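(* Let $1<p<\infty$, $-1<\alpha<p-2$, and let $g$ be an analytic function in the unit disc $\mathbb{D}$. Then the generalized Hilbert operator $\mathcal{H}_g:A^p_\alpha\to A^p_\alpha$ is bounded if and only if $g\in\Lambda\left(p,\frac1p\right)$.
   Context: $\mathbb{D}$ is the open unit disc, $\mathcal{H}ol(\mathbb{D})$ the space of analytic functions in $\mathbb{D}$, and $dA=\frac1\pi dx\,dy$. For $0<p<\infty$ and $\alpha>-1$, the weighted Bergman space $A^p_\alpha$ consists of $f\in\mathcal{H}ol(\mathbb{D})$ with $\|f\|_{A^p_\alpha}=\left((\alpha+1)\int_{\mathbb{D}}|f(z)|^p(1-|z|^2)^\alpha\,dA(z)\right)^{1/p}<\infty$. Given $g\in\mathcal{H}ol(\mathbb{D})$, the generalized Hilbert operator is $\mathcal{H}_g(f)(z)=\int_0^1 f(t)g'(tz)\,dt$, $z\in\mathbb{D}$, defined for $f\in\mathcal{H}ol(\mathbb{D})$ with $\int_0^1|f(t)|\,dt<\infty$ (this holds for every $f\in A^p_\alpha$ when $-1<\alpha<p-2$); then $\mathcal{H}_g(f)\in\mathcal{H}ol(\mathbb{D})$. Let $M_p(r,f)=\left(\frac1{2\pi}\int_0^{2\pi}|f(re^{it})|^p\,dt\right)^{1/p}$ and let $H^p$ be the Hardy space of $f\in\mathcal{H}ol(\mathbb{D})$ with $\sup_{0<r<1}M_p(r,f)<\infty$. Mean Lipschitz spaces: for $1\le p<\infty$ and $0<\alpha\le1$, $\Lambda(p,\alpha)$ is the set of $g\in H^p$ whose boundary function satisfies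 $\omega_p(g,t)=O(t^\alpha)$ as $t\to0$, where $\omega_p(g,t)=\sup_{0<h\le t}\left(\int_0^{2\pi}|g(e^{i(\theta+h)})-g(e^{i\theta})|^p\frac{d\theta}{2\pi}\right)^{1/p}$. Equivalently (Hardy–Littlewood), $\Lambda(p,\alpha)=\{g\in H^p: M_p(r,g')=O((1-r)^{\alpha-1}),\ r\to1^-\}$. *)

theory Defs
  imports "HOL-Complex_Analysis.Complex_Analysis" "HOL-Library.Landau_Symbols"
begin

text \<open>Functions on the unit disc are total functions on the complex numbers, of which
  only the values in \<^term>\<open>ball 0 1 :: complex set\<close> matter. The normalised area measure is
  Lebesgue measure divided by \<^term>\<open>pi\<close>.\<close>

definition bergman_norm :: "real \<Rightarrow> real \<Rightarrow> (complex \<Rightarrow> complex) \<Rightarrow> real" where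
  "bergman_norm p \<alpha> f =
     ((\<alpha> + 1) * ((1 / pi) *
        (LINT z:ball 0 1|lborel. cmod (f z) powr p * (1 - (cmod z)\<^sup>2) powr \<alpha>))) powr (1 / p)"

definition bergman_space :: "real \<Rightarrow> real \<Rightarrow> (complex \<Rightarrow> complex) set" where
  "bergman_space p \<alpha> = {f. f holomorphic_on ball 0 1 \<and>
     set_integrable lborel (ball 0 1) (\<lambda>z. cmod (f z) powr p * (1 - (cmod z)\<^sup>2) powr \<alpha>)}"

definition gen_hilbert :: "(complex \<Rightarrow> complex) \<Rightarrow> (complex \<Rightarrow> complex) \<Rightarrow> complex \<Rightarrow> complex" where
  "gen_hilbert g f z = (LBINT t=0..1. f (of_real t) * deriv g (of_real t * z))"

definition bounded_on_bergman ::
    "real \<Rightarrow> real \<Rightarrow> ((complex \<Rightarrow> complex) \<Rightarrow> complex \<Rightarrow> complex) \<Rightarrow> bool" where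
  "bounded_on_bergman p \<alpha> T \<longleftrightarrow>
     (\<forall>f\<in>bergman_space p \<alpha>. T f \<in> bergman_space p \<alpha>) \<and>
     (\<exists>C. \<forall>f\<in>bergman_space p \<alpha>. bergman_norm p \<alpha> (T f) \<le> C * bergman_norm p \<alpha> f)"

definition integral_mean :: "real \<Rightarrow> real \<Rightarrow> (complex \<Rightarrow> complex) \<Rightarrow> real" where
  "integral_mean p r f =
     ((1 / (2 * pi)) * (LINT t:{0..2 * pi}|lborel. cmod (f (rcis r t)) powr p)) powr (1 / p)"

definition hardy_space :: "real \<Rightarrow> (complex \<Rightarrow> complex) set" where
  "hardy_space p = {f. f holomorphic_on ball 0 1 \<and>
     bdd_above ((\<lambda>r. integral_mean p r f) ` {0<..<1})}"

text \<open>A boundary function is given by the radial limits almost everywhere. For members of a Hardy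
  space it exists by Fatou's theorem; it is determined up to a null set, and it is Lebesgue
  measurable since Lebesgue measure is complete.\<close>

definition is_boundary_function :: "(complex \<Rightarrow> complex) \<Rightarrow> (complex \<Rightarrow> complex) \<Rightarrow> bool" where
  "is_boundary_function g b \<longleftrightarrow>
     (AE \<theta> in lebesgue. ((\<lambda>r. g (rcis r \<theta>)) \<longlongrightarrow> b (cis \<theta>)) (at_left 1))"

text \<open>The argument is a function on the unit circle. If it is the boundary function of a member of
  \<^term>\<open>hardy_space p\<close>, it is \<open>p\<close>-integrable, so the integrals are genuine and the supremum is that of a
  bounded set.\<close>

definition modulus_of_continuity :: "real \<Rightarrow> (complex \<Rightarrow> complex) \<Rightarrow> real \<Rightarrow> real" where
  "modulus_of_continuity p b t =
     (SUP h\<in>{0<..t}. ((1 / (2 * pi)) *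
        (LINT \<theta>:{0..2 * pi}|lebesgue. cmod (b (cis (\<theta> + h)) - b (cis \<theta>)) powr p)) powr (1 / p))"

definition mean_lipschitz :: "real \<Rightarrow> real \<Rightarrow> (complex \<Rightarrow> complex) set" where
  "mean_lipschitz p a = {g \<in> hardy_space p. \<exists>b. is_boundary_function g b \<and>
     modulus_of_continuity p b \<in> O[at_right 0](\<lambda>t. t powr a)}"

end

theory Submission
  imports Defs
begin

text \<open>Both conditions are compared with the growth condition \<open>M\<^sub>p(r, g') = O((1 - r)^(1/p - 1))\<close>.
  Estimates of \<open>L\<^sup>p\<close> means on circles are reduced to scalar ones by duality: every mean of a
  holomorphic \<open>F\<close> is attained by a pairing \<open>h(z) = 1/2\<pi> \<integral> c(\<theta>) F(z e^(i\<theta>)) d\<theta>\<close> with \<open>c\<close> in the unit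
  ball of \<open>L\<^sup>q\<close>, and \<open>h\<close> is again holomorphic with \<open>\<bar>h(z)\<bar> \<le> M\<^sub>p(\<bar>z\<bar>, F)\<close>. The maximum principle,
  Cauchy's inequality and the scalar Hardy--Littlewood argument for \<open>h\<close> then give monotonicity of
  the means, derivative bounds and the equivalence of mean growth with the mean Lipschitz condition.

  Under the growth condition, \<open>M\<^sub>p(r, H f) \<le> C \<integral> \<bar>f(t)\<bar> (1 - tr)^(1/p - 1) dt\<close>, and a Schur test
  with a power weight bounds this by \<open>\<integral> \<bar>f(t)\<bar>^p (1 - t)^(\<alpha> + 1) dt\<close>, which the area mean value
  property bounds by the Bergman norm. Conversely, boundedness is tested on
  \<open>f(z) = z^(2L) (1 + z + \<dots> + z^(L - 1))\<close> with \<open>L \<approx> 1/(1 - r)\<close>: its norm is explicit, and \<open>g'\<close> is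
  recovered from \<open>H f\<close> by a first-order differential identity up to an absorbable error.\<close>

section \<open>Integration\<close>

text \<open>The exponent \<open>1 / p\<close> comes from scaling. Restriction to the diameter leaves
  the weight \<open>(1 - t) powr (\<alpha> + 1)\<close>, one power more than the weight
  \<open>(1 - r) powr \<alpha>\<close> of the target. The kernel
  \<open>(1 - t * r) powr (1 / p - 1)\<close>, integrated in \<open>t\<close>, gains
  \<open>1 / p\<close>, which the \<open>p\<close>-th power turns into exactly that one power; hence
  \<alpha> drops out of the condition on \<open>g\<close>. The test functions show the same
  cancellation: the \<open>p\<close>-th power of the norm is at most of order
  \<open>L powr (p - 2 - \<alpha>)\<close>, reading off a mean at radius \<open>R\<close> costs
  \<open>(1 - R) powr (- (\<alpha> + 1))\<close>, and for \<open>L\<close> about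
  \<open>1 / (1 - R)\<close> the product is \<open>(1 - R) powr (1 - p)\<close>. Their exponents
  start at \<open>2 * L\<close> because the image of \<open>z ^ m\<close> has mean at most
  \<open>1 / (m + 1)\<close> times that of \<open>g'\<close>: for \<open>m = 2 * L + j\<close> and
  \<open>j < L\<close> the coefficient \<open>j + 1\<close> of the error is at most half of
  \<open>m + 1\<close>. Duality removes all \<open>L^p\<close>-valued functions: \<open>c\<close> is
  chosen for one radius, a scalar theorem is applied to the pairing, and its constant does not
  depend on \<open>c\<close>.\<close>

lemma nn_integral_max_powr:
  fixes s A B :: real
  assumes s: "0 < s" and A: "-1 < A" and AB: "A + B < -1"
  shows "(\<integral>\<^sup>+u\<in>{0<..}. ennreal (u powr A * max u s powr B) \<partial>lborel)
    \<le> ennreal ((1 / (A + 1) - 1 / (A + B + 1)) * s powr (A + B + 1))"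
proof -
  \<comment> \<open>The integral is cut at \<open>u = s\<close>, where \<open>max u s\<close>
    changes from \<open>s\<close> to \<open>u\<close>. \<open>-1 < A\<close> is convergence at 0,
    \<open>A + B < -1\<close> convergence at infinity, and both pieces are homogeneous of degree
    \<open>A + B + 1\<close> in \<open>s\<close>.\<close>
  have 1: "(\<integral>\<^sup>+u. ennreal (indicator {0..s} u * u powr A) \<partial>lborel) = ennreal (s powr (A + 1) / (A + 1))"
    by (rule nn_integral_has_integral_lebesgue) (use has_integral_powr_from_0[of A s] s A in auto)
  have 2: "(\<integral>\<^sup>+u. ennreal (indicator {s..} u * u powr (A + B)) \<partial>lborel) = ennreal (- (s powr (A + B + 1)) / (A + B + 1))"
    by (rule nn_integral_has_integral_lebesgue) (use has_integral_powr_to_inf[of "A + B" s] s AB in auto)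
  have "(\<integral>\<^sup>+u\<in>{0<..}. ennreal (u powr A * max u s powr B) \<partial>lborel)
    \<le> (\<integral>\<^sup>+u. ennreal (s powr B) * ennreal (indicator {0..s} u * u powr A)
          + ennreal (indicator {s..} u * u powr (A + B)) \<partial>lborel)"
    by (intro nn_integral_mono)
       (auto simp: indicator_def max_def powr_add ennreal_mult'[symmetric] mult.commute)
  also have "\<dots> = ennreal (s powr B) * ennreal (s powr (A + 1) / (A + 1))
      + ennreal (- (s powr (A + B + 1)) / (A + B + 1))"
    by (simp add: nn_integral_add nn_integral_cmult 1 2)
  also have "\<dots> = ennreal (s powr B * (s powr (A + 1) / (A + 1)) + (- (s powr (A + B + 1)) / (A + B + 1)))"
    using A AB by (subst ennreal_plus) (auto simp: ennreal_mult'[symmetric] intro!: divide_nonneg_nonneg divide_nonneg_neg divide_nonpos_neg)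
  also have "s powr B * (s powr (A + 1) / (A + 1)) + (- (s powr (A + B + 1)) / (A + B + 1))
      = (1 / (A + 1) - 1 / (A + B + 1)) * s powr (A + B + 1)"
    by (simp add: powr_add field_simps)
  finally show ?thesis .
qed

lemma nn_integral_one_minus_powr_from:
  fixes b R :: real
  assumes "-1 < b" "R < 1"
  shows "(\<integral>\<^sup>+r\<in>{R..<1}. ennreal ((1 - r) powr b) \<partial>lborel) = ennreal ((1 - R) powr (b + 1) / (b + 1))"
proof -
  have "(\<integral>\<^sup>+r\<in>{R..<1}. ennreal ((1 - r) powr b) \<partial>lborel) = (\<integral>\<^sup>+r. ennreal (r powr b) * indicator {0<..1 - R} r \<partial>lborel)"
    by (subst nn_integral_real_affine[where c="-1" and t=1])
       (auto intro!: nn_integral_cong simp: indicator_def)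
  also have "\<dots> = (\<integral>\<^sup>+r. ennreal (indicator {0..1 - R} r * r powr b) \<partial>lborel)"
    by (intro nn_integral_cong) (auto simp: indicator_def)
  also have "\<dots> = ennreal ((1 - R) powr (b + 1) / (b + 1))"
    by (rule nn_integral_has_integral_lebesgue) (use has_integral_powr_from_0[of b "1 - R"] assms in auto)
  finally show ?thesis .
qed

lemma nn_integral_one_minus_powr:
  fixes b :: real
  assumes "-1 < b"
  shows "(\<integral>\<^sup>+r\<in>{0..<1}. ennreal ((1 - r) powr b) \<partial>lborel) = ennreal (1 / (b + 1))"
  using nn_integral_one_minus_powr_from[OF assms, of 0] by simp

text \<open>Formulated with real upper bounds \<open>A\<close> and \<open>B\<close> in place of the
  two integrals, so that it can be chained with estimates in \<open>ennreal\<close> without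
  computing any integral exactly.\<close>

lemma nn_integral_Holder:
  fixes f g :: "'a \<Rightarrow> real"
  assumes [measurable]: "f \<in> borel_measurable M" "g \<in> borel_measurable M"
    and nn: "\<And>x. 0 \<le> f x" "\<And>x. 0 \<le> g x"
    and pq: "1 < p" "1 < q" "1 / p + 1 / q = (1::real)"
    and A: "(\<integral>\<^sup>+x. ennreal (f x powr p) \<partial>M) \<le> ennreal A" "0 \<le> A"
    and B: "(\<integral>\<^sup>+x. ennreal (g x powr q) \<partial>M) \<le> ennreal B" "0 \<le> B"
  shows "(\<integral>\<^sup>+x. ennreal (f x * g x) \<partial>M) \<le> ennreal (A powr (1 / p) * B powr (1 / q))"
proof (cases "A = 0 \<or> B = 0")
  case True
  \<comment> \<open>The normalisation used in the other case divides by \<open>A\<close> and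
    \<open>B\<close>. If one of them is 0, the product vanishes almost everywhere.\<close>
  then have "AE x in M. ennreal (f x powr p) = 0 \<or> ennreal (g x powr q) = 0"
  proof
    assume "A = 0"
    then have "(\<integral>\<^sup>+x. ennreal (f x powr p) \<partial>M) = 0" using A by simp
    then show ?thesis by (subst (asm) nn_integral_0_iff_AE) auto
  next
    assume "B = 0"
    then have "(\<integral>\<^sup>+x. ennreal (g x powr q) \<partial>M) = 0" using B by simp
    then show ?thesis by (subst (asm) nn_integral_0_iff_AE) auto
  qed
  then have "AE x in M. ennreal (f x * g x) = 0"
    by eventually_elim (auto simp: ennreal_eq_0_iff)
  then have "(\<integral>\<^sup>+x. ennreal (f x * g x) \<partial>M) = 0"
    by (subst nn_integral_0_iff_AE) auto
  then show ?thesis by simp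
next
  case False
  define a where "a = A powr (1 / p)"
  define b where "b = B powr (1 / q)"
  have a: "0 < a" "a powr p = A" and b: "0 < b" "b powr q = B"
    using False A B pq by (auto simp: a_def b_def powr_powr)
  \<comment> \<open>Young's inequality for \<open>f x / a\<close> and \<open>g x / b\<close>,
    multiplied by \<open>a * b\<close>; after integration the two terms add up to
    \<open>a * b * (1 / p + 1 / q)\<close>.\<close>
  have "ennreal (f x * g x) \<le> ennreal (a * b / (p * A)) * ennreal (f x powr p)
      + ennreal (a * b / (q * B)) * ennreal (g x powr q)" for x
  proof -
    have "(f x / a) * (g x / b) \<le> (f x / a) powr p / p + (g x / b) powr q / q"
      using pq nn[of x] a b by (intro Youngs_inequality) auto
    also have "\<dots> = f x powr p / (p * A) + g x powr q / (q * B)"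
      using nn[of x] a b by (simp add: powr_divide mult.commute)
    finally have "f x * g x \<le> a * b * (f x powr p / (p * A) + g x powr q / (q * B))"
      using a b by (simp add: field_simps)
    also have "\<dots> = a * b / (p * A) * f x powr p + a * b / (q * B) * g x powr q"
      by (simp add: field_simps)
    finally show ?thesis
      using pq a b A B by (simp add: ennreal_mult[symmetric] ennreal_plus[symmetric] del: ennreal_plus)
  qed
  then have "(\<integral>\<^sup>+x. ennreal (f x * g x) \<partial>M) \<le>
     (\<integral>\<^sup>+x. ennreal (a * b / (p * A)) * ennreal (f x powr p)
      + ennreal (a * b / (q * B)) * ennreal (g x powr q) \<partial>M)"
    by (intro nn_integral_mono)
  also have "\<dots> = ennreal (a * b / (p * A)) * (\<integral>\<^sup>+x. ennreal (f x powr p) \<partial>M)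
      + ennreal (a * b / (q * B)) * (\<integral>\<^sup>+x. ennreal (g x powr q) \<partial>M)"
    by (simp add: nn_integral_add nn_integral_cmult)
  also have "\<dots> \<le> ennreal (a * b / (p * A)) * ennreal A + ennreal (a * b / (q * B)) * ennreal B"
    by (intro add_mono mult_left_mono A B) auto
  also have "\<dots> = ennreal (a * b / (p * A) * A + a * b / (q * B) * B)"
    using pq a b A B by (simp add: ennreal_mult[symmetric] ennreal_plus[symmetric] del: ennreal_plus)
  also have "a * b / (p * A) * A + a * b / (q * B) * B = a * b * (1 / p + 1 / q)"
    using False by (simp add: field_simps)
  finally show ?thesis using pq by (simp add: a_def b_def)
qed

section \<open>Plane Lebesgue measure: rotations and polar coordinates\<close>

lemma lborel_complex_eq: "distr lborel borel (\<lambda>(x, y). Complex x y) = lborel"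
proof (rule lborel_eqI[symmetric])
  have [measurable]: "(\<lambda>(x, y). Complex x y) \<in> borel_measurable (lborel \<Otimes>\<^sub>M lborel)"
    unfolding lborel_prod by (auto simp: complex_eq case_prod_beta intro!: borel_measurable_continuous_onI continuous_intros)
  fix l u :: complex
  assume lu: "\<And>b. b \<in> Basis \<Longrightarrow> l \<bullet> b \<le> u \<bullet> b"
  have "(\<lambda>(x, y). Complex x y) -` box l u \<inter> space lborel = box (Re l, Im l) (Re u, Im u)"
    by (auto simp: box_def Basis_complex_def Basis_prod_def inner_complex_def)
  then show "emeasure (distr lborel borel (\<lambda>(x, y). Complex x y)) (box l u) = ennreal (\<Prod>b\<in>Basis. (u - l) \<bullet> b)"
    using lu[of 1] lu[of \<i>]
    by (subst emeasure_distr)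
       (auto simp: lborel_prod Basis_complex_def emeasure_lborel_box_eq Basis_prod_def inner_complex_def prod.union_disjoint
          complex_eq case_prod_beta intro!: borel_measurable_continuous_onI continuous_intros)
qed simp

text \<open>On each line parallel to the shear the map is a translation, so Tonelli and translation
  invariance in one variable suffice. Rotations are then composed of shears.\<close>

lemma nn_integral_shear:
  fixes f :: "real \<times> real \<Rightarrow> ennreal" and a :: real
  assumes [measurable]: "f \<in> borel_measurable borel"
  shows "(\<integral>\<^sup>+z. f (fst z + a * snd z, snd z) \<partial>lborel) = (\<integral>\<^sup>+z. f z \<partial>lborel)"
    and "(\<integral>\<^sup>+z. f (fst z, snd z + a * fst z) \<partial>lborel) = (\<integral>\<^sup>+z. f z \<partial>lborel)"
proof -
  have [measurable]: "f \<in> borel_measurable (lborel \<Otimes>\<^sub>M lborel)" by (simp add: lborel_prod)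
  have "(\<integral>\<^sup>+y. \<integral>\<^sup>+x. f (x + a * y, y) \<partial>lborel \<partial>lborel) = (\<integral>\<^sup>+y. \<integral>\<^sup>+x. f (x, y) \<partial>lborel \<partial>lborel)"
  proof (rule nn_integral_cong)
    fix y show "(\<integral>\<^sup>+x. f (x + a * y, y) \<partial>lborel) = (\<integral>\<^sup>+x. f (x, y) \<partial>lborel)"
      using nn_integral_real_affine[of "\<lambda>x. f (x, y)" 1 "a * y"] by (simp add: add.commute)
  qed
  then show "(\<integral>\<^sup>+z. f (fst z + a * snd z, snd z) \<partial>lborel) = (\<integral>\<^sup>+z. f z \<partial>lborel)"
    unfolding lborel_prod[symmetric] by (simp add: lborel_pair.nn_integral_snd[symmetric] )
  have "(\<integral>\<^sup>+x. \<integral>\<^sup>+y. f (x, y + a * x) \<partial>lborel \<partial>lborel) = (\<integral>\<^sup>+x. \<integral>\<^sup>+y. f (x, y) \<partial>lborel \<partial>lborel)"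
  proof (rule nn_integral_cong)
    fix x show "(\<integral>\<^sup>+y. f (x, y + a * x) \<partial>lborel) = (\<integral>\<^sup>+y. f (x, y) \<partial>lborel)"
      using nn_integral_real_affine[of "\<lambda>y. f (x, y)" 1 "a * x"] by (simp add: add.commute)
  qed
  then show "(\<integral>\<^sup>+z. f (fst z, snd z + a * fst z) \<partial>lborel) = (\<integral>\<^sup>+z. f z \<partial>lborel)"
    unfolding lborel_prod[symmetric] by (simp add: lborel.nn_integral_fst[symmetric])
qed

lemma nn_integral_complex_pair:
  fixes f :: "complex \<Rightarrow> ennreal"
  assumes [measurable]: "f \<in> borel_measurable borel"
  shows "(\<integral>\<^sup>+z. f z \<partial>lborel) = (\<integral>\<^sup>+z. f (Complex (fst z) (snd z)) \<partial>lborel)"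
proof -
  have "(\<lambda>(x, y). Complex x y) \<in> borel_measurable lborel"
    by (auto simp: complex_eq case_prod_beta intro!: borel_measurable_continuous_onI continuous_intros)
  then show ?thesis
    by (subst lborel_complex_eq[symmetric], subst nn_integral_distr) (auto simp: case_prod_beta)
qed

lemma nn_integral_complex_rotate:
  fixes f :: "complex \<Rightarrow> ennreal"
  assumes f[measurable]: "f \<in> borel_measurable borel" and c: "norm c = 1"
  shows "(\<integral>\<^sup>+z. f (c * z) \<partial>lborel) = (\<integral>\<^sup>+z. f z \<partial>lborel)"
proof -
  have main: "(\<integral>\<^sup>+z. f (c * z) \<partial>lborel) = (\<integral>\<^sup>+z. f z \<partial>lborel)"
    if f[measurable]: "f \<in> borel_measurable borel" and c: "norm c = 1" "c \<noteq> -1"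
    for f :: "complex \<Rightarrow> ennreal" and c
  proof -
    define u v where "u = Re c" and "v = Im c"
    have uv: "u\<^sup>2 + v\<^sup>2 = 1" using c(1) by (simp add: u_def v_def cmod_def)
    have u1: "1 + u \<noteq> 0"
    proof
      assume "1 + u = 0"
      then have "u = -1" by simp
      with uv have "v = 0" by simp
      with \<open>u = -1\<close> have "c = -1" by (simp add: u_def v_def complex_eq_iff)
      with c(2) show False by simp
    qed
    \<comment> \<open>A rotation other than \<open>-1\<close> is a product of three shears with parameters \<open>-\<tau>, v, -\<tau>\<close>.\<close>
    define \<tau> where "\<tau> = v / (1 + u)"
    have \<tau>1: "\<tau> * (1 + u) = v" using u1 by (simp add: \<tau>_def)
    have "v * \<tau> * (1 + u) = (1 - u) * (1 + u)"
      using uv by (simp only: mult.assoc \<tau>1) (simp add: power2_eq_square algebra_simps)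
    then have \<tau>2: "v * \<tau> = 1 - u" using u1 by simp
    define F where "F z = f (Complex (fst z) (snd z))" for z
    have F[measurable]: "F \<in> borel_measurable borel"
    proof -
      have "(\<lambda>z. Complex (fst z) (snd z)) \<in> borel_measurable borel"
        by (auto simp: complex_eq intro!: borel_measurable_continuous_onI continuous_intros)
      from measurable_compose[OF this f] show ?thesis by (simp add: F_def[abs_def])
    qed
    have eq: "F ((fst z + (- \<tau>) * snd z) + (- \<tau>) * (snd z + v * (fst z + (- \<tau>) * snd z)), snd z + v * (fst z + (- \<tau>) * snd z))
        = f (c * Complex (fst z) (snd z))" for z
    proof -
      obtain x y where z: "z = (x, y)" by (cases z)
      have "y + v * (x - \<tau> * y) = v * x + (1 - v * \<tau>) * y" by (simp add: algebra_simps)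
      then have y': "y + v * (x - \<tau> * y) = v * x + u * y" by (simp add: \<tau>2)
      have "(x - \<tau> * y) - \<tau> * (v * x + u * y) = (1 - v * \<tau>) * x - \<tau> * (1 + u) * y" by (simp add: algebra_simps)
      then have x': "(x - \<tau> * y) - \<tau> * (v * x + u * y) = u * x - v * y" by (simp add: \<tau>1 \<tau>2)
      have "c * Complex x y = Complex (u * x - v * y) (v * x + u * y)"
        by (simp add: complex_eq_iff u_def v_def)
      then show ?thesis using x' y' by (simp add: z F_def)
    qed
    have S1: "(\<lambda>z. F (fst z + (- \<tau>) * snd z, snd z)) \<in> borel_measurable borel"
      by (rule measurable_compose[OF _ F], rule borel_measurable_continuous_onI, intro continuous_intros)
    have S2: "(\<lambda>z. F (fst z + (- \<tau>) * (snd z + v * fst z), snd z + v * fst z)) \<in> borel_measurable borel"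
      by (rule measurable_compose[OF _ F], rule borel_measurable_continuous_onI, intro continuous_intros)
    have "(\<integral>\<^sup>+z. f z \<partial>lborel) = (\<integral>\<^sup>+z. F z \<partial>lborel)"
      by (simp add: nn_integral_complex_pair F_def)
    also have "\<dots> = (\<integral>\<^sup>+z. F (fst z + (- \<tau>) * snd z, snd z) \<partial>lborel)"
      by (rule nn_integral_shear(1)[symmetric]) simp
    also have "\<dots> = (\<integral>\<^sup>+z. F (fst z + (- \<tau>) * (snd z + v * fst z), snd z + v * fst z) \<partial>lborel)"
      by (subst nn_integral_shear(2)[symmetric, where a=v]) (use S1 in auto)
    also have "\<dots> = (\<integral>\<^sup>+z. f (c * Complex (fst z) (snd z)) \<partial>lborel)"
      unfolding eq[symmetric] by (subst nn_integral_shear(1)[symmetric, where a="- \<tau>"]) (use S2 in auto)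
    also have "\<dots> = (\<integral>\<^sup>+z. f (c * z) \<partial>lborel)"
      by (simp add: nn_integral_complex_pair)
    finally show ?thesis by simp
  qed
  show ?thesis
  proof (cases "c = -1")
    case True
    \<comment> \<open>The half-turn is the one rotation whose shear parameter
      \<open>v / (1 + u)\<close> is undefined; it is two quarter-turns.\<close>
    have "\<i> \<noteq> -1" by (simp add: complex_eq_iff)
    then have "(\<integral>\<^sup>+z. f (\<i> * (\<i> * z)) \<partial>lborel) = (\<integral>\<^sup>+z. f z \<partial>lborel)"
      using main[of "\<lambda>z. f (\<i> * z)" \<i>] main[of f \<i>] by simp
    then show ?thesis using True by (simp add: mult.assoc[symmetric])
  qed (use main f c in auto)
qed

lemma borel_measurable_cis [measurable]: "cis \<in> borel_measurable borel"
  by (intro borel_measurable_continuous_onI continuous_on_cis continuous_on_id)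

text \<open>With \<open>\<psi>\<close> the residue of \<open>\<phi>\<close> modulo
  \<open>2 * pi\<close>, the period is cut at \<open>\<psi>\<close> and the two pieces are
  translated by \<open>\<psi>\<close> and \<open>\<psi> - 2 * pi\<close>, which makes them change
  places. The resulting half-open pieces fail to partition \<open>{0..2*pi}\<close> only at the
  points \<open>2 * pi - \<psi>\<close> and \<open>2 * pi\<close>, a null set.\<close>

lemma nn_integral_cis_shift:
  fixes H :: "complex \<Rightarrow> ennreal"
  assumes [measurable]: "H \<in> borel_measurable borel"
  shows "(\<integral>\<^sup>+\<theta>\<in>{0..2*pi}. H (cis (\<theta> + \<phi>)) \<partial>lborel) = (\<integral>\<^sup>+\<theta>\<in>{0..2*pi}. H (cis \<theta>) \<partial>lborel)"
proof -
  define k where "k = \<lfloor>\<phi> / (2*pi)\<rfloor>"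
  define \<psi> where "\<psi> = \<phi> - 2 * pi * of_int k"
  have "of_int k \<le> \<phi> / (2*pi)" "\<phi> / (2*pi) < of_int k + 1"
    unfolding k_def by linarith+
  then have \<psi>: "0 \<le> \<psi>" "\<psi> < 2 * pi"
    by (simp_all add: \<psi>_def field_simps)
  have cis: "cis (\<theta> + \<phi>) = cis (\<theta> + \<psi>)" for \<theta>
  proof -
    have "cis (\<theta> + \<phi>) = cis (\<theta> + \<psi>) * cis (2 * pi * of_int k)"
      by (simp add: cis_mult \<psi>_def algebra_simps)
    then show ?thesis by (simp add: cis_multiple_2pi)
  qed
  have c2: "cis (2 * pi + x) = cis x" for x
    by (simp add: cis_mult[symmetric])
  have c3: "cis (x + (\<psi> - 2 * pi)) = cis (x + \<psi>)" for x
    using c2[of "x + (\<psi> - 2 * pi)"] by (simp add: algebra_simps)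
  have [measurable]: "(\<lambda>x. H (cis x)) \<in> borel_measurable borel"
    by measurable
  have [measurable]: "(\<lambda>x. H (cis (x + a))) \<in> borel_measurable borel" for a
    by measurable
  have "(\<integral>\<^sup>+\<theta>\<in>{0..2*pi}. H (cis \<theta>) \<partial>lborel) =
     (\<integral>\<^sup>+\<theta>. H (cis \<theta>) * indicator {0..<\<psi>} \<theta> + H (cis \<theta>) * indicator {\<psi>..2*pi} \<theta> \<partial>lborel)"
    using \<psi> by (intro nn_integral_cong) (auto simp: indicator_def)
  also have "\<dots> = (\<integral>\<^sup>+\<theta>. H (cis \<theta>) * indicator {0..<\<psi>} \<theta> \<partial>lborel) + (\<integral>\<^sup>+\<theta>. H (cis \<theta>) * indicator {\<psi>..2*pi} \<theta> \<partial>lborel)"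
    by (rule nn_integral_add) measurable
  also have "(\<integral>\<^sup>+\<theta>. H (cis \<theta>) * indicator {0..<\<psi>} \<theta> \<partial>lborel)
      = (\<integral>\<^sup>+\<theta>. H (cis (\<theta> + \<psi>)) * indicator {2*pi - \<psi>..<2 * pi} \<theta> \<partial>lborel)"
    by (subst nn_integral_real_affine[where c=1 and t="\<psi> - 2 * pi"])
       (auto intro!: nn_integral_cong simp: indicator_def c3 add.commute[of "\<psi> - 2 * pi"])
  also have "(\<integral>\<^sup>+\<theta>. H (cis \<theta>) * indicator {\<psi>..2*pi} \<theta> \<partial>lborel)
      = (\<integral>\<^sup>+\<theta>. H (cis (\<theta> + \<psi>)) * indicator {0..2 * pi - \<psi>} \<theta> \<partial>lborel)"
    by (subst nn_integral_real_affine[where c=1 and t="\<psi>"])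
       (auto intro!: nn_integral_cong simp: indicator_def add.commute)
  also have "(\<integral>\<^sup>+\<theta>. H (cis (\<theta> + \<psi>)) * indicator {2*pi - \<psi>..<2 * pi} \<theta> \<partial>lborel) +
     (\<integral>\<^sup>+\<theta>. H (cis (\<theta> + \<psi>)) * indicator {0..2 * pi - \<psi>} \<theta> \<partial>lborel)
     = (\<integral>\<^sup>+\<theta>. H (cis (\<theta> + \<psi>)) * indicator {2*pi - \<psi>..<2 * pi} \<theta> + H (cis (\<theta> + \<psi>)) * indicator {0..2 * pi - \<psi>} \<theta> \<partial>lborel)"
    by (rule nn_integral_add[symmetric]) measurable
  also have "\<dots> = (\<integral>\<^sup>+\<theta>\<in>{0..2*pi}. H (cis (\<theta> + \<psi>)) \<partial>lborel)"
  proof (rule nn_integral_cong_AE)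
    show "AE \<theta> in lborel. H (cis (\<theta> + \<psi>)) * indicator {2*pi - \<psi>..<2 * pi} \<theta> + H (cis (\<theta> + \<psi>)) * indicator {0..2 * pi - \<psi>} \<theta>
        = H (cis (\<theta> + \<psi>)) * indicator {0..2*pi} \<theta>"
      using AE_lborel_singleton[of "2 * pi"] AE_lborel_singleton[of "2 * pi - \<psi>"]
      by eventually_elim (use \<psi> in \<open>auto simp: indicator_def\<close>)
  qed
  finally show ?thesis by (simp add: cis)
qed

text \<open>A measure on the line that is finite on the half-lines \<open>{x<..}\<close> is
  determined by its values there. For the image of the disc under \<open>cmod\<close> such a value
  is the area of an annulus, for the density \<open>2 * pi * r\<close> an elementary integral;
  \<open>max x 0\<close> takes care of negative \<open>x\<close>.\<close>

lemma nn_integral_radial: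
  fixes m :: "real \<Rightarrow> ennreal"
  assumes [measurable]: "m \<in> borel_measurable borel"
  shows "(\<integral>\<^sup>+z\<in>ball (0::complex) 1. m (cmod z) \<partial>lborel) = (\<integral>\<^sup>+r\<in>{0<..<1}. ennreal (2 * pi * r) * m r \<partial>lborel)"
proof -
  define M where "M = distr (density lborel (indicator (ball (0::complex) 1))) borel cmod"
  define N where "N = density lborel (\<lambda>r. indicator {0<..<1} r * ennreal (2 * pi * r))"
  have [simp]: "sets M = sets borel" "sets N = sets borel" by (simp_all add: M_def N_def)
  have M: "emeasure M {x<..} = ennreal (if x < 1 then pi * (1 - (max x 0)\<^sup>2) else 0)" for x
  proof -
    have "emeasure M {x<..} = emeasure lborel (ball (0::complex) 1 \<inter> {z. x < cmod z})"
      unfolding M_def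
    proof -
      have "emeasure (density lborel (indicator (ball (0::complex) 1))) {z. x < cmod z}
          = (\<integral>\<^sup>+z. indicator (ball 0 1) z * indicator {z. x < cmod z} z \<partial>lborel)"
        by (rule emeasure_density) (auto intro: borel_measurable_indicator)
      also have "\<dots> = (\<integral>\<^sup>+z. indicator (ball 0 1 \<inter> {z. x < cmod z}) z \<partial>lborel)"
        by (simp only: indicator_inter_arith)
      also have "\<dots> = emeasure lborel (ball (0::complex) 1 \<inter> {z. x < cmod z})"
        by (rule nn_integral_indicator) measurable
      finally show "emeasure (distr (density lborel (indicator (ball 0 1))) borel cmod) {x<..}
          = emeasure lborel (ball (0::complex) 1 \<inter> {z. x < cmod z})"
        by (subst emeasure_distr) (auto simp: vimage_def)
    qed
    also have "\<dots> = ennreal (if x < 1 then pi * (1 - (max x 0)\<^sup>2) else 0)"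
    proof -
      consider "x < 0" | "0 \<le> x" "x < 1" | "1 \<le> x" by linarith
      then show ?thesis
      proof cases
        case 1
        then have "ball (0::complex) 1 \<inter> {z. x < cmod z} = ball 0 1"
          by (auto intro: less_le_trans)
        then show ?thesis using 1 by (simp add: emeasure_ball eval_unit_ball_vol)
      next
        case 2
        then have "ball (0::complex) 1 \<inter> {z. x < cmod z} = ball 0 1 - cball 0 x"
          by auto
        then show ?thesis using 2
          by (simp add: emeasure_Diff emeasure_ball emeasure_cball eval_unit_ball_vol cball_subset_ball_iff
            ennreal_minus algebra_simps)
      next
        case 3
        then have "ball (0::complex) 1 \<inter> {z. x < cmod z} = {}" by auto
        then show ?thesis using 3 by simp
      qed
    qed
    finally show ?thesis .
  qed
  have N: "emeasure N {x<..} = ennreal (if x < 1 then pi * (1 - (max x 0)\<^sup>2) else 0)" for x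
  proof -
    have "emeasure N {x<..} = (\<integral>\<^sup>+r. indicator {0<..<1} r * ennreal (2 * pi * r) * indicator {x<..} r \<partial>lborel)"
      unfolding N_def by (subst emeasure_density) auto
    also have "\<dots> = (if x < 1 then (\<integral>\<^sup>+r. ennreal (2 * pi * r) * indicator {max x 0..1} r \<partial>lborel) else 0)"
    proof (cases "x < 1")
      case True
      have "(\<integral>\<^sup>+r. indicator {0<..<1} r * ennreal (2 * pi * r) * indicator {x<..} r \<partial>lborel)
          = (\<integral>\<^sup>+r. ennreal (2 * pi * r) * indicator {max x 0..1} r \<partial>lborel)"
      proof (rule nn_integral_cong_AE)
        show "AE r in lborel. indicator {0<..<1} r * ennreal (2 * pi * r) * indicator {x<..} r
            = ennreal (2 * pi * r) * indicator {max x 0..1} r"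
          using AE_lborel_singleton[of "max x 0"] AE_lborel_singleton[of 1]
          by eventually_elim (auto simp: indicator_def)
      qed
      then show ?thesis using True by simp
    next
      case False
      then have "(\<integral>\<^sup>+r. indicator {0<..<1} r * ennreal (2 * pi * r) * indicator {x<..} r \<partial>lborel) = (\<integral>\<^sup>+r. 0 \<partial>(lborel :: real measure))"
        by (intro nn_integral_cong) (auto simp: indicator_def)
      then show ?thesis using False by simp
    qed
    also have "\<dots> = ennreal (if x < 1 then pi * (1 - (max x 0)\<^sup>2) else 0)"
    proof (cases "x < 1")
      case True
      have "(\<integral>\<^sup>+r. ennreal (2 * pi * r) * indicator {max x 0..1} r \<partial>lborel) = pi * 1\<^sup>2 - pi * (max x 0)\<^sup>2"
        by (rule nn_integral_FTC_Icc[where F="\<lambda>r. pi * r\<^sup>2"]) (use True in \<open>auto intro!: derivative_eq_intros\<close>)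
      then show ?thesis using True by (simp add: algebra_simps)
    qed simp
    finally show ?thesis .
  qed
  have MN: "M = N"
    by (rule measure_eqI_lessThan) (auto simp: M N)
  have "(\<integral>\<^sup>+r. m r \<partial>M) = (\<integral>\<^sup>+z. m (cmod z) \<partial>density lborel (indicator (ball (0::complex) 1)))"
    unfolding M_def by (rule nn_integral_distr) auto
  also have "\<dots> = (\<integral>\<^sup>+z. indicator (ball 0 1) z * m (cmod z) \<partial>lborel)"
    by (rule nn_integral_density) (auto intro: borel_measurable_indicator)
  finally have "(\<integral>\<^sup>+z\<in>ball (0::complex) 1. m (cmod z) \<partial>lborel) = (\<integral>\<^sup>+r. m r \<partial>M)"
    by (simp add: mult.commute)
  also have "\<dots> = (\<integral>\<^sup>+r\<in>{0<..<1}. ennreal (2 * pi * r) * m r \<partial>lborel)"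
    unfolding MN N_def by (subst nn_integral_density) (auto simp: mult_ac)
  finally show ?thesis .
qed

text \<open>By rotation invariance the integral equals its average over all rotations of the
  integrand. Tonelli moves the average inside, where it depends on \<open>cmod z\<close> alone, and
  the radial case applies. No Jacobian is computed.\<close>

lemma nn_integral_polar:
  fixes F :: "complex \<Rightarrow> ennreal"
  assumes [measurable]: "F \<in> borel_measurable borel"
  shows "(\<integral>\<^sup>+z\<in>ball 0 1. F z \<partial>lborel) =
    (\<integral>\<^sup>+r\<in>{0<..<1}. ennreal r * (\<integral>\<^sup>+\<theta>\<in>{0..2*pi}. F (rcis r \<theta>) \<partial>lborel) \<partial>lborel)"
proof -
  define m where "m r = (\<integral>\<^sup>+\<theta>\<in>{0..2*pi}. F (rcis r \<theta>) \<partial>lborel)" for r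
  have m[measurable]: "m \<in> borel_measurable borel"
    unfolding m_def rcis_def by measurable
  have ms: "m (cmod z) = (\<integral>\<^sup>+\<theta>\<in>{0..2*pi}. F (cis \<theta> * z) \<partial>lborel)" for z
  proof -
    have z: "z = of_real (cmod z) * cis (Arg z)" using rcis_cmod_Arg[of z] by (simp add: rcis_def)
    have "(\<integral>\<^sup>+\<theta>\<in>{0..2*pi}. F (cis \<theta> * z) \<partial>lborel) = (\<integral>\<^sup>+\<theta>\<in>{0..2*pi}. F (of_real (cmod z) * cis (\<theta> + Arg z)) \<partial>lborel)"
      by (subst z) (simp add: cis_mult[symmetric] mult_ac)
    also have "\<dots> = m (cmod z)"
      unfolding m_def rcis_def
      by (rule nn_integral_cis_shift[of "\<lambda>w. F (of_real (cmod z) * w)"]) measurable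
    finally show ?thesis ..
  qed
  define G where "G z = F z * indicator (ball 0 1) z" for z
  have G[measurable]: "G \<in> borel_measurable borel"
    unfolding G_def[abs_def] by (intro borel_measurable_times_ennreal borel_measurable_indicator) auto
  have "ennreal (2 * pi) * (\<integral>\<^sup>+z. G z \<partial>lborel) = (\<integral>\<^sup>+\<theta>. (\<integral>\<^sup>+z. G (cis \<theta> * z) \<partial>lborel) * indicator {0..2*pi} \<theta> \<partial>lborel)"
    by (subst nn_integral_complex_rotate) (auto simp: nn_integral_cmult_indicator mult.commute)
  also have "\<dots> = (\<integral>\<^sup>+\<theta>. (\<integral>\<^sup>+z. G (cis \<theta> * z) * indicator {0..2*pi} \<theta> \<partial>lborel) \<partial>lborel)"
    by (intro nn_integral_cong nn_integral_multc[symmetric]) measurable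
  also have "\<dots> = (\<integral>\<^sup>+z. (\<integral>\<^sup>+\<theta>. G (cis \<theta> * z) * indicator {0..2*pi} \<theta> \<partial>lborel) \<partial>lborel)"
    by (rule lborel_pair.Fubini') measurable
  also have "\<dots> = (\<integral>\<^sup>+z\<in>ball 0 1. m (cmod z) \<partial>lborel)"
    unfolding ms by (intro nn_integral_cong) (auto simp: G_def indicator_def norm_mult)
  also have "\<dots> = (\<integral>\<^sup>+r\<in>{0<..<1}. ennreal (2 * pi * r) * m r \<partial>lborel)"
    by (rule nn_integral_radial) measurable
  also have "\<dots> = (\<integral>\<^sup>+r. ennreal (2 * pi) * (ennreal r * m r * indicator {0<..<1} r) \<partial>lborel)"
    by (intro nn_integral_cong) (auto simp: indicator_def ennreal_mult mult_ac)
  also have "\<dots> = ennreal (2 * pi) * (\<integral>\<^sup>+r\<in>{0<..<1}. ennreal r * m r \<partial>lborel)"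
    by (rule nn_integral_cmult) measurable
  finally show ?thesis
    by (subst (asm) ennreal_mult_cancel_left) (auto simp: m_def G_def[abs_def])
qed

section \<open>Circle means and duality\<close>

lemma set_integrable_continuous:
  fixes h :: "real \<Rightarrow> 'a::euclidean_space"
  assumes "continuous_on UNIV h"
  shows "set_integrable lborel {a..b} h"
  by (rule borel_integrable_atLeastAtMost') (use assms continuous_on_subset in blast)

lemma continuous_on_circle:
  assumes "continuous_on (ball 0 1) F" "cmod z < 1"
  shows "continuous_on A (\<lambda>\<theta>. F (z * cis \<theta>))"
  by (rule continuous_on_compose2[OF assms(1)]) (use assms(2) in \<open>auto intro!: continuous_intros simp: norm_mult\<close>)

lemma continuous_on_norm_powr:
  assumes "continuous_on A (F :: 'a::topological_space \<Rightarrow> complex)" "0 < p"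
  shows "continuous_on A (\<lambda>x. cmod (F x) powr p)"
  using assms by (intro continuous_on_powr' continuous_intros) auto

text \<open>Passage from the Bochner integral inside \<open>integral_mean\<close> to extended
  nonnegative integrals. Continuity makes the integrand integrable on the circle, so the value is
  genuine and not the default 0.\<close>

lemma nn_integral_mean:
  assumes F: "continuous_on (ball 0 1) F" and r: "0 \<le> r" "r < 1" and p: "0 < p"
  shows "(\<integral>\<^sup>+\<theta>\<in>{0..2*pi}. ennreal (cmod (F (rcis r \<theta>)) powr p) \<partial>lborel)
    = ennreal (2 * pi * integral_mean p r F powr p)"
proof -
  define h where "h \<theta> = cmod (F (rcis r \<theta>)) powr p" for \<theta>
  have "continuous_on UNIV h"
    unfolding h_def rcis_def using F r p by (intro continuous_on_norm_powr continuous_on_circle) auto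
  then have int: "set_integrable lborel {0..2*pi} h" by (rule set_integrable_continuous)
  have "(\<integral>\<^sup>+\<theta>\<in>{0..2*pi}. ennreal (h \<theta>) \<partial>lborel) = (\<integral>\<^sup>+\<theta>. ennreal (indicator {0..2*pi} \<theta> *\<^sub>R h \<theta>) \<partial>lborel)"
    by (intro nn_integral_cong) (auto simp: indicator_def)
  also have "\<dots> = ennreal (LINT \<theta>:{0..2*pi}|lborel. h \<theta>)"
    unfolding set_lebesgue_integral_def
    by (rule nn_integral_eq_integral) (use int in \<open>auto simp: set_integrable_def h_def\<close>)
  also have "(LINT \<theta>:{0..2*pi}|lborel. h \<theta>) = 2 * pi * integral_mean p r F powr p"
  proof -
    have "0 \<le> (LINT \<theta>:{0..2*pi}|lborel. h \<theta>)"
      unfolding set_lebesgue_integral_def by (intro integral_nonneg_AE) (auto simp: h_def)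
    then show ?thesis using p by (simp add: integral_mean_def powr_powr h_def)
  qed
  finally show ?thesis by (simp add: h_def)
qed

lemma integral_mean_nonneg [simp]: "0 \<le> integral_mean p r F"
  by (simp add: integral_mean_def)

text \<open>Outside the disc a function may take arbitrary values. Cutting it off there gives a
  Borel function on the whole plane, as Tonelli and polar coordinates require; primed copies such as
  \<open>F'\<close> and \<open>f'\<close> are made this way.\<close>

lemma borel_measurable_disc:
  assumes "continuous_on (ball 0 1) (F :: complex \<Rightarrow> complex)"
  shows "(\<lambda>w. indicator (ball 0 1) w *\<^sub>R F w) \<in> borel_measurable borel"
  by (rule borel_measurable_continuous_on_indicator) (use assms in auto)

lemma nn_integral_mean_shift:
  assumes F: "continuous_on (ball 0 1) F" and z: "cmod z < 1" and p: "0 < p"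
  shows "(\<integral>\<^sup>+\<theta>\<in>{0..2*pi}. ennreal (cmod (F (z * cis \<theta>)) powr p) \<partial>lborel)
    = ennreal (2 * pi * integral_mean p (cmod z) F powr p)"
proof -
  define F' where "F' w = indicator (ball 0 1) w *\<^sub>R F w" for w
  have [measurable]: "F' \<in> borel_measurable borel"
    unfolding F'_def[abs_def] by (rule borel_measurable_disc[OF F])
  have z': "z = of_real (cmod z) * cis (Arg z)" using rcis_cmod_Arg[of z] by (simp add: rcis_def)
  have "(\<integral>\<^sup>+\<theta>\<in>{0..2*pi}. ennreal (cmod (F (z * cis \<theta>)) powr p) \<partial>lborel)
    = (\<integral>\<^sup>+\<theta>\<in>{0..2*pi}. ennreal (cmod (F' (of_real (cmod z) * cis (\<theta> + Arg z))) powr p) \<partial>lborel)"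
    by (subst z', intro nn_integral_cong) (use z in \<open>auto simp: F'_def norm_mult cis_mult[symmetric] mult_ac\<close>)
  also have "\<dots> = (\<integral>\<^sup>+\<theta>\<in>{0..2*pi}. ennreal (cmod (F' (of_real (cmod z) * cis \<theta>)) powr p) \<partial>lborel)"
    by (rule nn_integral_cis_shift[of "\<lambda>w. ennreal (cmod (F' (of_real (cmod z) * w)) powr p)"]) measurable
  also have "\<dots> = (\<integral>\<^sup>+\<theta>\<in>{0..2*pi}. ennreal (cmod (F (rcis (cmod z) \<theta>)) powr p) \<partial>lborel)"
    by (intro nn_integral_cong) (use z in \<open>auto simp: F'_def norm_mult rcis_def\<close>)
  also have "\<dots> = ennreal (2 * pi * integral_mean p (cmod z) F powr p)"
    by (rule nn_integral_mean) (use F z p in auto)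
  finally show ?thesis .
qed

section \<open>Pairings of circle functions with the dual unit ball\<close>

definition circle_pairing :: "(real \<Rightarrow> complex) \<Rightarrow> (complex \<Rightarrow> complex) \<Rightarrow> complex \<Rightarrow> complex" where
  "circle_pairing c F z = (LINT \<theta>:{0..2*pi}|lborel. c \<theta> * F (z * cis \<theta>)) / (2 * pi)"

definition dual_ball :: "real \<Rightarrow> (real \<Rightarrow> complex) set" where
  "dual_ball p = {c. continuous_on UNIV c \<and>
     (\<integral>\<^sup>+\<theta>\<in>{0..2*pi}. ennreal (cmod (c \<theta>) powr (p / (p - 1))) \<partial>lborel) \<le> ennreal (2 * pi)}"

lemma dual_ball_continuous: "c \<in> dual_ball p \<Longrightarrow> continuous_on UNIV c"
  by (simp add: dual_ball_def)

lemma dual_ball_cis: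
  assumes "c \<in> dual_ball p" "continuous_on UNIV u" "\<And>\<theta>. cmod (u \<theta>) = 1"
  shows "(\<lambda>\<theta>. c \<theta> * u \<theta>) \<in> dual_ball p"
  using assms by (auto simp: dual_ball_def norm_mult intro!: continuous_intros)

lemma dual_ball_Holder:
  fixes H :: "real \<Rightarrow> real"
  assumes c: "c \<in> dual_ball p" and p: "1 < p"
    and [measurable]: "H \<in> borel_measurable borel" and H: "\<And>\<theta>. 0 \<le> H \<theta>"
    and B: "(\<integral>\<^sup>+\<theta>\<in>{0..2*pi}. ennreal (H \<theta> powr p) \<partial>lborel) \<le> ennreal (2 * pi * B powr p)" "0 \<le> B"
  shows "(\<integral>\<^sup>+\<theta>\<in>{0..2*pi}. ennreal (cmod (c \<theta>) * H \<theta>) \<partial>lborel) \<le> ennreal (2 * pi * B)"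
proof -
  have [measurable]: "c \<in> borel_measurable borel"
    using dual_ball_continuous[OF c] by (rule borel_measurable_continuous_onI)
  have q: "1 < p / (p - 1)" "1 / p + 1 / (p / (p - 1)) = 1"
    using p by (simp_all add: field_simps)
  have "(\<integral>\<^sup>+\<theta>\<in>{0..2*pi}. ennreal (cmod (c \<theta>) * H \<theta>) \<partial>lborel)
      = (\<integral>\<^sup>+\<theta>. ennreal ((indicator {0..2*pi} \<theta> * H \<theta>) * (indicator {0..2*pi} \<theta> * cmod (c \<theta>))) \<partial>lborel)"
    by (intro nn_integral_cong) (auto simp: indicator_def mult.commute)
  also have "\<dots> \<le> ennreal ((2 * pi * B powr p) powr (1 / p) * (2 * pi) powr (1 / (p / (p - 1))))"
  proof (rule nn_integral_Holder[OF _ _ _ _ p q])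
    have "(\<integral>\<^sup>+\<theta>. ennreal ((indicator {0..2*pi} \<theta> * H \<theta>) powr p) \<partial>lborel) = (\<integral>\<^sup>+\<theta>\<in>{0..2*pi}. ennreal (H \<theta> powr p) \<partial>lborel)"
      by (intro nn_integral_cong) (auto simp: indicator_def)
    with B show "(\<integral>\<^sup>+\<theta>. ennreal ((indicator {0..2*pi} \<theta> * H \<theta>) powr p) \<partial>lborel) \<le> ennreal (2 * pi * B powr p)" by simp
    have "(\<integral>\<^sup>+\<theta>. ennreal ((indicator {0..2*pi} \<theta> * cmod (c \<theta>)) powr (p / (p - 1))) \<partial>lborel)
        = (\<integral>\<^sup>+\<theta>\<in>{0..2*pi}. ennreal (cmod (c \<theta>) powr (p / (p - 1))) \<partial>lborel)"
      by (intro nn_integral_cong) (auto simp: indicator_def)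
    with c show "(\<integral>\<^sup>+\<theta>. ennreal ((indicator {0..2*pi} \<theta> * cmod (c \<theta>)) powr (p / (p - 1))) \<partial>lborel) \<le> ennreal (2 * pi)"
      by (simp add: dual_ball_def)
  qed (use H in auto)
  also have "(2 * pi * B powr p) powr (1 / p) * (2 * pi) powr (1 / (p / (p - 1)))
      = (2 * pi) powr (1 / p + 1 / (p / (p - 1))) * B"
    using p B by (simp add: powr_mult powr_powr powr_add)
  also have "\<dots> = 2 * pi * B" by (subst q) simp
  finally show ?thesis .
qed

lemma circle_pairing_integrable:
  fixes F :: "complex \<Rightarrow> complex"
  assumes "continuous_on (ball 0 1) F" "continuous_on UNIV c" "cmod z < 1"
  shows "set_integrable lborel {0..2*pi} (\<lambda>\<theta>. c \<theta> * F (z * cis \<theta>))"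
  by (rule set_integrable_continuous, rule continuous_on_mult[OF assms(2) continuous_on_circle[OF assms(1,3), of UNIV]])

lemma norm_circle_pairing_nn_integral_le:
  assumes F: "continuous_on (ball 0 1) F" and c: "continuous_on UNIV c" and z: "cmod z < 1"
  shows "ennreal (2 * pi * cmod (circle_pairing c F z)) \<le> (\<integral>\<^sup>+\<theta>\<in>{0..2*pi}. ennreal (cmod (c \<theta>) * cmod (F (z * cis \<theta>))) \<partial>lborel)"
proof -
  have "ennreal (cmod (LINT \<theta>:{0..2*pi}|lborel. c \<theta> * F (z * cis \<theta>)))
      \<le> (\<integral>\<^sup>+\<theta>. ennreal (cmod (indicator {0..2*pi} \<theta> *\<^sub>R (c \<theta> * F (z * cis \<theta>)))) \<partial>lborel)"
    unfolding set_lebesgue_integral_def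
    by (rule integral_norm_bound_ennreal)
       (use circle_pairing_integrable[OF F c z] in \<open>simp add: set_integrable_def\<close>)
  also have "\<dots> = (\<integral>\<^sup>+\<theta>\<in>{0..2*pi}. ennreal (cmod (c \<theta>) * cmod (F (z * cis \<theta>))) \<partial>lborel)"
    by (intro nn_integral_cong) (auto simp: indicator_def norm_mult)
  finally show ?thesis
    by (simp add: circle_pairing_def norm_divide norm_mult)
qed

lemma norm_circle_pairing_le:
  assumes F: "continuous_on (ball 0 1) F" and c: "c \<in> dual_ball p" and p: "1 < p" and z: "cmod z < 1"
  shows "cmod (circle_pairing c F z) \<le> integral_mean p (cmod z) F"
proof -
  have "ennreal (2 * pi * cmod (circle_pairing c F z)) \<le> ennreal (2 * pi * integral_mean p (cmod z) F)"
    by (rule order_trans[OF norm_circle_pairing_nn_integral_le[OF F dual_ball_continuous[OF c] z] dual_ball_Holder[OF c p]])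
       (use nn_integral_mean_shift[OF F z, of p] p continuous_on_circle[OF F z] in
         \<open>auto intro!: borel_measurable_continuous_onI continuous_intros\<close>)
  then show ?thesis by simp
qed

text \<open>Up to a constant this map sends the values of \<open>F\<close> to those of its extremal
  multiplier. For \<open>p < 2\<close> the second factor is unbounded near 0; continuity there holds
  because the modulus of the product is \<open>cmod w powr (p - 1)\<close>, which tends to
  0.\<close>

lemma continuous_cnj_powr:
  assumes "1 < p"
  shows "continuous_on UNIV (\<lambda>w. cnj w * of_real (cmod w powr (p - 2)))"
proof -
  have "isCont (\<lambda>w. cnj w * of_real (cmod w powr (p - 2))) w" for w
  proof (cases "w = 0")
    case False
    then show ?thesis by (intro continuous_intros) auto
  next
    case True
    have "continuous_on UNIV (\<lambda>w. cmod w powr (p - 1))"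
      by (rule continuous_on_norm_powr) (use assms in auto)
    then have "isCont (\<lambda>w. cmod w powr (p - 1)) 0"
      by (simp add: continuous_on_eq_continuous_at)
    then have "((\<lambda>w::complex. cmod w powr (p - 1)) \<longlongrightarrow> cmod 0 powr (p - 1)) (at 0)"
      by (simp only: isCont_def)
    moreover have "cmod (cnj w * of_real (cmod w powr (p - 2))) = cmod w powr (p - 1)" for w
    proof (cases "w = 0")
      case False
      then have "cmod w * cmod w powr (p - 2) = cmod w powr (1 + (p - 2))"
        by (subst powr_add) simp
      then show ?thesis by (simp add: norm_mult)
    qed simp
    ultimately have "((\<lambda>w. cmod (cnj w * of_real (cmod w powr (p - 2)))) \<longlongrightarrow> 0) (at 0)"
      by simp
    then show ?thesis
      by (simp add: True isCont_def tendsto_norm_zero_iff del: norm_mult)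
  qed
  then show ?thesis by (simp add: continuous_on_eq_continuous_at)
qed

text \<open>The equality case of Hoelder's inequality: on the circle of radius \<open>r\<close> the
  multiplier is the conjugate of \<open>F\<close> times \<open>|F|^(p - 2)\<close>, divided by
  \<open>M powr (p - 1)\<close>. It depends on \<open>r\<close>; at all other points only the
  inequality \<open>norm_circle_pairing_le\<close> is available.\<close>

lemma circle_pairing_attains:
  assumes F: "continuous_on (ball 0 1) F" and p: "1 < p" and r: "0 \<le> r" "r < 1"
  shows "\<exists>c\<in>dual_ball p. circle_pairing c F (of_real r) = of_real (integral_mean p r F)"
proof (cases "integral_mean p r F = 0")
  case True
  \<comment> \<open>With mean 0 the normalising divisor vanishes, and the zero multiplier
    serves.\<close>
  have c: "(\<lambda>_. 0) \<in> dual_ball p" by (simp add: dual_ball_def)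
  have "circle_pairing (\<lambda>_. 0) F (of_real r) = of_real (integral_mean p r F)"
    using True by (simp add: circle_pairing_def set_lebesgue_integral_def)
  with c show ?thesis by blast
next
  case False
  define M where "M = integral_mean p r F"
  have M: "0 < M" using False integral_mean_nonneg[of p r F] unfolding M_def by linarith
  define w where "w \<theta> = F (of_real r * cis \<theta>)" for \<theta>
  define c where "c \<theta> = cnj (w \<theta>) * of_real (cmod (w \<theta>) powr (p - 2)) / of_real (M powr (p - 1))" for \<theta>
  have wc: "continuous_on UNIV w" unfolding w_def using F r by (intro continuous_on_circle) auto
  have cc: "continuous_on UNIV c"
    unfolding c_def using M
    by (intro continuous_on_divide continuous_on_compose2[OF continuous_cnj_powr[OF p] wc] continuous_intros) auto
  have nw: "cmod w * cmod w powr (p - 2) = cmod w powr (p - 1)" for w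
    by (cases "w = 0") (auto simp: powr_add[symmetric] powr_mult_base)
  have nc: "cmod (c \<theta>) powr (p / (p - 1)) = cmod (w \<theta>) powr p / M powr p" for \<theta>
    using p M by (simp add: c_def norm_mult norm_divide nw powr_divide powr_powr)
  have I: "(\<integral>\<^sup>+\<theta>\<in>{0..2*pi}. ennreal (cmod (w \<theta>) powr p) \<partial>lborel) = ennreal (2 * pi * M powr p)"
    using nn_integral_mean[OF F r, of p] p by (simp add: w_def M_def rcis_def)
  have [measurable]: "w \<in> borel_measurable borel" using wc by (rule borel_measurable_continuous_onI)
  have "(\<integral>\<^sup>+\<theta>\<in>{0..2*pi}. ennreal (cmod (c \<theta>) powr (p / (p - 1))) \<partial>lborel)
     = (\<integral>\<^sup>+\<theta>. ennreal (1 / M powr p) * (ennreal (cmod (w \<theta>) powr p) * indicator {0..2*pi} \<theta>) \<partial>lborel)"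
    by (intro nn_integral_cong) (auto simp: nc indicator_def ennreal_mult[symmetric])
  also have "\<dots> = ennreal (1 / M powr p) * ennreal (2 * pi * M powr p)"
    by (subst nn_integral_cmult) (auto simp: I)
  also have "\<dots> = ennreal (2 * pi)" using M by (simp add: ennreal_mult[symmetric])
  finally have cd: "c \<in> dual_ball p" using cc by (simp add: dual_ball_def)
  have "(LINT \<theta>:{0..2*pi}|lborel. c \<theta> * F (of_real r * cis \<theta>)) = (LINT \<theta>:{0..2*pi}|lborel. of_real (cmod (w \<theta>) powr p / M powr (p - 1)))"
  proof -
    have "c \<theta> * w \<theta> = of_real (cmod (w \<theta>) powr p / M powr (p - 1))" for \<theta>
    proof -
      have "c \<theta> * w \<theta> = of_real ((cmod (w \<theta>))\<^sup>2 * cmod (w \<theta>) powr (p - 2) / M powr (p - 1))"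
        using complex_norm_square[of "w \<theta>"] by (simp add: c_def mult_ac)
      also have "(cmod (w \<theta>))\<^sup>2 * cmod (w \<theta>) powr (p - 2) = cmod (w \<theta>) powr p"
        by (cases "w \<theta> = 0") (auto simp: powr_add[symmetric] powr_numeral[symmetric] simp del: powr_numeral)
      finally show ?thesis .
    qed
    then show ?thesis by (simp add: w_def)
  qed
  also have "\<dots> = of_real (LINT \<theta>:{0..2*pi}|lborel. cmod (w \<theta>) powr p / M powr (p - 1))"
    by (rule set_integral_complex_of_real)
  also have "(LINT \<theta>:{0..2*pi}|lborel. cmod (w \<theta>) powr p / M powr (p - 1)) = (LINT \<theta>:{0..2*pi}|lborel. cmod (w \<theta>) powr p) / M powr (p - 1)"
    by (simp add: set_lebesgue_integral_def)
  also have "(LINT \<theta>:{0..2*pi}|lborel. cmod (w \<theta>) powr p) = 2 * pi * M powr p"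
  proof -
    have "0 \<le> (LINT \<theta>:{0..2*pi}|lborel. cmod (w \<theta>) powr p)"
      unfolding set_lebesgue_integral_def by (intro integral_nonneg_AE) auto
    then show ?thesis using p by (simp add: M_def integral_mean_def powr_powr w_def rcis_def)
  qed
  also have "2 * pi * M powr p / M powr (p - 1) = 2 * pi * M"
    using M by (simp add: powr_diff)
  finally have "circle_pairing c F (of_real r) = of_real M"
    by (simp add: circle_pairing_def)
  with cd show ?thesis by (auto simp: M_def)
qed

text \<open>Differentiation under the integral sign. The chain-rule factor
  \<open>cis \<theta>\<close> is unimodular and is moved into the multiplier, so a derivative of a
  pairing is again a pairing, with a multiplier of the same \<open>L^q\<close> norm.\<close>

lemma circle_pairing_has_field_derivative:
  assumes F: "F holomorphic_on ball 0 1" and c: "continuous_on UNIV c" and z: "cmod z < 1"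
  shows "(circle_pairing c F has_field_derivative circle_pairing (\<lambda>\<theta>. c \<theta> * cis \<theta>) (deriv F) z) (at z)"
proof -
  have Fc: "continuous_on (ball 0 1) F" by (rule holomorphic_on_imp_continuous_on[OF F])
  have dF: "deriv F holomorphic_on ball 0 1" using F by (simp add: holomorphic_deriv)
  then have dFc: "continuous_on (ball 0 1) (deriv F)" by (rule holomorphic_on_imp_continuous_on)
  have eq1: "circle_pairing c F w = integral (cbox 0 (2*pi)) (\<lambda>\<theta>. c \<theta> * F (w * cis \<theta>)) / (2 * pi)" if "w \<in> ball 0 1" for w
    unfolding circle_pairing_def
    using set_borel_integral_eq_integral(2)[OF circle_pairing_integrable[OF Fc c]] that by simp
  have cc: "continuous_on UNIV (\<lambda>\<theta>. c \<theta> * cis \<theta>)" by (intro continuous_intros c)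
  have eq2: "circle_pairing (\<lambda>\<theta>. c \<theta> * cis \<theta>) (deriv F) z = integral (cbox 0 (2*pi)) (\<lambda>\<theta>. c \<theta> * (deriv F (z * cis \<theta>) * cis \<theta>)) / (2 * pi)"
    unfolding circle_pairing_def
    using set_borel_integral_eq_integral(2)[OF circle_pairing_integrable[OF dFc cc]] z by (simp add: mult_ac)
  have "((\<lambda>w. integral (cbox 0 (2*pi)) (\<lambda>\<theta>. c \<theta> * F (w * cis \<theta>))) has_field_derivative
      integral (cbox 0 (2*pi)) (\<lambda>\<theta>. c \<theta> * (deriv F (z * cis \<theta>) * cis \<theta>))) (at z within ball 0 1)"
  proof (rule leibniz_rule_field_derivative)
    fix w :: complex and t :: real assume w: "w \<in> ball 0 1"
    have "(F has_field_derivative deriv F (w * cis t)) (at (w * cis t))"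
      by (rule holomorphic_derivI[OF F]) (use w in \<open>auto simp: norm_mult\<close>)
    then have "((\<lambda>w. F (w * cis t)) has_field_derivative deriv F (w * cis t) * cis t) (at w)"
      by (rule DERIV_chain2) (auto intro!: derivative_eq_intros)
    then show "((\<lambda>w. c t * F (w * cis t)) has_field_derivative c t * (deriv F (w * cis t) * cis t)) (at w within ball 0 1)"
      by (intro DERIV_cmult) (rule has_field_derivative_at_within)
  next
    fix w :: complex assume w: "w \<in> ball 0 1"
    show "(\<lambda>\<theta>. c \<theta> * F (w * cis \<theta>)) integrable_on cbox 0 (2*pi)"
      using set_borel_integral_eq_integral(1)[OF circle_pairing_integrable[OF Fc c]] w by simp
  next
    show "continuous_on (ball 0 1 \<times> cbox 0 (2 * pi)) (\<lambda>(w, t). c t * (deriv F (w * cis t) * cis t))"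
      unfolding case_prod_beta
      by (intro continuous_intros continuous_on_compose2[OF c] continuous_on_compose2[OF dFc])
         (auto simp: norm_mult)
  qed (use z in auto)
  moreover have "at z within ball 0 1 = at z"
    by (rule at_within_open) (use z in auto)
  ultimately have "((\<lambda>w. integral (cbox 0 (2*pi)) (\<lambda>\<theta>. c \<theta> * F (w * cis \<theta>))) has_field_derivative
      integral (cbox 0 (2*pi)) (\<lambda>\<theta>. c \<theta> * (deriv F (z * cis \<theta>) * cis \<theta>))) (at z)"
    by (simp only:)
  from DERIV_cdivide[OF this, of "2 * pi"]
  have "((\<lambda>w. integral (cbox 0 (2*pi)) (\<lambda>\<theta>. c \<theta> * F (w * cis \<theta>)) / (2*pi)) has_field_derivative
      circle_pairing (\<lambda>\<theta>. c \<theta> * cis \<theta>) (deriv F) z) (at z)"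
    unfolding eq2 by (simp only: of_real_mult of_real_numeral)
  then show ?thesis
  proof (rule has_field_derivative_transform_within_open)
    fix w :: complex assume "w \<in> ball 0 1"
    then show "integral (cbox 0 (2*pi)) (\<lambda>\<theta>. c \<theta> * F (w * cis \<theta>)) / (2*pi) = circle_pairing c F w"
      by (rule eq1[symmetric])
  qed (use z in auto)
qed

lemma circle_pairing_holomorphic:
  assumes "F holomorphic_on ball 0 1" "continuous_on UNIV c"
  shows "circle_pairing c F holomorphic_on ball 0 1"
  unfolding holomorphic_on_open[OF open_ball]
proof (intro ballI exI)
  fix z :: complex assume "z \<in> ball 0 1"
  then show "(circle_pairing c F has_field_derivative circle_pairing (\<lambda>\<theta>. c \<theta> * cis \<theta>) (deriv F) z) (at z)"
    by (intro circle_pairing_has_field_derivative assms) simp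
qed

lemma circle_pairing_deriv_attains:
  assumes F: "F holomorphic_on ball 0 1" and p: "1 < p" and r: "0 \<le> r" "r < 1"
  shows "\<exists>c\<in>dual_ball p. deriv (circle_pairing c F) (of_real r) = of_real (integral_mean p r (deriv F))"
proof -
  have "continuous_on (ball 0 1) (deriv F)" by (rule holomorphic_on_imp_continuous_on[OF holomorphic_deriv[OF F open_ball]])
  from circle_pairing_attains[OF this p r]
  obtain c where c: "c \<in> dual_ball p" "circle_pairing c (deriv F) (of_real r) = of_real (integral_mean p r (deriv F))"
    by blast
  \<comment> \<open>The factor \<open>cis (- \<theta>)\<close> cancels the
    \<open>cis \<theta>\<close> that differentiation produces.\<close>
  define c' where "c' \<theta> = c \<theta> * cis (- \<theta>)" for \<theta>
  have c': "c' \<in> dual_ball p" unfolding c'_def[abs_def]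
    by (intro dual_ball_cis c) (auto intro!: continuous_intros)
  have "(\<lambda>\<theta>. c' \<theta> * cis \<theta>) = c" by (auto simp: c'_def mult.assoc cis_mult)
  then have "deriv (circle_pairing c' F) (of_real r) = circle_pairing c (deriv F) (of_real r)"
    using DERIV_imp_deriv[OF circle_pairing_has_field_derivative[OF F dual_ball_continuous[OF c'], of "of_real r"]] r
    by simp
  with c c' show ?thesis by metis
qed

text \<open>The multiplier extremal at radius \<open>r\<close> is kept while the point moves out to
  the circle of radius \<open>R\<close>, where the pairing is at most the mean at \<open>R\<close>;
  the maximum principle connects the two.\<close>

lemma integral_mean_mono:
  assumes F: "F holomorphic_on ball 0 1" and p: "1 < p" and r: "0 \<le> r" "r \<le> R" "R < 1"
  shows "integral_mean p r F \<le> integral_mean p R F"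
proof (cases "R = 0")
  case True
  then have "r = R" using r by linarith
  then show ?thesis by simp
next
  case False
  have Fc: "continuous_on (ball 0 1) F" by (rule holomorphic_on_imp_continuous_on[OF F])
  have "r < 1" using r by linarith
  from circle_pairing_attains[OF Fc p r(1) this]
  obtain c where c: "c \<in> dual_ball p" "circle_pairing c F (of_real r) = of_real (integral_mean p r F)"
    by blast
  have hol: "circle_pairing c F holomorphic_on ball 0 1"
    using circle_pairing_holomorphic[OF F dual_ball_continuous[OF c(1)]] .
  have "cmod (circle_pairing c F (of_real r)) \<le> integral_mean p R F"
  proof (rule maximum_modulus_frontier[where S="cball 0 R" and f="circle_pairing c F" and \<xi>="of_real r"])
    show "circle_pairing c F holomorphic_on interior (cball 0 R)"
      by (rule holomorphic_on_subset[OF hol]) (use r in auto)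
    show "continuous_on (closure (cball 0 R)) (circle_pairing c F)"
      by (rule holomorphic_on_imp_continuous_on, rule holomorphic_on_subset[OF hol]) (use r in auto)
    fix z assume "z \<in> frontier (cball (0::complex) R)"
    then have "cmod z = R" using r False by (simp add: frontier_cball)
    then show "cmod (circle_pairing c F z) \<le> integral_mean p R F"
      using norm_circle_pairing_le[OF Fc c(1) p, of z] r by simp
  qed (use r in auto)
  then show ?thesis using c by simp
qed

text \<open>Cauchy's inequality on the disc of radius \<open>R - r\<close> about \<open>r\<close>.
  This disc lies in \<open>cball 0 R\<close>, where monotonicity of the means bounds the pairing by
  the mean at \<open>R\<close>.\<close>

lemma integral_mean_deriv_le:
  assumes F: "F holomorphic_on ball 0 1" and p: "1 < p" and r: "0 \<le> r" "r < R" "R < 1"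
  shows "integral_mean p r (deriv F) \<le> integral_mean p R F / (R - r)"
proof -
  have Fc: "continuous_on (ball 0 1) F" by (rule holomorphic_on_imp_continuous_on[OF F])
  have "r < 1" using r by linarith
  from circle_pairing_deriv_attains[OF F p r(1) this]
  obtain c where c: "c \<in> dual_ball p" "deriv (circle_pairing c F) (of_real r) = of_real (integral_mean p r (deriv F))"
    by blast
  have hol: "circle_pairing c F holomorphic_on ball 0 1"
    using circle_pairing_holomorphic[OF F dual_ball_continuous[OF c(1)]] .
  have le: "cmod w \<le> R" if "cmod (of_real r - w) \<le> R - r" for w
    using that norm_triangle_ineq4[of "of_real r" "of_real r - w"] r by simp
  have sub: "cball (of_real r) (R - r) \<subseteq> ball (0::complex) 1"
  proof
    fix x assume "x \<in> cball (complex_of_real r) (R - r)"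
    then have "cmod x \<le> R" using le by (simp add: dist_norm)
    then show "x \<in> ball 0 1" using r by simp
  qed
  have sub': "ball (of_real r) (R - r) \<subseteq> ball (0::complex) 1"
    using sub ball_subset_cball by blast
  have "norm ((deriv ^^ 1) (circle_pairing c F) (of_real r)) \<le> fact 1 * integral_mean p R F / (R - r) ^ 1"
  proof (rule Cauchy_inequality)
    show "circle_pairing c F holomorphic_on ball (of_real r) (R - r)"
      by (rule holomorphic_on_subset[OF hol sub'])
    show "continuous_on (cball (of_real r) (R - r)) (circle_pairing c F)"
      by (rule holomorphic_on_imp_continuous_on[OF holomorphic_on_subset[OF hol sub]])
    fix x assume "cmod (of_real r - x) = R - r"
    then have "cmod x \<le> R" using le by simp
    then show "cmod (circle_pairing c F x) \<le> integral_mean p R F"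
      using norm_circle_pairing_le[OF Fc c(1) p, of x] integral_mean_mono[OF F p, of "cmod x" R] r by simp
  qed (use r in auto)
  then show ?thesis using c by simp
qed

section \<open>The generalized Hilbert operator\<close>

text \<open>A fixed sequence tending to 1 and lying strictly between 0 and 1 from index 0 on, hence
  the \<open>+ 2\<close>. It turns limits along \<open>at_left 1\<close> into limits of sequences,
  as dominated convergence and Fatou's lemma need.\<close>

definition radius :: "nat \<Rightarrow> real" where "radius n = 1 - 1 / (real n + 2)"

lemma radius: "0 < radius n" "radius n < 1" "0 \<le> radius n"
  by (auto simp: radius_def field_simps)

lemma radius_tendsto: "radius \<longlonglongrightarrow> 1"
  unfolding radius_def by real_asymp

lemma radius_at_left: "filterlim radius (at_left 1) sequentially"
  unfolding filterlim_at using radius_tendsto radius by (auto simp: less_imp_neq intro!: always_eventually)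

lemma gen_hilbert_eq:
  "gen_hilbert g f z = (LINT t:{0..<1}|lborel. f (of_real t) * deriv g (of_real t * z))"
  unfolding gen_hilbert_def using interval_integral_Ico[of 0 1]
  by (simp add: zero_ereal_def one_ereal_def)

lemma bounded_on_subdisc:
  assumes "continuous_on (ball 0 1) (F :: complex \<Rightarrow> complex)" "\<rho> < 1"
  obtains K where "0 < K" "\<And>w. cmod w \<le> \<rho> \<Longrightarrow> cmod (F w) \<le> K"
proof -
  have "compact (F ` cball 0 \<rho>)"
    by (rule compact_continuous_image[OF continuous_on_subset[OF assms(1)]]) (use assms(2) in auto)
  then obtain K where "0 < K" "\<forall>x\<in>F ` cball 0 \<rho>. cmod x \<le> K"
    using compact_imp_bounded bounded_pos by metis
  then show ?thesis using that by simp
qed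

text \<open>\<open>f\<close> may be unbounded near 1, so differentiation under the integral is
  applied to the truncations to \<open>{0..radius n}\<close>. These converge uniformly on small
  closed balls: \<open>deriv g (of_real t * w)\<close> is bounded there uniformly in
  \<open>t\<close>, and the remaining tail of the integral of \<open>|f|\<close> tends to 0.\<close>

lemma gen_hilbert_holomorphic:
  assumes g: "g holomorphic_on ball 0 1" and f: "f holomorphic_on ball 0 1"
    and int: "set_integrable lborel {0..<1} (\<lambda>t. f (of_real t))"
  shows "gen_hilbert g f holomorphic_on ball 0 1"
proof -
  define G where "G = deriv g"
  have G: "G holomorphic_on ball 0 1" unfolding G_def using g by (rule holomorphic_deriv) simp
  have Gc: "continuous_on (ball 0 1) G" by (rule holomorphic_on_imp_continuous_on[OF G])
  have fc: "continuous_on (ball 0 1) f" by (rule holomorphic_on_imp_continuous_on[OF f])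
  define T where "T n z = (LINT t:{0..radius n}|lborel. f (of_real t) * G (of_real t * z))" for n z
  have conti: "continuous_on {0..radius n} (\<lambda>t. f (of_real t) * G (of_real t * z))" if "z \<in> ball 0 1" for n z
  proof -
    have "cmod (of_real t * z) < 1" if "t \<in> {0..radius n}" for t
      using that radius[of n] \<open>z \<in> ball 0 1\<close> mult_le_one[of t 1] mult_strict_mono'[of t 1 "cmod z" 1]
      by (auto simp: norm_mult)
    then show ?thesis
      using radius[of n] by (intro continuous_intros continuous_on_compose2[OF fc] continuous_on_compose2[OF Gc]) auto
  qed
  have inti: "set_integrable lborel {0..radius n} (\<lambda>t. f (of_real t) * G (of_real t * z))" if "z \<in> ball 0 1" for n z
    by (rule borel_integrable_atLeastAtMost'[OF conti[OF that]])
  have Thol: "T n holomorphic_on ball 0 1" for n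
  proof -
    have "(\<lambda>z. integral (cbox 0 (radius n)) (\<lambda>t. f (of_real t) * G (of_real t * z))) holomorphic_on ball 0 1"
    proof (rule leibniz_rule_holomorphic)
      fix z :: complex and t :: real assume z: "z \<in> ball 0 1" and t: "t \<in> cbox 0 (radius n)"
      have tz: "of_real t * z \<in> ball 0 1"
        using z t radius[of n] mult_strict_mono'[of t 1 "cmod z" 1] by (auto simp: norm_mult)
      have "(G has_field_derivative deriv G (of_real t * z)) (at (of_real t * z))"
        by (rule holomorphic_derivI[OF G open_ball tz])
      then have "((\<lambda>z. G (of_real t * z)) has_field_derivative deriv G (of_real t * z) * of_real t) (at z)"
        by (rule DERIV_chain2) (auto intro!: derivative_eq_intros)
      then show "((\<lambda>z. f (of_real t) * G (of_real t * z)) has_field_derivative f (of_real t) * (deriv G (of_real t * z) * of_real t)) (at z within ball 0 1)"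
        by (intro DERIV_cmult) (rule has_field_derivative_at_within)
    next
      fix z :: complex assume z: "z \<in> ball 0 1"
      show "(\<lambda>t. f (of_real t) * G (of_real t * z)) integrable_on cbox 0 (radius n)"
        using set_borel_integral_eq_integral(1)[OF inti[OF z]] by simp
    next
      have dGc: "continuous_on (ball 0 1) (deriv G)"
        by (rule holomorphic_on_imp_continuous_on[OF holomorphic_deriv[OF G open_ball]])
      have "cmod (of_real t * z) < 1" if "z \<in> ball 0 1" "t \<in> {0..radius n}" for t z
        using that radius[of n] mult_strict_mono'[of t 1 "cmod z" 1] by (auto simp: norm_mult)
      then show "continuous_on (ball 0 1 \<times> cbox 0 (radius n)) (\<lambda>(z, t). f (of_real t) * (deriv G (of_real t * z) * of_real t))"
        unfolding case_prod_beta using radius[of n]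
        by (intro continuous_intros continuous_on_compose2[OF fc] continuous_on_compose2[OF dGc]) auto
    qed auto
    then show ?thesis
      by (rule holomorphic_transform)
         (use set_borel_integral_eq_integral(2)[OF inti] in \<open>simp add: T_def\<close>)
  qed
  \<comment> \<open>The tail of the integral of \<open>|f|\<close>, which controls the truncation
    error at every \<open>z\<close> up to a bound for \<open>deriv g\<close>.\<close>
  define e where "e n = (LINT t|lborel. indicator {radius n<..<1} t * cmod (f (of_real t)))" for n
  have intn: "integrable lborel (\<lambda>t. cmod (indicator {0..<1} t *\<^sub>R f (of_real t)))"
    using int unfolding set_integrable_def by (rule integrable_norm)
  have [measurable]: "(\<lambda>t. indicator {0..<1} t *\<^sub>R f (of_real t)) \<in> borel_measurable lborel"
    using int unfolding set_integrable_def by (rule borel_measurable_integrable)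
  have e_eq: "indicator {radius n<..<1} t * cmod (f (of_real t)) = indicator {radius n<..<1} t * cmod (indicator {0..<1} t *\<^sub>R f (of_real t))" for n t
    using radius[of n] by (auto simp: indicator_def)
  have inte: "integrable lborel (\<lambda>t. indicator {radius n<..<1} t * cmod (f (of_real t)))" for n
    by (rule Bochner_Integration.integrable_bound[OF intn], subst e_eq)
       (measurable, use radius[of n] in \<open>auto simp: indicator_def\<close>)
  have "e \<longlonglongrightarrow> (LINT t|(lborel :: real measure). (0::real))"
    unfolding e_def
  proof (rule integral_dominated_convergence[where w="\<lambda>t. cmod (indicator {0..<1} t *\<^sub>R f (of_real t))"])
    show "integrable lborel (\<lambda>t. cmod (indicator {0..<1} t *\<^sub>R f (of_real t)))" by (rule intn)
    show "AE t in lborel. (\<lambda>n. indicator {radius n<..<1} t * cmod (f (of_real t))) \<longlonglongrightarrow> 0"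
    proof (rule AE_I2)
      fix t :: real
      show "(\<lambda>n. indicator {radius n<..<1} t * cmod (f (of_real t))) \<longlonglongrightarrow> 0"
      proof (cases "t < 1")
        case True
        have "\<forall>\<^sub>F n in sequentially. t < radius n"
          using order_tendstoD(1)[OF radius_tendsto True] .
        then have "\<forall>\<^sub>F n in sequentially. indicator {radius n<..<1} t * cmod (f (of_real t)) = 0"
          by eventually_elim (auto simp: indicator_def)
        then show ?thesis by (rule tendsto_eventually)
      qed auto
    qed
    show "AE t in lborel. norm (indicator {radius n<..<1} t * cmod (f (of_real t))) \<le> cmod (indicator {0..<1} t *\<^sub>R f (of_real t))" for n
      using radius[of n] by (auto simp: indicator_def)
    show "(\<lambda>t. indicator {radius n<..<1} t * cmod (f (of_real t))) \<in> borel_measurable lborel" for n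
      using inte by (rule borel_measurable_integrable)
  qed auto
  then have e: "e \<longlonglongrightarrow> 0" by simp
  have key: "cmod (gen_hilbert g f z - T n z) \<le> K * e n"
    if z: "cmod z < 1" and K: "0 < K" "\<And>w. cmod w \<le> cmod z \<Longrightarrow> cmod (G w) \<le> K" for z n K
  proof -
    have Gz: "cmod (G (of_real t * z)) \<le> K" if "t \<in> {0..<1}" for t
      using that mult_right_mono[of t 1 "cmod z"] by (intro K) (auto simp: norm_mult)
    have Gtm: "(\<lambda>t. indicator {0..<1} t *\<^sub>R G (of_real t * z)) \<in> borel_measurable borel"
    proof (rule borel_measurable_continuous_on_indicator)
      have "cmod (of_real t * z) < 1" if "t \<in> {0..<1}" for t
        using that z mult_strict_mono'[of t 1 "cmod z" 1] by (auto simp: norm_mult)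
      then show "continuous_on {0..<1} (\<lambda>t. G (of_real t * z))"
        by (intro continuous_intros continuous_on_compose2[OF Gc]) auto
    qed simp
    have intG: "integrable lborel (\<lambda>t. indicator {0..<1} t *\<^sub>R (f (of_real t) * G (of_real t * z)))"
    proof (rule Bochner_Integration.integrable_bound)
      show "integrable lborel (\<lambda>t. K * cmod (indicator {0..<1} t *\<^sub>R f (of_real t)))"
        by (intro integrable_mult_right intn)
      have "(\<lambda>t. indicator {0..<1} t *\<^sub>R (f (of_real t) * G (of_real t * z)))
        = (\<lambda>t. (indicator {0..<1} t *\<^sub>R f (of_real t)) * (indicator {0..<1} t *\<^sub>R G (of_real t * z)))"
        by (auto simp: indicator_def)
      moreover have "(\<lambda>t. (indicator {0..<1} t *\<^sub>R f (of_real t)) * (indicator {0..<1} t *\<^sub>R G (of_real t * z))) \<in> borel_measurable lborel"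
        by (rule borel_measurable_times) (use Gtm in auto)
      ultimately show "(\<lambda>t. indicator {0..<1} t *\<^sub>R (f (of_real t) * G (of_real t * z))) \<in> borel_measurable lborel"
        by (simp only:)
      show "AE t in lborel. cmod (indicator {0..<1} t *\<^sub>R (f (of_real t) * G (of_real t * z)))
          \<le> norm (K * cmod (indicator {0..<1} t *\<^sub>R f (of_real t)))"
      proof (rule AE_I2)
        fix t :: real
        show "cmod (indicator {0..<1} t *\<^sub>R (f (of_real t) * G (of_real t * z)))
          \<le> norm (K * cmod (indicator {0..<1} t *\<^sub>R f (of_real t)))"
        proof (cases "t \<in> {0..<1}")
          case True
          from mult_left_mono[OF Gz[OF True] norm_ge_zero[of "f (of_real t)"]]
          show ?thesis using True K(1) by (simp add: norm_mult mult.commute abs_mult)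
        qed simp
      qed
    qed
    have "gen_hilbert g f z - T n z = (LINT t|lborel. indicator {0..<1} t *\<^sub>R (f (of_real t) * G (of_real t * z))
       - indicator {0..radius n} t *\<^sub>R (f (of_real t) * G (of_real t * z)))"
      unfolding gen_hilbert_eq T_def G_def[symmetric] set_lebesgue_integral_def
      by (rule Bochner_Integration.integral_diff[symmetric]) (use intG inti[of z n] z in \<open>auto simp: set_integrable_def\<close>)
    also have "cmod \<dots> \<le> (LINT t|lborel. K * (indicator {radius n<..<1} t * cmod (f (of_real t))))"
    proof (rule Bochner_Integration.integral_norm_bound_integral)
      fix t :: real
      show "cmod (indicator {0..<1} t *\<^sub>R (f (of_real t) * G (of_real t * z))
       - indicator {0..radius n} t *\<^sub>R (f (of_real t) * G (of_real t * z))) \<le> K * (indicator {radius n<..<1} t * cmod (f (of_real t)))"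
        using radius[of n] Gz[of t] mult_right_mono[of "cmod (G (of_real t * z))" K "cmod (f (of_real t))"]
        by (auto simp: indicator_def norm_mult mult.commute)
    qed (use intG inti[of z n] z inte in \<open>auto simp: set_integrable_def\<close>)
    also have "\<dots> = K * e n" by (simp add: e_def)
    finally show ?thesis .
  qed
  show ?thesis
  proof (rule holomorphic_uniform_sequence[of _ T])
    fix x :: complex assume x: "x \<in> ball 0 1"
    define d where "d = (1 - cmod x) / 2"
    define \<rho> where "\<rho> = (1 + cmod x) / 2"
    have d: "0 < d" and \<rho>: "\<rho> < 1" using x by (auto simp: d_def \<rho>_def)
    have le: "cmod w \<le> \<rho>" if "w \<in> cball x d" for w
    proof -
      have "cmod (w - x) \<le> d" using that by (simp add: dist_norm norm_minus_commute)
      then have "cmod w \<le> cmod x + d" using norm_triangle_ineq2[of w x] by linarith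
      then show ?thesis by (simp add: d_def \<rho>_def field_simps)
    qed
    obtain K where K: "0 < K" "\<And>w. cmod w \<le> \<rho> \<Longrightarrow> cmod (G w) \<le> K"
      using bounded_on_subdisc[OF Gc \<rho>] by blast
    have "uniform_limit (cball x d) T (gen_hilbert g f) sequentially"
      unfolding uniform_limit_iff
    proof (intro allI impI)
      fix \<epsilon> :: real assume "0 < \<epsilon>"
      have "(\<lambda>n. K * e n) \<longlonglongrightarrow> K * 0" by (intro tendsto_intros e)
      then have "\<forall>\<^sub>F n in sequentially. K * e n < \<epsilon>"
        using \<open>0 < \<epsilon>\<close> by (auto dest: order_tendstoD(2))
      then show "\<forall>\<^sub>F n in sequentially. \<forall>w\<in>cball x d. dist (T n w) (gen_hilbert g f w) < \<epsilon>"
      proof eventually_elim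
        case (elim n)
        show ?case
        proof
          fix w assume w: "w \<in> cball x d"
          have "cmod (gen_hilbert g f w - T n w) \<le> K * e n"
            using key[of w K n] le[OF w] \<rho> K by force
          then show "dist (T n w) (gen_hilbert g f w) < \<epsilon>"
            using elim by (simp add: dist_norm norm_minus_commute)
        qed
      qed
    qed
    moreover have "cball x d \<subseteq> ball 0 1" using le \<rho> by fastforce
    ultimately show "\<exists>d>0. cball x d \<subseteq> ball 0 1 \<and> uniform_limit (cball x d) T (gen_hilbert g f) sequentially"
      using d by blast
  qed (use Thol in auto)
qed

text \<open>The operator averages over dilations and the pairing over rotations, so the two commute
  by Fubini. Absolute integrability holds because \<open>deriv g\<close> is only evaluated at points
  of modulus at most \<open>cmod z\<close>, where it is bounded.\<close>

lemma circle_pairing_gen_hilbert: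
  assumes g: "g holomorphic_on ball 0 1" and c: "continuous_on UNIV c"
    and int: "set_integrable lborel {0..<1} (\<lambda>t. f (of_real t))" and z: "cmod z < 1"
  shows "circle_pairing c (gen_hilbert g f) z =
    (LINT t:{0..<1}|lborel. f (of_real t) * circle_pairing c (deriv g) (of_real t * z))"
proof -
  define G where "G w = indicator (ball 0 1) w *\<^sub>R deriv g w" for w
  have Gc: "continuous_on (ball 0 1) (deriv g)"
    by (rule holomorphic_on_imp_continuous_on[OF holomorphic_deriv[OF g open_ball]])
  have Gm[measurable]: "G \<in> borel_measurable borel"
    unfolding G_def[abs_def] by (rule borel_measurable_disc[OF Gc])
  define \<Phi> where "\<Phi> t = indicator {0..<1} t *\<^sub>R f (of_real t)" for t :: real
  have \<Phi>: "integrable lborel \<Phi>" using int by (simp add: set_integrable_def \<Phi>_def[abs_def])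
  then have [measurable]: "\<Phi> \<in> borel_measurable borel" by auto
  define c' where "c' \<theta> = indicator {0..2*pi} \<theta> *\<^sub>R c \<theta>" for \<theta>
  have c': "integrable lborel c'"
    using set_integrable_continuous[OF c] by (simp add: set_integrable_def c'_def[abs_def])
  then have [measurable]: "c' \<in> borel_measurable borel" by auto
  obtain K where K: "0 < K" "\<And>w. cmod w \<le> cmod z \<Longrightarrow> cmod (deriv g w) \<le> K"
    using bounded_on_subdisc[OF Gc z] by blast
  have tz: "cmod (of_real t * z * cis \<theta>) \<le> cmod z" if "t \<in> {0..<1}" for t \<theta>
    using that mult_right_mono[of t 1 "cmod z"] by (auto simp: norm_mult)
  have G: "G (of_real t * z * cis \<theta>) = deriv g (of_real t * z * cis \<theta>)" if "t \<in> {0..<1}" for t \<theta>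
    using tz[OF that, of \<theta>] z by (simp add: G_def)
  have GK: "cmod (G (of_real t * z * cis \<theta>)) \<le> K" if "t \<in> {0..<1}" for t \<theta>
    using G[OF that] K(2)[OF tz[OF that]] by simp
  have intp: "integrable (lborel \<Otimes>\<^sub>M lborel) (\<lambda>(\<theta>, t). c' \<theta> * \<Phi> t * G (of_real t * z * cis \<theta>))"
  proof (rule integrableI_bounded)
    show "(\<lambda>(\<theta>, t). c' \<theta> * \<Phi> t * G (of_real t * z * cis \<theta>)) \<in> borel_measurable (lborel \<Otimes>\<^sub>M lborel)"
      by measurable
    have "(\<integral>\<^sup>+x. ennreal (norm (case x of (\<theta>, t) \<Rightarrow> c' \<theta> * \<Phi> t * G (of_real t * z * cis \<theta>))) \<partial>(lborel \<Otimes>\<^sub>M lborel))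
      \<le> (\<integral>\<^sup>+x. (ennreal K * ennreal (cmod (c' (fst x)))) * ennreal (cmod (\<Phi> (snd x))) \<partial>(lborel \<Otimes>\<^sub>M lborel))"
    proof (rule nn_integral_mono, clarsimp)
      fix \<theta> t
      show "ennreal (cmod (c' \<theta> * \<Phi> t * G (of_real t * z * cis \<theta>))) \<le> ennreal K * ennreal (cmod (c' \<theta>)) * ennreal (cmod (\<Phi> t))"
      proof (cases "t \<in> {0..<1}")
        case True
        have "cmod (c' \<theta> * \<Phi> t * G (of_real t * z * cis \<theta>)) \<le> cmod (c' \<theta>) * cmod (\<Phi> t) * K"
          unfolding norm_mult by (intro mult_left_mono GK True) auto
        then show ?thesis using K by (simp add: ennreal_mult[symmetric] mult_ac)
      qed (simp add: \<Phi>_def)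
    qed
    also have "\<dots> = (\<integral>\<^sup>+\<theta>. \<integral>\<^sup>+t. (ennreal K * ennreal (cmod (c' \<theta>))) * ennreal (cmod (\<Phi> t)) \<partial>lborel \<partial>lborel)"
      by (subst lborel.nn_integral_fst[symmetric]) auto
    also have "\<dots> = ennreal K * (\<integral>\<^sup>+\<theta>. ennreal (cmod (c' \<theta>)) \<partial>lborel) * (\<integral>\<^sup>+t. ennreal (cmod (\<Phi> t)) \<partial>lborel)"
      by (simp add: nn_integral_cmult nn_integral_multc)
    also have "\<dots> < \<infinity>"
      using c' \<Phi> by (auto simp: integrable_iff_bounded ennreal_mult_less_top)
    finally show "(\<integral>\<^sup>+x. ennreal (norm (case x of (\<theta>, t) \<Rightarrow> c' \<theta> * \<Phi> t * G (of_real t * z * cis \<theta>))) \<partial>(lborel \<Otimes>\<^sub>M lborel)) < \<infinity>" .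
  qed
  have "(LINT \<theta>:{0..2*pi}|lborel. c \<theta> * gen_hilbert g f (z * cis \<theta>))
      = (LINT \<theta>|lborel. LINT t|lborel. c' \<theta> * \<Phi> t * G (of_real t * z * cis \<theta>))"
    unfolding set_lebesgue_integral_def gen_hilbert_eq
  proof (intro Bochner_Integration.integral_cong refl)
    fix \<theta> :: real
    have "(LINT t|lborel. c' \<theta> * \<Phi> t * G (of_real t * z * cis \<theta>)) = (LINT t|lborel. c' \<theta> * (indicator {0..<1} t *\<^sub>R (f (of_real t) * deriv g (of_real t * (z * cis \<theta>)))))"
      by (intro Bochner_Integration.integral_cong refl) (use G in \<open>auto simp: \<Phi>_def indicator_def mult_ac\<close>)
    also have "\<dots> = c' \<theta> * (LINT t|lborel. indicator {0..<1} t *\<^sub>R (f (of_real t) * deriv g (of_real t * (z * cis \<theta>))))"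
      by (rule integral_mult_right_zero)
    finally have E: "(LINT t|lborel. c' \<theta> * \<Phi> t * G (of_real t * z * cis \<theta>))
       = c' \<theta> * (LINT t|lborel. indicator {0..<1} t *\<^sub>R (f (of_real t) * deriv g (of_real t * (z * cis \<theta>))))" .
    show "indicator {0..2*pi} \<theta> *\<^sub>R (c \<theta> * (LINT t|lborel. indicator {0..<1} t *\<^sub>R (f (of_real t) * deriv g (of_real t * (z * cis \<theta>)))))
       = (LINT t|lborel. c' \<theta> * \<Phi> t * G (of_real t * z * cis \<theta>))"
      unfolding E by (simp add: c'_def)
  qed
  also have "\<dots> = (LINT t|lborel. LINT \<theta>|lborel. c' \<theta> * \<Phi> t * G (of_real t * z * cis \<theta>))"
    by (rule lborel_pair.Fubini_integral[OF intp, symmetric])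
  also have "\<dots> = (LINT t:{0..<1}|lborel. f (of_real t) * (LINT \<theta>:{0..2*pi}|lborel. c \<theta> * deriv g (of_real t * z * cis \<theta>)))"
    unfolding set_lebesgue_integral_def
  proof (intro Bochner_Integration.integral_cong refl)
    fix t :: real
    have "(LINT \<theta>|lborel. c' \<theta> * \<Phi> t * G (of_real t * z * cis \<theta>)) = (LINT \<theta>|lborel. \<Phi> t * (indicator {0..2*pi} \<theta> *\<^sub>R (c \<theta> * deriv g (of_real t * z * cis \<theta>))))"
      by (intro Bochner_Integration.integral_cong refl) (use G[of t] in \<open>auto simp: \<Phi>_def c'_def indicator_def mult_ac\<close>)
    also have "\<dots> = \<Phi> t * (LINT \<theta>|lborel. (indicator {0..2*pi} \<theta> *\<^sub>R (c \<theta> * deriv g (of_real t * z * cis \<theta>))))"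
      by (rule integral_mult_right_zero)
    finally show "(LINT \<theta>|lborel. c' \<theta> * \<Phi> t * G (of_real t * z * cis \<theta>)) =
       indicator {0..<1} t *\<^sub>R (f (of_real t) * (LINT \<theta>|lborel. (indicator {0..2*pi} \<theta> *\<^sub>R (c \<theta> * deriv g (of_real t * z * cis \<theta>)))))"
      by (simp add: \<Phi>_def)
  qed
  finally show ?thesis
    by (simp add: circle_pairing_def set_lebesgue_integral_def)
qed

text \<open>Minkowski's integral inequality for this operator, obtained by pairing with the
  multiplier that is extremal for the left-hand side.\<close>

lemma integral_mean_gen_hilbert_le:
  assumes g: "g holomorphic_on ball 0 1" and f: "f holomorphic_on ball 0 1" and p: "1 < p"
    and int: "set_integrable lborel {0..<1} (\<lambda>t. f (of_real t))" and r: "0 \<le> r" "r < 1"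
  shows "ennreal (integral_mean p r (gen_hilbert g f)) \<le>
    (\<integral>\<^sup>+t\<in>{0..<1}. ennreal (cmod (f (of_real t)) * integral_mean p (t * r) (deriv g)) \<partial>lborel)"
proof -
  have "continuous_on (ball 0 1) (gen_hilbert g f)"
    by (rule holomorphic_on_imp_continuous_on[OF gen_hilbert_holomorphic[OF g f int]])
  from circle_pairing_attains[OF this p r] obtain c where
    c: "c \<in> dual_ball p" "circle_pairing c (gen_hilbert g f) (of_real r) = of_real (integral_mean p r (gen_hilbert g f))"
    by blast
  have Gc: "continuous_on (ball 0 1) (deriv g)"
    by (rule holomorphic_on_imp_continuous_on[OF holomorphic_deriv[OF g open_ball]])
  define H where "H t = indicator {0..<1} t *\<^sub>R (f (of_real t) * circle_pairing c (deriv g) (of_real t * of_real r))" for t :: real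
  have "of_real (integral_mean p r (gen_hilbert g f)) = (LINT t|lborel. H t)"
    using circle_pairing_gen_hilbert[OF g dual_ball_continuous[OF c(1)] int, of "of_real r"] r c(2)
    by (simp add: set_lebesgue_integral_def H_def[abs_def])
  then have "ennreal (integral_mean p r (gen_hilbert g f)) = ennreal (cmod (LINT t|lborel. H t))"
    by (metis abs_of_nonneg integral_mean_nonneg norm_of_real)
  \<comment> \<open>If \<open>H\<close> is not integrable, its Bochner integral is 0 by default and
    the bound is trivial.\<close>
  also have "\<dots> \<le> (\<integral>\<^sup>+t. ennreal (cmod (H t)) \<partial>lborel)"
    by (cases "integrable lborel H") (auto intro: integral_norm_bound_ennreal simp: not_integrable_integral_eq)
  also have "\<dots> \<le> (\<integral>\<^sup>+t\<in>{0..<1}. ennreal (cmod (f (of_real t)) * integral_mean p (t * r) (deriv g)) \<partial>lborel)"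
  proof (rule nn_integral_mono)
    fix t :: real
    show "ennreal (cmod (H t)) \<le> ennreal (cmod (f (of_real t)) * integral_mean p (t * r) (deriv g)) * indicator {0..<1} t"
    proof (cases "t \<in> {0..<1}")
      case True
      then have tr: "t * r < 1" "0 \<le> t * r" using r mult_strict_mono'[of t 1 r 1] by auto
      have "cmod (of_real t * of_real r) = t * r"
        using tr(2) by (metis abs_of_nonneg norm_of_real of_real_mult)
      then have "cmod (circle_pairing c (deriv g) (of_real t * of_real r)) \<le> integral_mean p (t * r) (deriv g)"
        using norm_circle_pairing_le[OF Gc c(1) p, of "of_real t * of_real r"] tr(1) by metis
      then show ?thesis using True by (auto simp: H_def norm_mult intro!: ennreal_leI mult_left_mono)
    qed (simp add: H_def)
  qed
  finally show ?thesis .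
qed

section \<open>Mean growth and the mean Lipschitz condition\<close>

lemma norm_diff_le_powr_radial:
  fixes h :: "complex \<Rightarrow> complex"
  assumes h: "h holomorphic_on ball 0 1" and a: "0 < a" and C: "0 \<le> C"
    and bd: "\<And>z. cmod z < 1 \<Longrightarrow> cmod (deriv h z) \<le> C * (1 - cmod z) powr (a - 1)"
    and s: "0 \<le> s" "s \<le> r" "r < 1" and u: "cmod u = 1"
  shows "cmod (h (of_real r * u) - h (of_real s * u)) \<le> C / a * (1 - s) powr a"
proof (cases "s < r")
  case True
  have in1: "of_real x * u \<in> ball 0 1" if "x \<in> {s..r}" for x
    using that s u by (auto simp: norm_mult)
  have D: "((\<lambda>x. h (of_real x * u)) has_vector_derivative u * deriv h (of_real x * u)) (at x)" if "x \<in> {s..r}" for x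
  proof -
    have "(h has_field_derivative deriv h (of_real x * u)) (at (of_real x * u))"
      by (rule holomorphic_derivI[OF h open_ball in1[OF that]])
    moreover have "((\<lambda>x. of_real x * u) has_vector_derivative u) (at x)"
      by (auto intro!: derivative_eq_intros)
    ultimately show ?thesis using field_vector_diff_chain_at[of "\<lambda>x. of_real x * u" u x h] by (simp add: o_def)
  qed
  have "cmod (h (of_real r * u) - h (of_real s * u)) \<le> (- C / a * (1 - r) powr a) - (- C / a * (1 - s) powr a)"
  proof (rule differentiable_bound_general[OF True, where f="\<lambda>x. h (of_real x * u)" and \<phi>="\<lambda>x. - C / a * (1 - x) powr a"
      and f'="\<lambda>x. u * deriv h (of_real x * u)" and \<phi>'="\<lambda>x. C * (1 - x) powr (a - 1)"])
    show "continuous_on {s..r} (\<lambda>x. h (of_real x * u))"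
      by (rule continuous_at_imp_continuous_on) (use D has_vector_derivative_continuous in blast)
    show "continuous_on {s..r} (\<lambda>x. - C / a * (1 - x) powr a)"
      using s by (intro continuous_intros) auto
    fix x assume x: "s < x" "x < r"
    show "((\<lambda>x. - C / a * (1 - x) powr a) has_vector_derivative C * (1 - x) powr (a - 1)) (at x)"
      unfolding has_real_derivative_iff_has_vector_derivative[symmetric]
      using x s a by (auto intro!: derivative_eq_intros simp: field_simps)
    show "((\<lambda>x. h (of_real x * u)) has_vector_derivative u * deriv h (of_real x * u)) (at x)"
      using D x by auto
    show "cmod (u * deriv h (of_real x * u)) \<le> C * (1 - x) powr (a - 1)"
      using bd[of "of_real x * u"] in1[of x] x s u by (simp add: norm_mult)
  qed
  moreover have "0 \<le> C / a * (1 - r) powr a" using C a by simp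
  ultimately show ?thesis by simp
next
  case False
  then have "r = s" using s by simp
  then show ?thesis using C a by simp
qed

lemma norm_diff_le_arc:
  fixes h :: "complex \<Rightarrow> complex"
  assumes h: "h holomorphic_on ball 0 1" and s: "0 \<le> s" "s < 1" and t: "0 < t"
    and bd: "\<And>z. cmod z = s \<Longrightarrow> cmod (deriv h z) \<le> B"
  shows "cmod (h (of_real s * cis t) - h (of_real s)) \<le> B * t"
proof -
  have D: "((\<lambda>x. h (of_real s * cis x)) has_vector_derivative (of_real s * (\<i> * cis x)) * deriv h (of_real s * cis x)) (at x)" for x
  proof -
    have "(h has_field_derivative deriv h (of_real s * cis x)) (at (of_real s * cis x))"
      by (rule holomorphic_derivI[OF h open_ball]) (use s in \<open>auto simp: norm_mult\<close>)
    moreover have "((\<lambda>x. of_real s * cis x) has_vector_derivative of_real s * (\<i> * cis x)) (at x)"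
      by (intro has_vector_derivative_mult_right) (auto intro!: derivative_eq_intros simp: has_vector_derivative_def scaleR_conv_of_real mult_ac)
    ultimately show ?thesis using field_vector_diff_chain_at[of "\<lambda>x. of_real s * cis x" "of_real s * (\<i> * cis x)" x h] by (simp add: o_def)
  qed
  have B: "0 \<le> B" using bd[of "of_real s"] s by (smt (verit) norm_ge_zero norm_of_real)
  have "cmod (h (of_real s * cis t) - h (of_real s * cis 0)) \<le> B * t - B * 0"
  proof (rule differentiable_bound_general[OF t, where f="\<lambda>x. h (of_real s * cis x)" and \<phi>="\<lambda>x. B * x"
      and f'="\<lambda>x. (of_real s * (\<i> * cis x)) * deriv h (of_real s * cis x)" and \<phi>'="\<lambda>_. B"])
    show "continuous_on {0..t} (\<lambda>x. h (of_real s * cis x))"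
      by (rule continuous_at_imp_continuous_on) (use D has_vector_derivative_continuous in blast)
    show "((\<lambda>x. B * x) has_vector_derivative B) (at x)" for x
      unfolding has_real_derivative_iff_has_vector_derivative[symmetric]
      by (auto intro!: derivative_eq_intros)
    show "cmod (of_real s * (\<i> * cis x) * deriv h (of_real s * cis x)) \<le> B" for x
      using bd[of "of_real s * cis x"] s B mult_left_le_one_le[of "cmod (deriv h (of_real s * cis x))" s]
      by (simp add: norm_mult)
  qed (use D in \<open>auto intro!: continuous_intros\<close>)
  then show ?thesis by simp
qed

text \<open>The Hardy--Littlewood detour: inward along a radius to distance \<open>t\<close> from
  the unit circle, along an arc there, and outward again. The two radial legs integrate the
  derivative bound and cost \<open>C / a * t powr a\<close> each; on the arc the derivative is at
  most \<open>C * t powr (a - 1)\<close> and the length at most \<open>t\<close>.\<close>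

lemma norm_increment_le_powr:
  fixes h :: "complex \<Rightarrow> complex"
  assumes h: "h holomorphic_on ball 0 1" and a: "0 < a" "a \<le> 1" and C: "0 \<le> C"
    and bd: "\<And>z. cmod z < 1 \<Longrightarrow> cmod (deriv h z) \<le> C * (1 - cmod z) powr (a - 1)"
    and r: "0 \<le> r" "r < 1" and t: "0 < t" "t \<le> 1"
  shows "cmod (h (of_real r * cis t) - h (of_real r)) \<le> C * (2 / a + 1) * t powr a"
proof -
  \<comment> \<open>If \<open>r\<close> is already at distance at least \<open>t\<close> from 1,
    then \<open>s = r\<close> and the radial legs are empty.\<close>
  define s where "s = min r (1 - t)"
  have s: "0 \<le> s" "s \<le> r" "s < 1" "t \<le> 1 - s" using r t by (auto simp: s_def)
  have rad: "cmod (h (of_real r * u) - h (of_real s * u)) \<le> C / a * t powr a" if u: "cmod u = 1" for u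
  proof (cases "s = r")
    case False
    then have "1 - s = t" by (auto simp: s_def)
    then show ?thesis using norm_diff_le_powr_radial[OF h a(1) C bd s(1,2) r(2) u] by simp
  qed (use a C in simp)
  have "cmod (h (of_real s * cis t) - h (of_real s)) \<le> C * (1 - s) powr (a - 1) * t"
    by (rule norm_diff_le_arc[OF h s(1,3) t(1)]) (use bd s in auto)
  also have "\<dots> \<le> C * t powr (a - 1) * t"
    by (intro mult_right_mono mult_left_mono powr_mono2' C) (use s t a in auto)
  also have "\<dots> = C * t powr a" using t by (simp add: powr_diff)
  finally have arc: "cmod (h (of_real s * cis t) - h (of_real s)) \<le> C * t powr a" .
  have "h (of_real r * cis t) - h (of_real r) = (h (of_real r * cis t) - h (of_real s * cis t)) +
      (h (of_real s * cis t) - h (of_real s)) - (h (of_real r * 1) - h (of_real s * 1))" by simp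
  also have "cmod \<dots> \<le> C / a * t powr a + C * t powr a + C / a * t powr a"
  proof -
    have "norm (x + y - z) \<le> norm x + norm y + norm z" for x y z :: complex
      using norm_triangle_ineq4[of "x + y" z] norm_triangle_ineq[of x y] by linarith
    from this[of "h (of_real r * cis t) - h (of_real s * cis t)" "h (of_real s * cis t) - h (of_real s)" "h (of_real r * 1) - h (of_real s * 1)"]
    show ?thesis using rad[of "cis t"] rad[of 1] arc by simp
  qed
  also have "\<dots> = C * (2 / a + 1) * t powr a" using a by (simp add: field_simps)
  finally show ?thesis .
qed

text \<open>The Hardy--Littlewood form of the mean Lipschitz condition. The bound is asked for all
  radii and not only near 1, which makes it directly usable under integrals in \<open>r\<close>; for
  holomorphic \<open>g\<close> and \<open>p > 1\<close> the two versions agree by monotonicity of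
  the means.\<close>

definition mean_growth :: "real \<Rightarrow> real \<Rightarrow> (complex \<Rightarrow> complex) \<Rightarrow> bool" where
  "mean_growth p a g \<longleftrightarrow>
     (\<exists>C. \<forall>r. 0 \<le> r \<and> r < 1 \<longrightarrow> integral_mean p r (deriv g) \<le> C * (1 - r) powr (a - 1))"

lemma mean_growthE:
  assumes "mean_growth p a g"
  obtains C where "0 < C" "\<And>r. 0 \<le> r \<Longrightarrow> r < 1 \<Longrightarrow> integral_mean p r (deriv g) \<le> C * (1 - r) powr (a - 1)"
proof -
  from assms obtain C where C: "\<And>r. 0 \<le> r \<Longrightarrow> r < 1 \<Longrightarrow> integral_mean p r (deriv g) \<le> C * (1 - r) powr (a - 1)"
    by (auto simp: mean_growth_def)
  show ?thesis
  proof (rule that[of "max C 1"])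
    fix r :: real assume r: "0 \<le> r" "r < 1"
    have "C * (1 - r) powr (a - 1) \<le> max C 1 * (1 - r) powr (a - 1)"
      by (intro mult_right_mono) auto
    with C[OF r] show "integral_mean p r (deriv g) \<le> max C 1 * (1 - r) powr (a - 1)" by linarith
  qed simp
qed

lemma norm_deriv_circle_pairing_le:
  assumes g: "g holomorphic_on ball 0 1" and p: "1 < p" and c: "c \<in> dual_ball p" and z: "cmod z < 1"
  shows "cmod (deriv (circle_pairing c g) z) \<le> integral_mean p (cmod z) (deriv g)"
proof -
  have "(\<lambda>\<theta>. c \<theta> * cis \<theta>) \<in> dual_ball p"
    by (rule dual_ball_cis[OF c]) (auto intro!: continuous_intros)
  then have "cmod (circle_pairing (\<lambda>\<theta>. c \<theta> * cis \<theta>) (deriv g) z) \<le> integral_mean p (cmod z) (deriv g)"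
    by (intro norm_circle_pairing_le p z) (rule holomorphic_on_imp_continuous_on[OF holomorphic_deriv[OF g open_ball]])
  moreover have "deriv (circle_pairing c g) z = circle_pairing (\<lambda>\<theta>. c \<theta> * cis \<theta>) (deriv g) z"
    by (rule DERIV_imp_deriv[OF circle_pairing_has_field_derivative[OF g dual_ball_continuous[OF c] z]])
  ultimately show ?thesis by simp
qed

lemma holomorphic_on_rotate:
  assumes "g holomorphic_on ball 0 1"
  shows "(\<lambda>w. g (w * cis t)) holomorphic_on ball 0 1"
proof -
  have "(\<lambda>w. w * cis t) holomorphic_on ball 0 1" by (intro holomorphic_intros)
  moreover have "(\<lambda>w. w * cis t) ` ball 0 1 \<subseteq> ball 0 1" by (auto simp: norm_mult)
  ultimately show ?thesis
    using holomorphic_on_compose_gen[of "\<lambda>w. w * cis t" "ball 0 1" g "ball 0 1"] assms by (simp add: o_def)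
qed

lemma circle_pairing_increment:
  assumes g: "g holomorphic_on ball 0 1" and c: "continuous_on UNIV c" and z: "cmod z < 1"
  shows "circle_pairing c (\<lambda>w. g (w * cis t) - g w) z = circle_pairing c g (z * cis t) - circle_pairing c g z"
proof -
  have gc: "continuous_on (ball 0 1) g" by (rule holomorphic_on_imp_continuous_on[OF g])
  have "(LINT \<theta>:{0..2*pi}|lborel. c \<theta> * (g (z * cis \<theta> * cis t) - g (z * cis \<theta>)))
      = (LINT \<theta>:{0..2*pi}|lborel. c \<theta> * g (z * cis t * cis \<theta>) - c \<theta> * g (z * cis \<theta>))"
    by (simp add: algebra_simps)
  also have "\<dots> = (LINT \<theta>:{0..2*pi}|lborel. c \<theta> * g (z * cis t * cis \<theta>)) - (LINT \<theta>:{0..2*pi}|lborel. c \<theta> * g (z * cis \<theta>))"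
    by (rule set_integral_diff) (use z in \<open>auto intro!: circle_pairing_integrable[OF gc c] simp: norm_mult\<close>)
  finally show ?thesis by (simp add: circle_pairing_def diff_divide_distrib)
qed

lemma integral_mean_increment_le:
  assumes g: "g holomorphic_on ball 0 1" and p: "1 < p" and a: "0 < a" "a \<le> 1" and C: "0 \<le> C"
    and bd: "\<And>r. 0 \<le> r \<Longrightarrow> r < 1 \<Longrightarrow> integral_mean p r (deriv g) \<le> C * (1 - r) powr (a - 1)"
    and r: "0 \<le> r" "r < 1" and t: "0 < t" "t \<le> 1"
  shows "integral_mean p r (\<lambda>w. g (w * cis t) - g w) \<le> C * (2 / a + 1) * t powr a"
proof -
  have "continuous_on (ball 0 1) (\<lambda>w. g (w * cis t) - g w)"
    by (intro holomorphic_on_imp_continuous_on holomorphic_intros holomorphic_on_rotate g)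
  from circle_pairing_attains[OF this p r] obtain c where
    c: "c \<in> dual_ball p" "circle_pairing c (\<lambda>w. g (w * cis t) - g w) (of_real r) = of_real (integral_mean p r (\<lambda>w. g (w * cis t) - g w))"
    by blast
  have "cmod (circle_pairing c g (of_real r * cis t) - circle_pairing c g (of_real r)) \<le> C * (2 / a + 1) * t powr a"
  proof (rule norm_increment_le_powr[OF circle_pairing_holomorphic[OF g dual_ball_continuous[OF c(1)]] a C _ r t])
    fix z :: complex assume "cmod z < 1"
    then show "cmod (deriv (circle_pairing c g) z) \<le> C * (1 - cmod z) powr (a - 1)"
      using norm_deriv_circle_pairing_le[OF g p c(1)] bd[of "cmod z"] by force
  qed
  moreover have "circle_pairing c g (of_real r * cis t) - circle_pairing c g (of_real r) = of_real (integral_mean p r (\<lambda>w. g (w * cis t) - g w))"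
    using circle_pairing_increment[OF g dual_ball_continuous[OF c(1)], of "of_real r" t] c(2) r by simp
  ultimately show ?thesis by (metis abs_of_nonneg integral_mean_nonneg norm_of_real)
qed

lemma mean_growth_imp_hardy:
  assumes g: "g holomorphic_on ball 0 1" and p: "1 < p" and a: "0 < a" and gr: "mean_growth p a g"
  shows "g \<in> hardy_space p"
proof -
  obtain C where C: "0 < C" "\<And>r. 0 \<le> r \<Longrightarrow> r < 1 \<Longrightarrow> integral_mean p r (deriv g) \<le> C * (1 - r) powr (a - 1)"
    using mean_growthE[OF gr] by blast
  have gc: "continuous_on (ball 0 1) g" by (rule holomorphic_on_imp_continuous_on[OF g])
  have "integral_mean p r g \<le> integral_mean p 0 g + C / a" if r: "r \<in> {0<..<1}" for r
  proof -
    from r have r': "0 \<le> r" "r < 1" by auto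
    from circle_pairing_attains[OF gc p r'] obtain c where
      c: "c \<in> dual_ball p" "circle_pairing c g (of_real r) = of_real (integral_mean p r g)" by blast
    have "cmod (circle_pairing c g (of_real r * 1) - circle_pairing c g (of_real 0 * 1)) \<le> C / a * (1 - 0) powr a"
    proof (rule norm_diff_le_powr_radial[OF circle_pairing_holomorphic[OF g dual_ball_continuous[OF c(1)]] a _ _ _ r'])
      fix z :: complex assume "cmod z < 1"
      then show "cmod (deriv (circle_pairing c g) z) \<le> C * (1 - cmod z) powr (a - 1)"
        using norm_deriv_circle_pairing_le[OF g p c(1)] C(2)[of "cmod z"] by force
    qed (use C in auto)
    moreover have "cmod (circle_pairing c g 0) \<le> integral_mean p 0 g"
      using norm_circle_pairing_le[OF gc c(1) p, of 0] by simp
    moreover have "cmod (circle_pairing c g (of_real r)) = integral_mean p r g"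
      using c(2) by simp
    ultimately show ?thesis
      using norm_triangle_ineq2[of "circle_pairing c g (of_real r)" "circle_pairing c g 0"] by simp
  qed
  then show ?thesis using g by (auto simp: hardy_space_def intro!: bdd_aboveI2[where M="integral_mean p 0 g + C / a"])
qed

section \<open>Radial limits and passage to the boundary\<close>

lemma AE_lborel_shift:
  fixes h :: real
  assumes "AE \<theta> in lborel. P \<theta>"
  shows "AE \<theta> in lborel. P (\<theta> + h)"
proof -
  obtain N where N: "{x. \<not> P x} \<subseteq> N" "emeasure lborel N = 0" "N \<in> sets lborel"
    using AE_E[OF assms] by auto
  have [measurable]: "N \<in> sets borel" using N(3) by simp
  have "AE x in lborel. x \<notin> N"
    by (rule AE_not_in) (use N in \<open>auto simp: null_sets_def\<close>)
  then have "AE x in lborel. h + 1 * x \<notin> N"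
    by (intro AE_borel_affine) auto
  then show ?thesis by eventually_elim (use N(1) in \<open>auto simp: add.commute\<close>)
qed

text \<open>The translates of one period by multiples of \<open>2 * pi\<close> cover the line, and
  there are countably many of them.\<close>

lemma AE_cis_periodic:
  assumes "AE \<theta> in lborel. \<theta> \<in> {0..2*pi} \<longrightarrow> Q (cis \<theta>)"
  shows "AE \<theta> in lborel. Q (cis \<theta>)"
proof -
  have "AE \<theta> in lborel. \<forall>k::int. \<theta> + 2 * pi * of_int k \<in> {0..2*pi} \<longrightarrow> Q (cis (\<theta> + 2 * pi * of_int k))"
    unfolding AE_all_countable
  proof
    fix k :: int
    show "AE \<theta> in lborel. \<theta> + 2 * pi * of_int k \<in> {0..2*pi} \<longrightarrow> Q (cis (\<theta> + 2 * pi * of_int k))"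
      by (rule AE_lborel_shift[OF assms])
  qed
  then show ?thesis
  proof eventually_elim
    case (elim \<theta>)
    define k where "k = \<lfloor>\<theta> / (2*pi)\<rfloor>"
    have "of_int k \<le> \<theta> / (2*pi)" "\<theta> / (2*pi) < of_int k + 1" unfolding k_def by linarith+
    then have "\<theta> + 2 * pi * of_int (- k) \<in> {0..2*pi}" by (simp add: field_simps)
    with elim have "Q (cis (\<theta> + 2 * pi * of_int (- k)))" by blast
    moreover have "cis (\<theta> + 2 * pi * of_int (- k)) = cis \<theta>"
      using cis_multiple_2pi[of "of_int (- k)"] by (simp add: cis_mult[symmetric] del: of_int_minus)
    ultimately show ?case by simp
  qed
qed

lemma one_in_dual_ball: "(\<lambda>_. 1) \<in> dual_ball p"
  by (simp add: dual_ball_def nn_integral_cmult_indicator)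

lemma nn_integral_circle_le_mean:
  assumes F: "continuous_on (ball 0 1) F" and p: "1 < p" and r: "0 \<le> r" "r < 1"
  shows "(\<integral>\<^sup>+\<theta>\<in>{0..2*pi}. ennreal (cmod (F (rcis r \<theta>))) \<partial>lborel) \<le> ennreal (2 * pi * integral_mean p r F)"
proof -
  have "(\<lambda>\<theta>. cmod (F (of_real r * cis \<theta>))) \<in> borel_measurable borel"
    using r by (intro borel_measurable_continuous_onI continuous_on_norm continuous_on_circle F) auto
  then show ?thesis
    using dual_ball_Holder[OF one_in_dual_ball p, of "\<lambda>\<theta>. cmod (F (rcis r \<theta>))" "integral_mean p r F"]
      nn_integral_mean[OF F r, of p] p by (simp add: rcis_def)
qed

text \<open>Along the radius \<open>g\<close> is a constant plus the indefinite integral of an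
  integrable function, and such an integral is continuous up to the endpoint 1.\<close>

lemma radial_limit_exists:
  assumes g: "g holomorphic_on ball 0 1"
    and fin: "(\<integral>\<^sup>+r\<in>{0..<1}. ennreal (cmod (deriv g (rcis r \<theta>))) \<partial>lborel) < \<infinity>"
  shows "\<exists>l. ((\<lambda>r. g (rcis r \<theta>)) \<longlongrightarrow> l) (at_left 1)"
proof -
  define \<phi> where "\<phi> r = indicator {0..<1} r *\<^sub>R (cis \<theta> * deriv g (rcis r \<theta>))" for r :: real
  have Gc: "continuous_on (ball 0 1) (deriv g)"
    by (rule holomorphic_on_imp_continuous_on[OF holomorphic_deriv[OF g open_ball]])
  have [measurable]: "\<phi> \<in> borel_measurable borel"
    unfolding \<phi>_def[abs_def] rcis_def
    by (intro borel_measurable_continuous_on_indicator continuous_intros continuous_on_compose2[OF Gc])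
       (auto simp: norm_mult)
  have "(\<integral>\<^sup>+r. ennreal (cmod (\<phi> r)) \<partial>lborel) = (\<integral>\<^sup>+r\<in>{0..<1}. ennreal (cmod (deriv g (rcis r \<theta>))) \<partial>lborel)"
    by (intro nn_integral_cong) (auto simp: \<phi>_def indicator_def norm_mult)
  then have "integrable lborel \<phi>" using fin by (intro integrableI_bounded) auto
  then have "set_integrable lborel {0..1} \<phi>" unfolding set_integrable_def
    by (intro integrable_mult_indicator) auto
  then have "\<phi> integrable_on {0..1}" by (rule set_borel_integral_eq_integral)
  then have cont: "continuous_on {0..1} (\<lambda>x. integral {0..x} \<phi>)" by (rule indefinite_integral_continuous_1)
  have eq: "g (rcis r \<theta>) = g 0 + integral {0..r} \<phi>" if r: "0 \<le> r" "r < 1" for r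
  proof -
    have "((\<lambda>x. cis \<theta> * deriv g (rcis x \<theta>)) has_integral (g (rcis r \<theta>) - g (rcis 0 \<theta>))) {0..r}"
    proof (rule fundamental_theorem_of_calculus[OF r(1)])
      fix x assume x: "x \<in> {0..r}"
      have "(g has_field_derivative deriv g (rcis x \<theta>)) (at (rcis x \<theta>))"
        by (rule holomorphic_derivI[OF g open_ball]) (use x r in auto)
      moreover have "((\<lambda>x. rcis x \<theta>) has_vector_derivative cis \<theta>) (at x)"
        unfolding rcis_def by (auto intro!: derivative_eq_intros)
      ultimately have "((\<lambda>x. g (rcis x \<theta>)) has_vector_derivative cis \<theta> * deriv g (rcis x \<theta>)) (at x)"
        using field_vector_diff_chain_at[of "\<lambda>x. rcis x \<theta>" "cis \<theta>" x g] by (simp add: o_def)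
      then show "((\<lambda>x. g (rcis x \<theta>)) has_vector_derivative cis \<theta> * deriv g (rcis x \<theta>)) (at x within {0..r})"
        by (rule has_vector_derivative_at_within)
    qed
    then have "(\<phi> has_integral (g (rcis r \<theta>) - g (rcis 0 \<theta>))) {0..r}"
      by (rule has_integral_eq[rotated]) (use r in \<open>auto simp: \<phi>_def\<close>)
    then show ?thesis by (simp add: integral_unique)
  qed
  have "((\<lambda>x. integral {0..x} \<phi>) \<longlongrightarrow> integral {0..1} \<phi>) (at_left 1)"
    using continuous_on_Icc_at_leftD[OF cont] by simp
  then have "((\<lambda>x. g 0 + integral {0..x} \<phi>) \<longlongrightarrow> g 0 + integral {0..1} \<phi>) (at_left 1)"
    by (intro tendsto_intros)
  moreover have "\<forall>\<^sub>F r in at_left 1. g 0 + integral {0..r} \<phi> = g (rcis r \<theta>)"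
    using eventually_at_left_real[of 0 1] by (auto elim!: eventually_mono simp: eq)
  ultimately show ?thesis by (blast intro: Lim_transform_eventually)
qed

lemma nn_integral_Fatou_powr:
  fixes u :: "nat \<Rightarrow> 'a \<Rightarrow> complex"
  assumes [measurable]: "\<And>n. u n \<in> borel_measurable M"
    and lim: "AE x in M. (\<lambda>n. u n x) \<longlonglongrightarrow> U x" and p: "0 < p"
    and B: "\<And>n. (\<integral>\<^sup>+x. ennreal (cmod (u n x) powr p) \<partial>M) \<le> B"
  shows "(\<integral>\<^sup>+x. ennreal (cmod (U x) powr p) \<partial>M) \<le> B"
proof -
  have "(\<integral>\<^sup>+x. ennreal (cmod (U x) powr p) \<partial>M) = (\<integral>\<^sup>+x. liminf (\<lambda>n. ennreal (cmod (u n x) powr p)) \<partial>M)"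
  proof (rule nn_integral_cong_AE)
    show "AE x in M. ennreal (cmod (U x) powr p) = liminf (\<lambda>n. ennreal (cmod (u n x) powr p))"
      using lim
    proof eventually_elim
      case (elim x)
      have "isCont (\<lambda>w. cmod w powr p) (U x)"
        using continuous_on_norm_powr[of UNIV "\<lambda>w. w" p] p by (simp add: continuous_on_eq_continuous_at)
      then have "(\<lambda>n. cmod (u n x) powr p) \<longlonglongrightarrow> cmod (U x) powr p"
        using elim by (rule isCont_tendsto_compose)
      then have L: "(\<lambda>n. ennreal (cmod (u n x) powr p)) \<longlonglongrightarrow> ennreal (cmod (U x) powr p)"
        by (rule tendsto_ennrealI)
      show ?case by (rule lim_imp_Liminf[OF sequentially_bot L, symmetric])
    qed
  qed
  also have "\<dots> \<le> liminf (\<lambda>n. \<integral>\<^sup>+x. ennreal (cmod (u n x) powr p) \<partial>M)"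
    by (rule nn_integral_liminf) measurable
  also have "\<dots> \<le> B"
    by (intro order_trans[OF Liminf_le_Limsup] Limsup_bounded) (use B in auto)
  finally show ?thesis .
qed

text \<open>The cut-off to the disc makes the function Borel measurable on the whole plane. Where the limit
  does not exist, the value is arbitrary.\<close>

definition radial_limit :: "(complex \<Rightarrow> complex) \<Rightarrow> complex \<Rightarrow> complex" where
  "radial_limit g \<zeta> = lim (\<lambda>n. indicator (ball 0 1) (of_real (radius n) * \<zeta>) *\<^sub>R g (of_real (radius n) * \<zeta>))"

lemma borel_measurable_radial_limit:
  assumes "continuous_on (ball 0 1) g"
  shows "radial_limit g \<in> borel_measurable borel"
proof -
  have "(\<lambda>\<zeta>. indicator (ball 0 1) (of_real (radius n) * \<zeta>) *\<^sub>R g (of_real (radius n) * \<zeta>)) \<in> borel_measurable borel" for n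
    by (rule measurable_compose[OF _ borel_measurable_disc[OF assms]]) simp
  then show ?thesis unfolding radial_limit_def[abs_def] by (rule borel_measurable_lim_metric)
qed

lemma radial_limit_eq:
  assumes "((\<lambda>r. g (rcis r \<theta>)) \<longlongrightarrow> l) (at_left 1)"
  shows "(\<lambda>n. g (of_real (radius n) * cis \<theta>)) \<longlonglongrightarrow> l" "radial_limit g (cis \<theta>) = l"
proof -
  show *: "(\<lambda>n. g (of_real (radius n) * cis \<theta>)) \<longlonglongrightarrow> l"
    using filterlim_compose[OF assms radius_at_left] by (simp add: rcis_def)
  have "(\<lambda>n. indicator (ball 0 1) (of_real (radius n) * cis \<theta>) *\<^sub>R g (of_real (radius n) * cis \<theta>)) \<longlonglongrightarrow> l"
    using * radius by (simp add: norm_mult less_imp_le abs_of_pos)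
  then show "radial_limit g (cis \<theta>) = l" unfolding radial_limit_def by (rule limI)
qed

text \<open>Since \<open>a - 1 > -1\<close>, the growth bound makes \<open>|g'|\<close> integrable
  over all radii and angles. By Tonelli it is integrable along almost every single radius, where the
  limit then exists.\<close>

lemma mean_growth_radial_limit:
  assumes g: "g holomorphic_on ball 0 1" and p: "1 < p" and a: "0 < a" and gr: "mean_growth p a g"
  shows "AE \<theta> in lborel. ((\<lambda>r. g (rcis r \<theta>)) \<longlongrightarrow> radial_limit g (cis \<theta>)) (at_left 1)"
proof -
  obtain C where C: "0 < C" "\<And>r. 0 \<le> r \<Longrightarrow> r < 1 \<Longrightarrow> integral_mean p r (deriv g) \<le> C * (1 - r) powr (a - 1)"
    using mean_growthE[OF gr] by blast
  define G where "G w = indicator (ball 0 1) w *\<^sub>R deriv g w" for w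
  have Gc: "continuous_on (ball 0 1) (deriv g)"
    by (rule holomorphic_on_imp_continuous_on[OF holomorphic_deriv[OF g open_ball]])
  have [measurable]: "G \<in> borel_measurable borel"
    unfolding G_def[abs_def] by (rule borel_measurable_disc[OF Gc])
  have G: "G (rcis r \<theta>) = deriv g (rcis r \<theta>)" if "r \<in> {0..<1}" for r \<theta>
    using that by (simp add: G_def)
  have "(\<integral>\<^sup>+\<theta>. (\<integral>\<^sup>+r. ennreal (cmod (G (of_real r * cis \<theta>))) * indicator {0..<1} r * indicator {0..2*pi} \<theta> \<partial>lborel) \<partial>lborel)
      = (\<integral>\<^sup>+r. (\<integral>\<^sup>+\<theta>. ennreal (cmod (G (of_real r * cis \<theta>))) * indicator {0..<1} r * indicator {0..2*pi} \<theta> \<partial>lborel) \<partial>lborel)"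
    by (rule lborel_pair.Fubini'[symmetric]) measurable
  also have "\<dots> \<le> (\<integral>\<^sup>+r. ennreal (2 * pi * C) * (ennreal ((1 - r) powr (a - 1)) * indicator {0..<1} r) \<partial>lborel)"
  proof (rule nn_integral_mono)
    fix r :: real
    show "(\<integral>\<^sup>+\<theta>. ennreal (cmod (G (of_real r * cis \<theta>))) * indicator {0..<1} r * indicator {0..2*pi} \<theta> \<partial>lborel)
       \<le> ennreal (2 * pi * C) * (ennreal ((1 - r) powr (a - 1)) * indicator {0..<1} r)"
    proof (cases "r \<in> {0..<1}")
      case True
      have "(\<integral>\<^sup>+\<theta>. ennreal (cmod (G (of_real r * cis \<theta>))) * indicator {0..<1} r * indicator {0..2*pi} \<theta> \<partial>lborel)
          = (\<integral>\<^sup>+\<theta>\<in>{0..2*pi}. ennreal (cmod (deriv g (rcis r \<theta>))) \<partial>lborel)"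
        by (intro nn_integral_cong) (use True G[OF True] in \<open>auto simp: rcis_def\<close>)
      also have "\<dots> \<le> ennreal (2 * pi * integral_mean p r (deriv g))"
        by (rule nn_integral_circle_le_mean[OF Gc p]) (use True in auto)
      also have "\<dots> \<le> ennreal (2 * pi * (C * (1 - r) powr (a - 1)))"
        by (intro ennreal_leI mult_left_mono C) (use True in auto)
      also have "\<dots> = ennreal (2 * pi * C) * (ennreal ((1 - r) powr (a - 1)) * indicator {0..<1} r)"
        using True C by (simp add: ennreal_mult[symmetric] mult_ac)
      finally show ?thesis .
    qed simp
  qed
  also have "\<dots> = ennreal (2 * pi * C) * ennreal (1 / (a - 1 + 1))"
    by (subst nn_integral_cmult) (use nn_integral_one_minus_powr[of "a - 1"] a in auto)
  also have "\<dots> < \<infinity>" by (simp add: ennreal_mult_less_top)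
  finally have fin: "(\<integral>\<^sup>+\<theta>. (\<integral>\<^sup>+r. ennreal (cmod (G (of_real r * cis \<theta>))) * indicator {0..<1} r * indicator {0..2*pi} \<theta> \<partial>lborel) \<partial>lborel) < \<infinity>" .
  have "AE \<theta> in lborel. (\<integral>\<^sup>+r. ennreal (cmod (G (of_real r * cis \<theta>))) * indicator {0..<1} r * indicator {0..2*pi} \<theta> \<partial>lborel) \<noteq> \<infinity>"
    by (rule nn_integral_noteq_infinite) (measurable, use fin in \<open>simp add: less_top\<close>)
  then have "AE \<theta> in lborel. \<theta> \<in> {0..2*pi} \<longrightarrow> (\<exists>l. ((\<lambda>r. g (of_real r * cis \<theta>)) \<longlongrightarrow> l) (at_left 1))"
  proof eventually_elim
    case (elim \<theta>)
    show ?case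
    proof
      assume th: "\<theta> \<in> {0..2*pi}"
      have "(\<integral>\<^sup>+r\<in>{0..<1}. ennreal (cmod (deriv g (rcis r \<theta>))) \<partial>lborel)
        = (\<integral>\<^sup>+r. ennreal (cmod (G (of_real r * cis \<theta>))) * indicator {0..<1} r * indicator {0..2*pi} \<theta> \<partial>lborel)"
        by (intro nn_integral_cong) (use th G in \<open>auto simp: rcis_def indicator_def\<close>)
      with elim have "(\<integral>\<^sup>+r\<in>{0..<1}. ennreal (cmod (deriv g (rcis r \<theta>))) \<partial>lborel) < \<infinity>"
        by (simp add: less_top)
      from radial_limit_exists[OF g this] show "\<exists>l. ((\<lambda>r. g (of_real r * cis \<theta>)) \<longlongrightarrow> l) (at_left 1)"
        by (simp add: rcis_def)
    qed
  qed
  from AE_cis_periodic[OF this] show ?thesis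
    by eventually_elim (use radial_limit_eq(2) in \<open>auto simp: rcis_def\<close>)
qed

text \<open>Fatou's lemma along the circles of radius \<open>radius n\<close>: pointwise convergence
  of the increments almost everywhere suffices, and convergence in \<open>L^p\<close> is not asked
  for.\<close>

lemma nn_integral_boundary_increment_le:
  assumes g: "g holomorphic_on ball 0 1" and p: "0 < p"
    and AE: "AE \<theta> in lborel. ((\<lambda>r. g (rcis r \<theta>)) \<longlongrightarrow> b (cis \<theta>)) (at_left 1)"
    and B: "\<And>n. integral_mean p (radius n) (\<lambda>w. g (w * cis h) - g w) \<le> B"
  shows "(\<integral>\<^sup>+\<theta>. ennreal (cmod (indicator {0..2*pi} \<theta> *\<^sub>R (b (cis (\<theta> + h)) - b (cis \<theta>))) powr p) \<partial>lborel)
    \<le> ennreal (2 * pi * B powr p)"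
proof -
  have gc: "continuous_on (ball 0 1) g" by (rule holomorphic_on_imp_continuous_on[OF g])
  have inc: "continuous_on (ball 0 1) (\<lambda>w. g (w * cis h) - g w)"
    by (intro holomorphic_on_imp_continuous_on holomorphic_intros holomorphic_on_rotate g)
  show ?thesis
  proof (rule nn_integral_Fatou_powr)
    show "(\<lambda>\<theta>. indicator {0..2*pi} \<theta> *\<^sub>R (g (of_real (radius n) * cis (\<theta> + h)) - g (of_real (radius n) * cis \<theta>))) \<in> borel_measurable lborel" for n
    proof -
      have "continuous_on UNIV (\<lambda>\<theta>. g (of_real (radius n) * cis (\<theta> + h)) - g (of_real (radius n) * cis \<theta>))"
        using radius[of n] by (intro continuous_intros continuous_on_compose2[OF gc]) (auto simp: norm_mult)
      then have [measurable]: "(\<lambda>\<theta>. g (of_real (radius n) * cis (\<theta> + h)) - g (of_real (radius n) * cis \<theta>)) \<in> borel_measurable borel"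
        by (rule borel_measurable_continuous_onI)
      show ?thesis by measurable
    qed
    show "AE \<theta> in lborel. (\<lambda>n. indicator {0..2*pi} \<theta> *\<^sub>R (g (of_real (radius n) * cis (\<theta> + h)) - g (of_real (radius n) * cis \<theta>)))
        \<longlonglongrightarrow> indicator {0..2*pi} \<theta> *\<^sub>R (b (cis (\<theta> + h)) - b (cis \<theta>))"
      using AE AE_lborel_shift[OF AE, of h]
      by eventually_elim (intro tendsto_intros radial_limit_eq(1))
    show "(\<integral>\<^sup>+\<theta>. ennreal (cmod (indicator {0..2*pi} \<theta> *\<^sub>R (g (of_real (radius n) * cis (\<theta> + h)) - g (of_real (radius n) * cis \<theta>))) powr p) \<partial>lborel)
        \<le> ennreal (2 * pi * B powr p)" for n
    proof -
      have "(\<integral>\<^sup>+\<theta>. ennreal (cmod (indicator {0..2*pi} \<theta> *\<^sub>R (g (of_real (radius n) * cis (\<theta> + h)) - g (of_real (radius n) * cis \<theta>))) powr p) \<partial>lborel)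
         = (\<integral>\<^sup>+\<theta>\<in>{0..2*pi}. ennreal (cmod ((\<lambda>w. g (w * cis h) - g w) (rcis (radius n) \<theta>)) powr p) \<partial>lborel)"
        using p by (intro nn_integral_cong) (auto simp: indicator_def rcis_def cis_mult mult.assoc)
      also have "\<dots> = ennreal (2 * pi * integral_mean p (radius n) (\<lambda>w. g (w * cis h) - g w) powr p)"
        by (rule nn_integral_mean[OF inc]) (use radius p in auto)
      also have "\<dots> \<le> ennreal (2 * pi * B powr p)"
        by (intro ennreal_leI mult_left_mono powr_mono2 B) (use p in auto)
      finally show ?thesis .
    qed
  qed (use p in auto)
qed

lemma mean_growth_imp_mean_lipschitz:
  assumes g: "g holomorphic_on ball 0 1" and p: "1 < p" and a: "0 < a" "a \<le> 1" and gr: "mean_growth p a g"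
  shows "g \<in> mean_lipschitz p a"
proof -
  obtain C where C: "0 < C" "\<And>r. 0 \<le> r \<Longrightarrow> r < 1 \<Longrightarrow> integral_mean p r (deriv g) \<le> C * (1 - r) powr (a - 1)"
    using mean_growthE[OF gr] by blast
  define K where "K = C * (2 / a + 1)"
  have K: "0 < K" using C a by (simp add: K_def add_pos_pos)
  have gc: "continuous_on (ball 0 1) g" by (rule holomorphic_on_imp_continuous_on[OF g])
  define b where "b = radial_limit g"
  have bm[measurable]: "b \<in> borel_measurable borel"
    unfolding b_def by (rule borel_measurable_radial_limit[OF gc])
  have AE: "AE \<theta> in lborel. ((\<lambda>r. g (rcis r \<theta>)) \<longlongrightarrow> b (cis \<theta>)) (at_left 1)"
    unfolding b_def by (rule mean_growth_radial_limit[OF g p a(1) gr])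
  then have bd: "is_boundary_function g b"
    unfolding is_boundary_function_def by (rule AE_completion)
  have term_le: "((1 / (2 * pi)) * (LINT \<theta>:{0..2 * pi}|lebesgue. cmod (b (cis (\<theta> + h)) - b (cis \<theta>)) powr p)) powr (1 / p) \<le> K * h powr a"
    if h: "0 < h" "h \<le> 1" for h
  proof -
    have "(\<integral>\<^sup>+\<theta>. ennreal (cmod (indicator {0..2*pi} \<theta> *\<^sub>R (b (cis (\<theta> + h)) - b (cis \<theta>))) powr p) \<partial>lborel) \<le> ennreal (2 * pi * (K * h powr a) powr p)"
      unfolding K_def
      by (rule nn_integral_boundary_increment_le[OF g _ AE integral_mean_increment_le[OF g p a]])
         (use C p radius h in auto)
    also have "(\<integral>\<^sup>+\<theta>. ennreal (cmod (indicator {0..2*pi} \<theta> *\<^sub>R (b (cis (\<theta> + h)) - b (cis \<theta>))) powr p) \<partial>lborel)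
       = (\<integral>\<^sup>+\<theta>. ennreal (indicator {0..2*pi} \<theta> *\<^sub>R cmod (b (cis (\<theta> + h)) - b (cis \<theta>)) powr p) \<partial>lborel)"
      using p by (intro nn_integral_cong) (auto simp: indicator_def)
    finally have "(LINT \<theta>|lborel. indicator {0..2*pi} \<theta> *\<^sub>R cmod (b (cis (\<theta> + h)) - b (cis \<theta>)) powr p) \<le> 2 * pi * (K * h powr a) powr p"
      by (intro integral_real_bounded) auto
    \<comment> \<open>The definition integrates over the completed measure. As \<open>b\<close> is
      Borel, the value is the same for \<open>lborel\<close>.\<close>
    moreover have "(LINT \<theta>:{0..2 * pi}|lebesgue. cmod (b (cis (\<theta> + h)) - b (cis \<theta>)) powr p)
       = (LINT \<theta>|lborel. indicator {0..2*pi} \<theta> *\<^sub>R cmod (b (cis (\<theta> + h)) - b (cis \<theta>)) powr p)"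
      unfolding set_lebesgue_integral_def by (rule integral_completion) measurable
    ultimately have "(1 / (2 * pi)) * (LINT \<theta>:{0..2 * pi}|lebesgue. cmod (b (cis (\<theta> + h)) - b (cis \<theta>)) powr p) \<le> (K * h powr a) powr p"
      by (simp add: field_simps)
    moreover have "0 \<le> (LINT \<theta>:{0..2 * pi}|lebesgue. cmod (b (cis (\<theta> + h)) - b (cis \<theta>)) powr p)"
      unfolding set_lebesgue_integral_def by (intro integral_nonneg_AE) auto
    ultimately have "((1 / (2 * pi)) * (LINT \<theta>:{0..2 * pi}|lebesgue. cmod (b (cis (\<theta> + h)) - b (cis \<theta>)) powr p)) powr (1 / p) \<le> ((K * h powr a) powr p) powr (1 / p)"
      using p by (intro powr_mono2) auto
    then show ?thesis using p K by (simp add: powr_powr)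
  qed
  have mod_le: "\<bar>modulus_of_continuity p b t\<bar> \<le> K * t powr a" if t: "0 < t" "t \<le> 1" for t
  proof -
    have le: "((1 / (2 * pi)) * (LINT \<theta>:{0..2 * pi}|lebesgue. cmod (b (cis (\<theta> + h)) - b (cis \<theta>)) powr p)) powr (1 / p) \<le> K * t powr a"
      if "h \<in> {0<..t}" for h
    proof -
      have "K * h powr a \<le> K * t powr a" using that t K a by (intro mult_left_mono powr_mono2) auto
      then show ?thesis using term_le[of h] that t by auto
    qed
    have "modulus_of_continuity p b t \<le> K * t powr a"
      unfolding modulus_of_continuity_def by (rule cSUP_least) (use t le in auto)
    \<comment> \<open>The term at \<open>h = t\<close> is nonnegative and lies below the supremum
      because the set is bounded above; a real \<open>SUP\<close> over an unbounded set would be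
      unspecified.\<close>
    moreover have "0 \<le> modulus_of_continuity p b t"
      unfolding modulus_of_continuity_def
      by (rule cSUP_upper2[where x=t]) (use t le in \<open>auto intro!: bdd_aboveI2[where M="K * t powr a"]\<close>)
    ultimately show ?thesis by simp
  qed
  have "modulus_of_continuity p b \<in> O[at_right 0](\<lambda>t. t powr a)"
  proof (rule bigoI[where c=K])
    show "\<forall>\<^sub>F t in at_right 0. norm (modulus_of_continuity p b t) \<le> K * norm (t powr a)"
      using eventually_at_right_real[of 0 1] by (auto elim!: eventually_mono intro!: mod_le)
  qed
  with bd mean_growth_imp_hardy[OF g p a(1) gr] show ?thesis
    by (auto simp: mean_lipschitz_def)
qed

section \<open>From increments back to derivative growth\<close>

lemma half_le_sin:
  assumes "0 \<le> x" "x \<le> pi / 2"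
  shows "x / 2 \<le> sin x"
proof -
  have "\<bar>sin x - (\<Sum>m<3. sin_coeff m * x ^ m)\<bar> \<le> inverse (fact 3) * \<bar>x\<bar> ^ 3"
    by (rule Maclaurin_sin_bound)
  moreover have "(\<Sum>m<3. sin_coeff m * x ^ m) = x"
    by (simp add: eval_nat_numeral sin_coeff_def)
  moreover have "fact 3 = (6::real)" by (simp add: eval_nat_numeral)
  ultimately have "x - x ^ 3 / 6 \<le> sin x" using assms(1) by (simp add: abs_if field_simps split: if_splits)
  moreover have "x * (x\<^sup>2 / 6) \<le> x * (1 / 2)"
  proof (rule mult_left_mono)
    \<comment> \<open>All that is needed is \<open>x\<^sup>2 \<le> 3\<close>; the value 1.6 is a
      convenient bound for \<open>pi / 2\<close>, with square 2.56.\<close>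
    have "x \<le> 1.6" using assms(2) pi_less_4 pi_approx by simp
    then have "x\<^sup>2 \<le> 1.6\<^sup>2" using assms(1) by (intro power_mono) auto
    then show "x\<^sup>2 / 6 \<le> 1 / 2" by (simp add: power2_eq_square)
  qed (use assms in auto)
  ultimately show ?thesis by (simp add: power2_eq_square power3_eq_cube)
qed

text \<open>By the law of cosines the squared distance is \<open>(\<rho> - r)\<^sup>2 + 4 * \<rho> *
  r * (sin (\<phi> / 2))\<^sup>2\<close>. The minimum is the distance \<open>m\<close> from
  \<open>\<phi>\<close> to the nearer end of the period; the sine is the same for \<open>m\<close>,
  and \<open>m / 2\<close> lies in the range where \<open>sin x \<ge> x / 2\<close>.\<close>

lemma norm_cis_diff_ge:
  fixes \<rho> r \<phi> :: real
  assumes "0 \<le> r" "0 \<le> \<rho>" "0 \<le> \<phi>" "\<phi> \<le> 2 * pi"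
  shows "(\<rho> - r)\<^sup>2 + \<rho> * r * (min \<phi> (2 * pi - \<phi>))\<^sup>2 / 4 \<le> (cmod (of_real \<rho> * cis \<phi> - of_real r))\<^sup>2"
proof -
  define m where "m = min \<phi> (2 * pi - \<phi>)"
  have m: "0 \<le> m" "m \<le> pi" using assms by (auto simp: m_def min_def)
  have "sin (\<phi> / 2) = sin (m / 2)"
  proof (cases "\<phi> \<le> 2 * pi - \<phi>")
    case False
    then have "m / 2 = pi - \<phi> / 2" by (simp add: m_def field_simps)
    then have "sin (m / 2) = sin (pi - \<phi> / 2)" by (simp only:)
    then show ?thesis by simp
  qed (simp add: m_def)
  moreover have "m / 4 \<le> sin (m / 2)" using half_le_sin[of "m / 2"] m by simp
  ultimately have "(m / 4)\<^sup>2 \<le> (sin (\<phi> / 2))\<^sup>2" using m by (intro power_mono) auto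
  then have "4 * (\<rho> * r) * (m / 4)\<^sup>2 \<le> 4 * (\<rho> * r) * (sin (\<phi> / 2))\<^sup>2"
    using assms by (intro mult_left_mono) auto
  then have *: "\<rho> * r * m\<^sup>2 / 4 \<le> 4 * (\<rho> * r) * (sin (\<phi> / 2))\<^sup>2"
    by (simp add: power2_eq_square mult_ac)
  have "cos \<phi> = 1 - 2 * (sin (\<phi> / 2))\<^sup>2" using cos_double_sin[of "\<phi> / 2"] by simp
  moreover have "(cmod (of_real \<rho> * cis \<phi> - of_real r))\<^sup>2 = (\<rho> - r)\<^sup>2 + 2 * (\<rho> * r) * (1 - cos \<phi>)"
  proof -
    have "(cmod (of_real \<rho> * cis \<phi> - of_real r))\<^sup>2 = (\<rho> * cos \<phi> - r)\<^sup>2 + (\<rho> * sin \<phi>)\<^sup>2"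
      by (simp add: cmod_power2)
    also have "\<dots> = \<rho>\<^sup>2 * ((sin \<phi>)\<^sup>2 + (cos \<phi>)\<^sup>2) + r\<^sup>2 - 2 * (\<rho> * r) * cos \<phi>"
      by (simp only: power2_eq_square) algebra
    also have "(sin \<phi>)\<^sup>2 + (cos \<phi>)\<^sup>2 = 1" by (rule sin_cos_squared_add)
    finally show ?thesis by (simp add: power2_eq_square algebra_simps)
  qed
  ultimately show ?thesis using * by (simp add: m_def)
qed

text \<open>Of the radial and the angular contribution the larger one is kept. For
  \<open>r \<ge> 1 / 2\<close> the product of the radii is at least 3/8, so the angular term is at
  least \<open>m\<^sup>2 / 16\<close>, while the radial one is
  \<open>((1 - r) / 2)\<^sup>2\<close>.\<close>

lemma norm_cis_diff_ge_max:
  assumes r: "1 / 2 \<le> r" "r < 1" and \<phi>: "0 \<le> \<phi>" "\<phi> \<le> 2 * pi"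
  shows "(max (min \<phi> (2 * pi - \<phi>)) ((1 - r) / 2))\<^sup>2 / 16 \<le> (cmod (of_real ((1 + r) / 2) * cis \<phi> - of_real r))\<^sup>2"
proof -
  define \<rho> where "\<rho> = (1 + r) / 2"
  define m where "m = min \<phi> (2 * pi - \<phi>)"
  have "3 / 4 * (1 / 2) \<le> \<rho> * r" using r by (intro mult_mono) (auto simp: \<rho>_def)
  then have "1 / 4 * m\<^sup>2 \<le> \<rho> * r * m\<^sup>2" by (intro mult_right_mono) auto
  moreover have "(\<rho> - r)\<^sup>2 + \<rho> * r * m\<^sup>2 / 4 \<le> (cmod (of_real \<rho> * cis \<phi> - of_real r))\<^sup>2"
    unfolding m_def using r \<phi> by (intro norm_cis_diff_ge) (auto simp: \<rho>_def)
  moreover have "\<rho> - r = (1 - r) / 2" by (simp add: \<rho>_def field_simps)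
  moreover have "0 \<le> ((1 - r) / 2)\<^sup>2" "0 \<le> m\<^sup>2" by auto
  moreover have "(max m ((1 - r) / 2))\<^sup>2 = m\<^sup>2 \<or> (max m ((1 - r) / 2))\<^sup>2 = (\<rho> - r)\<^sup>2"
    by (auto simp: max_def \<rho>_def field_simps)
  moreover have "0 \<le> (\<rho> - r)\<^sup>2" by simp
  ultimately show ?thesis unfolding m_def[symmetric] \<rho>_def[symmetric]
    by linarith
qed

lemma nn_integral_min_arc_le:
  fixes k :: "real \<Rightarrow> ennreal"
  assumes [measurable]: "k \<in> borel_measurable borel"
  shows "(\<integral>\<^sup>+\<phi>\<in>{0..2*pi}. k (min \<phi> (2 * pi - \<phi>)) \<partial>lborel) \<le> 2 * (\<integral>\<^sup>+\<phi>\<in>{0<..}. k \<phi> \<partial>lborel)"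
proof -
  have "(\<integral>\<^sup>+\<phi>\<in>{0..2*pi}. k (min \<phi> (2 * pi - \<phi>)) \<partial>lborel)
    \<le> (\<integral>\<^sup>+\<phi>. k \<phi> * indicator {0<..} \<phi> + k (2 * pi - \<phi>) * indicator {0<..} (2 * pi - \<phi>) \<partial>lborel)"
  proof (rule nn_integral_mono_AE)
    show "AE \<phi> in lborel. k (min \<phi> (2 * pi - \<phi>)) * indicator {0..2 * pi} \<phi>
        \<le> k \<phi> * indicator {0<..} \<phi> + k (2 * pi - \<phi>) * indicator {0<..} (2 * pi - \<phi>)"
      using AE_lborel_singleton[of 0] AE_lborel_singleton[of "2 * pi"]
      by eventually_elim (auto simp: indicator_def min_def)
  qed
  also have "\<dots> = (\<integral>\<^sup>+\<phi>\<in>{0<..}. k \<phi> \<partial>lborel) + (\<integral>\<^sup>+\<phi>. k (2 * pi - \<phi>) * indicator {0<..} (2 * pi - \<phi>) \<partial>lborel)"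
    by (rule nn_integral_add) measurable
  also have "(\<integral>\<^sup>+\<phi>. k (2 * pi - \<phi>) * indicator {0<..} (2 * pi - \<phi>) \<partial>lborel) = (\<integral>\<^sup>+\<phi>\<in>{0<..}. k \<phi> \<partial>lborel)"
  proof -
    define k' where "k' \<phi> = k \<phi> * indicator {0<..} \<phi>" for \<phi>
    have "(\<integral>\<^sup>+\<phi>. k' \<phi> \<partial>lborel) = ennreal \<bar>-1\<bar> * (\<integral>\<^sup>+\<phi>. k' (2 * pi + (-1) * \<phi>) \<partial>lborel)"
      by (rule nn_integral_real_affine) (auto simp: k'_def[abs_def])
    then have "(\<integral>\<^sup>+\<phi>. k' (2 * pi - \<phi>) \<partial>lborel) = (\<integral>\<^sup>+\<phi>. k' \<phi> \<partial>lborel)" by simp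
    then show ?thesis by (simp only: k'_def)
  qed
  finally show ?thesis unfolding mult_2 .
qed

lemma inverse_sum_nonneg:
  fixes a :: real
  assumes "0 < a" "a < 1"
  shows "0 \<le> 1 / (a + 1) - 1 / (a - 1)"
proof -
  have "0 \<le> 1 / (a + 1)" "1 / (a - 1) \<le> 0" using assms by (auto simp: divide_le_0_iff)
  then show ?thesis by linarith
qed

text \<open>Cauchy's formula for the derivative on the circle midway between \<open>r\<close> and 1.
  Its kernel has size about \<open>max m \<delta> powr (-2)\<close>, which alone would give only
  \<open>1 / \<delta>\<close>; the Hoelder factor \<open>m powr a\<close> improves this to
  \<open>\<delta> powr (a - 1)\<close>. The condition \<open>a < 1\<close> is convergence of the
  resulting integral at infinity.\<close>

lemma norm_deriv_le_of_increments:
  fixes h :: "complex \<Rightarrow> complex"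
  assumes h: "h holomorphic_on ball 0 1" and a: "0 < a" "a < 1" and K: "0 \<le> K"
    and r: "1 / 2 \<le> r" "r < 1" and \<rho>: "\<rho> = (1 + r) / 2"
    and inc: "\<And>\<phi>. 0 \<le> \<phi> \<Longrightarrow> \<phi> \<le> 2 * pi \<Longrightarrow>
      cmod (h (of_real \<rho> * cis \<phi>) - h (of_real \<rho>)) \<le> K * (min \<phi> (2 * pi - \<phi>)) powr a"
  shows "cmod (deriv h (of_real r)) \<le> 16 * K * (1 / (a + 1) - 1 / (a - 1)) * ((1 - r) / 2) powr (a - 1)"
proof -
  define \<delta> where "\<delta> = (1 - r) / 2"
  have \<delta>: "0 < \<delta>" using r by (simp add: \<delta>_def)
  have \<rho>1: "r < \<rho>" "\<rho> < 1" "0 < \<rho>" using r \<rho> by auto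
  have hc: "continuous_on (ball 0 1) h" by (rule holomorphic_on_imp_continuous_on[OF h])
  \<comment> \<open>Subtracting a constant leaves the derivative unchanged and makes the integrand
    small at angle 0, where the kernel is largest.\<close>
  define f where "f u = h u - h (of_real \<rho>)" for u
  have f: "f holomorphic_on ball 0 1" unfolding f_def by (intro holomorphic_intros h)
  define \<psi> where "\<psi> \<phi> = f (of_real \<rho> * cis \<phi>) / (of_real \<rho> * cis \<phi> - of_real r)\<^sup>2 * of_real \<rho> * \<i> * cis \<phi>" for \<phi>
  have nz: "of_real \<rho> * cis \<phi> - of_real r \<noteq> 0" for \<phi>
  proof
    assume "of_real \<rho> * cis \<phi> - of_real r = 0"
    then have "cmod (of_real \<rho> * cis \<phi>) = cmod (of_real r)" by simp
    then show False using r \<rho>1 by (simp add: norm_mult)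
  qed
  have "(f has_field_derivative (1 / (2 * of_real pi * \<i>) * contour_integral (circlepath 0 \<rho>) (\<lambda>u. f u / (u - of_real r)\<^sup>2))) (at (of_real r))"
    by (rule Cauchy_derivative_integral_circlepath(2))
       (use r \<rho>1 in \<open>auto intro!: holomorphic_on_imp_continuous_on holomorphic_on_subset[OF f]\<close>)
  moreover have "(f has_field_derivative deriv h (of_real r)) (at (of_real r))"
    unfolding f_def using holomorphic_derivI[OF h open_ball, of "of_real r"] r
    by (auto intro!: derivative_eq_intros)
  ultimately have "deriv h (of_real r) = 1 / (2 * of_real pi * \<i>) * contour_integral (circlepath 0 \<rho>) (\<lambda>u. f u / (u - of_real r)\<^sup>2)"
    by (rule DERIV_unique[symmetric])
  also have "contour_integral (circlepath 0 \<rho>) (\<lambda>u. f u / (u - of_real r)\<^sup>2) = integral {0..2*pi} \<psi>"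
    unfolding circlepath_def \<psi>_def using contour_integral_part_circlepath_eq[of 0 "2*pi" 0 \<rho>] by simp
  finally have D: "2 * pi * cmod (deriv h (of_real r)) = cmod (integral {0..2*pi} \<psi>)"
    by (simp add: norm_mult norm_divide)
  have "continuous_on UNIV \<psi>"
    unfolding \<psi>_def f_def using nz \<rho>1
    by (intro continuous_intros continuous_on_compose2[OF hc]) (auto simp: norm_mult)
  then have \<psi>i: "set_integrable lborel {0..2*pi} \<psi>" by (rule set_integrable_continuous)
  have bound: "cmod (\<psi> \<phi>) \<le> 16 * K * ((min \<phi> (2 * pi - \<phi>)) powr a * max (min \<phi> (2 * pi - \<phi>)) \<delta> powr (-2))"
    if \<phi>: "\<phi> \<in> {0..2*pi}" for \<phi>
  proof -
    define m where "m = min \<phi> (2 * pi - \<phi>)"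
    define d where "d = cmod (of_real \<rho> * cis \<phi> - of_real r)"
    have M: "0 < max m \<delta>" using \<delta> by simp
    have d: "(max m \<delta>)\<^sup>2 / 16 \<le> d\<^sup>2"
      unfolding d_def m_def \<delta>_def \<rho> using norm_cis_diff_ge_max[OF r, of \<phi>] \<phi> by simp
    have "0 < d" using nz[of \<phi>] by (simp add: d_def)
    have "cmod (\<psi> \<phi>) = cmod (f (of_real \<rho> * cis \<phi>)) / d\<^sup>2 * \<rho>"
      using \<rho>1 by (simp add: \<psi>_def norm_mult norm_divide norm_power d_def)
    also have "\<dots> \<le> cmod (f (of_real \<rho> * cis \<phi>)) / d\<^sup>2 * 1"
      using \<rho>1 by (intro mult_left_mono) auto
    also have "\<dots> \<le> (K * m powr a) / d\<^sup>2 * 1"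
      using inc[of \<phi>] \<phi> by (intro mult_right_mono divide_right_mono) (auto simp: f_def m_def)
    also have "\<dots> \<le> (K * m powr a) / ((max m \<delta>)\<^sup>2 / 16) * 1"
      using M K d \<open>0 < d\<close> by (intro mult_right_mono divide_left_mono) auto
    also have "\<dots> = 16 * K * (m powr a * max m \<delta> powr (-2))"
      using M by (simp add: powr_minus_divide)
    finally show ?thesis unfolding m_def .
  qed
  have "ennreal (cmod (integral {0..2*pi} \<psi>)) \<le> (\<integral>\<^sup>+\<phi>. ennreal (cmod (indicator {0..2*pi} \<phi> *\<^sub>R \<psi> \<phi>)) \<partial>lborel)"
    unfolding set_borel_integral_eq_integral(2)[OF \<psi>i, symmetric] set_lebesgue_integral_def
    by (rule integral_norm_bound_ennreal) (use \<psi>i in \<open>simp add: set_integrable_def\<close>)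
  also have "\<dots> \<le> (\<integral>\<^sup>+\<phi>. ennreal (16 * K) * (ennreal ((min \<phi> (2 * pi - \<phi>)) powr a * max (min \<phi> (2 * pi - \<phi>)) \<delta> powr (-2)) * indicator {0..2*pi} \<phi>) \<partial>lborel)"
    using bound K by (intro nn_integral_mono) (auto simp: indicator_def ennreal_mult[symmetric] intro!: ennreal_leI)
  also have "\<dots> = ennreal (16 * K) * (\<integral>\<^sup>+\<phi>\<in>{0..2*pi}. ennreal ((min \<phi> (2 * pi - \<phi>)) powr a * max (min \<phi> (2 * pi - \<phi>)) \<delta> powr (-2)) \<partial>lborel)"
    by (rule nn_integral_cmult) measurable
  also have "\<dots> \<le> ennreal (16 * K) * (2 * (\<integral>\<^sup>+u\<in>{0<..}. ennreal (u powr a * max u \<delta> powr (-2)) \<partial>lborel))"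
    by (intro mult_left_mono nn_integral_min_arc_le) auto
  also have "\<dots> \<le> ennreal (16 * K) * (2 * ennreal ((1 / (a + 1) - 1 / (a + (-2) + 1)) * \<delta> powr (a + (-2) + 1)))"
    by (intro mult_left_mono nn_integral_max_powr \<delta>) (use a in auto)
  also have "\<dots> = ennreal (16 * K * (2 * ((1 / (a + 1) - 1 / (a - 1)) * \<delta> powr (a - 1))))"
  proof -
    have "0 \<le> 1 / (a + 1) - 1 / (a - 1)" by (rule inverse_sum_nonneg[OF a])
    then show ?thesis using K
      by (simp add: ennreal_mult[symmetric] ennreal_numeral[symmetric] del: ennreal_numeral)
  qed
  finally have "cmod (integral {0..2*pi} \<psi>) \<le> 16 * K * (2 * ((1 / (a + 1) - 1 / (a - 1)) * \<delta> powr (a - 1)))"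
  proof (subst (asm) ennreal_le_iff)
    have "0 \<le> 1 / (a + 1) - 1 / (a - 1)" by (rule inverse_sum_nonneg[OF a])
    then show "0 \<le> 16 * K * (2 * ((1 / (a + 1) - 1 / (a - 1)) * \<delta> powr (a - 1)))" using K by simp
  qed
  then have "2 * pi * cmod (deriv h (of_real r)) \<le> 2 * (16 * K * ((1 / (a + 1) - 1 / (a - 1)) * \<delta> powr (a - 1)))"
    by (simp add: D)
  \<comment> \<open>Since \<open>1 \<le> pi\<close>, the factor \<open>2 * pi\<close> of Cauchy's
    formula absorbs the 2 that comes from the two half-circles.\<close>
  moreover have "2 * cmod (deriv h (of_real r)) \<le> 2 * pi * cmod (deriv h (of_real r))"
    using pi_gt3 by (intro mult_right_mono) auto
  ultimately show ?thesis by (simp add: \<delta>_def mult.assoc)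
qed

text \<open>Boundedness in \<open>L^p\<close> with \<open>p > 1\<close> gives uniform integrability.
  Below a height \<open>K\<close> dominated convergence applies, as \<open>S\<close> has finite
  measure; above it \<open>v\<close> is at most \<open>v powr p / K powr (p - 1)\<close>, which is
  small in the mean uniformly in \<open>n\<close>.\<close>

lemma nn_integral_eventually_le_of_powr_bound:
  fixes v :: "nat \<Rightarrow> 'a \<Rightarrow> real"
  assumes [measurable]: "\<And>n. v n \<in> borel_measurable M" "S \<in> sets M"
    and nn: "\<And>n x. 0 \<le> v n x" and S: "emeasure M S < \<infinity>" "\<And>n x. x \<notin> S \<Longrightarrow> v n x = 0"
    and lim: "AE x in M. (\<lambda>n. v n x) \<longlonglongrightarrow> 0" and p: "1 < p"
    and B: "\<And>n. (\<integral>\<^sup>+x. ennreal (v n x powr p) \<partial>M) \<le> ennreal B" and \<epsilon>: "0 < \<epsilon>"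
  shows "\<forall>\<^sub>F n in sequentially. (\<integral>\<^sup>+x. ennreal (v n x) \<partial>M) \<le> ennreal \<epsilon>"
proof -
  \<comment> \<open>Chosen so that the part above \<open>K\<close> contributes at most
    \<open>\<epsilon> / 2\<close>; the summand 1 keeps \<open>K\<close> positive when
    \<open>B\<close> is 0.\<close>
  define K where "K = (2 * (\<bar>B\<bar> + 1) / \<epsilon>) powr (1 / (p - 1))"
  have K: "0 < K" "K powr (p - 1) = 2 * (\<bar>B\<bar> + 1) / \<epsilon>"
    using \<epsilon> p by (simp_all add: K_def powr_powr)
  have le: "ennreal (v n x) \<le> ennreal (min (v n x) K) + ennreal (1 / K powr (p - 1)) * ennreal (v n x powr p)" for n x
  proof (cases "v n x \<le> K")
    case False
    then have "K powr (p - 1) \<le> v n x powr (p - 1)" using K p by (intro powr_mono2) auto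
    then have "v n x * K powr (p - 1) \<le> v n x * v n x powr (p - 1)" using nn by (intro mult_left_mono) auto
    also have "\<dots> = v n x powr p" using False K by (simp add: powr_mult_base)
    finally have "v n x \<le> 1 / K powr (p - 1) * v n x powr p" using K(1) by (simp add: field_simps)
    then have "ennreal (v n x) \<le> ennreal (1 / K powr (p - 1)) * ennreal (v n x powr p)"
      by (simp add: ennreal_mult[symmetric])
    then show ?thesis by (rule order_trans) simp
  qed simp
  have "(\<lambda>n. \<integral>\<^sup>+x. ennreal (min (v n x) K) \<partial>M) \<longlonglongrightarrow> (\<integral>\<^sup>+x. 0 \<partial>M)"
  proof (rule nn_integral_dominated_convergence[where w="\<lambda>x. ennreal K * indicator S x"])
    show "AE x in M. ennreal (min (v j x) K) \<le> ennreal K * indicator S x" for j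
      using S(2)[of _ j] K by (intro AE_I2) (auto simp: indicator_def intro!: ennreal_leI)
    show "(\<integral>\<^sup>+x. ennreal K * indicator S x \<partial>M) < \<infinity>"
      using S(1) by (simp add: nn_integral_cmult_indicator ennreal_mult_less_top)
    show "AE x in M. (\<lambda>i. ennreal (min (v i x) K)) \<longlonglongrightarrow> 0"
      using lim
    proof eventually_elim
      case (elim x)
      have "(\<lambda>i. min (v i x) K) \<longlonglongrightarrow> min 0 K" by (intro tendsto_intros elim)
      then have "(\<lambda>i. ennreal (min (v i x) K)) \<longlonglongrightarrow> ennreal 0" using K by (intro tendsto_ennrealI) simp
      then show ?case by simp
    qed
  qed measurable
  then have "(\<lambda>n. \<integral>\<^sup>+x. ennreal (min (v n x) K) \<partial>M) \<longlonglongrightarrow> 0" by simp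
  then have "\<forall>\<^sub>F n in sequentially. (\<integral>\<^sup>+x. ennreal (min (v n x) K) \<partial>M) < ennreal (\<epsilon> / 2)"
    using \<epsilon> by (intro order_tendstoD(2)) auto
  then show ?thesis
  proof eventually_elim
    case (elim n)
    have "(\<integral>\<^sup>+x. ennreal (v n x) \<partial>M) \<le> (\<integral>\<^sup>+x. ennreal (min (v n x) K) + ennreal (1 / K powr (p - 1)) * ennreal (v n x powr p) \<partial>M)"
      by (intro nn_integral_mono le)
    also have "\<dots> = (\<integral>\<^sup>+x. ennreal (min (v n x) K) \<partial>M) + ennreal (1 / K powr (p - 1)) * (\<integral>\<^sup>+x. ennreal (v n x powr p) \<partial>M)"
      by (simp add: nn_integral_add nn_integral_cmult)
    also have "\<dots> \<le> ennreal (\<epsilon> / 2) + ennreal (1 / K powr (p - 1)) * ennreal \<bar>B\<bar>"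
      by (intro add_mono less_imp_le[OF elim] mult_left_mono order_trans[OF B] ennreal_leI) auto
    also have "\<dots> = ennreal (\<epsilon> / 2 + 1 / K powr (p - 1) * \<bar>B\<bar>)"
      using \<epsilon> by (simp add: ennreal_mult[symmetric] ennreal_plus[symmetric] del: ennreal_plus)
    also have "\<dots> \<le> ennreal \<epsilon>"
      using \<epsilon> by (intro ennreal_leI) (simp add: K(2) field_simps)
    finally show ?case .
  qed
qed

text \<open>The radial functions need not be known to converge in \<open>L\<^sup>p\<close>: being bounded in \<open>L\<^sup>p\<close> with \<open>p > 1\<close>, they
  converge in \<open>L\<^sup>1\<close>, which suffices against the bounded continuous \<open>c\<close> of the pairing.\<close>

lemma integral_mean_le_boundary:
  assumes G: "G holomorphic_on ball 0 1" and p: "1 < p" and \<rho>: "0 \<le> \<rho>" "\<rho> < 1"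
    and \<beta>[measurable]: "\<beta> \<in> borel_measurable borel"
    and lim: "AE \<theta> in lborel. (\<lambda>n. G (of_real (radius n) * cis \<theta>)) \<longlonglongrightarrow> \<beta> (cis \<theta>)"
    and A: "\<And>n. integral_mean p (radius n) G \<le> A" and B: "0 \<le> B"
    and \<beta>B: "(\<integral>\<^sup>+\<theta>\<in>{0..2*pi}. ennreal (cmod (\<beta> (cis \<theta>)) powr p) \<partial>lborel) \<le> ennreal (2 * pi * B powr p)"
  shows "integral_mean p \<rho> G \<le> B"
proof (rule field_le_epsilon)
  fix \<epsilon> :: real assume \<epsilon>: "0 < \<epsilon>"
  have Gc: "continuous_on (ball 0 1) G" by (rule holomorphic_on_imp_continuous_on[OF G])
  define G' where "G' w = indicator (ball 0 1) w *\<^sub>R G w" for w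
  have [measurable]: "G' \<in> borel_measurable borel"
    unfolding G'_def[abs_def] by (rule borel_measurable_disc[OF Gc])
  have G': "G' (of_real (radius n) * cis \<theta>) = G (of_real (radius n) * cis \<theta>)" for n \<theta>
    using radius[of n] by (simp add: G'_def norm_mult)
  have A0: "0 \<le> A" using A[of 0] integral_mean_nonneg order_trans by blast
  from circle_pairing_attains[OF Gc p \<rho>] obtain c where
    c: "c \<in> dual_ball p" "circle_pairing c G (of_real \<rho>) = of_real (integral_mean p \<rho> G)" by blast
  have cc: "continuous_on UNIV c" by (rule dual_ball_continuous[OF c(1)])
  then have [measurable]: "c \<in> borel_measurable borel" by (rule borel_measurable_continuous_onI)
  have "compact (c ` {0..2*pi})"
    by (rule compact_continuous_image) (use cc continuous_on_subset in auto)
  then obtain k where k: "0 < k" "\<And>\<theta>. \<theta> \<in> {0..2*pi} \<Longrightarrow> cmod (c \<theta>) \<le> k"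
    using compact_imp_bounded bounded_pos by (metis imageI)
  \<comment> \<open>Its integral is made smaller than \<open>2 * pi * \<epsilon> / k\<close> below,
    because it enters the pairing multiplied by the bound \<open>k\<close> for \<open>|c|\<close>
    and is divided by \<open>2 * pi\<close>.\<close>
  define v where "v n \<theta> = indicator {0..2*pi} \<theta> * cmod (G' (of_real (radius n) * cis \<theta>) - \<beta> (cis \<theta>))" for n \<theta>
  have "\<forall>\<^sub>F n in sequentially. (\<integral>\<^sup>+\<theta>. ennreal (v n \<theta>) \<partial>lborel) \<le> ennreal (2 * pi * \<epsilon> / k)"
  proof (rule nn_integral_eventually_le_of_powr_bound[where S="{0..2*pi}", OF _ _ _ _ _ _ p])
    show "v n \<in> borel_measurable lborel" for n unfolding v_def[abs_def] by measurable
    show "AE \<theta> in lborel. (\<lambda>n. v n \<theta>) \<longlonglongrightarrow> 0"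
      using lim
    proof eventually_elim
      case (elim \<theta>)
      have "(\<lambda>n. indicator {0..2*pi} \<theta> * cmod (G (of_real (radius n) * cis \<theta>) - \<beta> (cis \<theta>))) \<longlonglongrightarrow> indicator {0..2*pi} \<theta> * cmod (\<beta> (cis \<theta>) - \<beta> (cis \<theta>))"
        by (intro tendsto_intros elim)
      then show ?case by (simp add: v_def G')
    qed
    show "(\<integral>\<^sup>+\<theta>. ennreal (v n \<theta> powr p) \<partial>lborel) \<le> ennreal (2 powr p * (2 * pi * A powr p + 2 * pi * B powr p))" for n
    proof -
      have "ennreal (v n \<theta> powr p) \<le> ennreal (2 powr p) * (ennreal (cmod (G (rcis (radius n) \<theta>)) powr p) * indicator {0..2*pi} \<theta>
          + ennreal (cmod (\<beta> (cis \<theta>)) powr p) * indicator {0..2*pi} \<theta>)" for \<theta>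
      proof (cases "\<theta> \<in> {0..2*pi}")
        case True
        define x y where "x = cmod (G (rcis (radius n) \<theta>))" and "y = cmod (\<beta> (cis \<theta>))"
        have xy: "0 \<le> x" "0 \<le> y" by (auto simp: x_def y_def)
        have "v n \<theta> \<le> x + y" using True norm_triangle_ineq4 by (simp add: v_def G' x_def y_def rcis_def)
        also have "\<dots> \<le> 2 * max x y" by simp
        finally have "v n \<theta> powr p \<le> (2 * max x y) powr p"
          using p True by (intro powr_mono2) (auto simp: v_def)
        also have "\<dots> = 2 powr p * (max x y) powr p" using xy by (simp add: powr_mult)
        also have "\<dots> \<le> 2 powr p * (x powr p + y powr p)"
          by (intro mult_left_mono) (auto simp: max_def)
        finally show ?thesis using True
          by (simp add: x_def y_def ennreal_mult[symmetric] ennreal_plus[symmetric] del: ennreal_plus)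
      qed (simp add: v_def)
      then have "(\<integral>\<^sup>+\<theta>. ennreal (v n \<theta> powr p) \<partial>lborel) \<le> (\<integral>\<^sup>+\<theta>. ennreal (2 powr p) * (ennreal (cmod (G' (of_real (radius n) * cis \<theta>)) powr p) * indicator {0..2*pi} \<theta>
          + ennreal (cmod (\<beta> (cis \<theta>)) powr p) * indicator {0..2*pi} \<theta>) \<partial>lborel)"
        by (intro nn_integral_mono) (simp add: G' rcis_def)
      also have "\<dots> = ennreal (2 powr p) * ((\<integral>\<^sup>+\<theta>\<in>{0..2*pi}. ennreal (cmod (G' (of_real (radius n) * cis \<theta>)) powr p) \<partial>lborel)
          + (\<integral>\<^sup>+\<theta>\<in>{0..2*pi}. ennreal (cmod (\<beta> (cis \<theta>)) powr p) \<partial>lborel))"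
        by (simp add: nn_integral_cmult nn_integral_add)
      also have "(\<integral>\<^sup>+\<theta>\<in>{0..2*pi}. ennreal (cmod (G' (of_real (radius n) * cis \<theta>)) powr p) \<partial>lborel) = ennreal (2 * pi * integral_mean p (radius n) G powr p)"
        using nn_integral_mean[OF Gc, of "radius n" p] radius[of n] p by (simp add: G' rcis_def)
      also have "ennreal (2 powr p) * (ennreal (2 * pi * integral_mean p (radius n) G powr p) + (\<integral>\<^sup>+\<theta>\<in>{0..2*pi}. ennreal (cmod (\<beta> (cis \<theta>)) powr p) \<partial>lborel))
          \<le> ennreal (2 powr p) * (ennreal (2 * pi * A powr p) + ennreal (2 * pi * B powr p))"
        by (intro mult_left_mono add_mono \<beta>B ennreal_leI powr_mono2 A) (use p in auto)
      also have "\<dots> = ennreal (2 powr p * (2 * pi * A powr p + 2 * pi * B powr p))"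
        by (simp add: ennreal_mult[symmetric] ennreal_plus[symmetric] del: ennreal_plus)
      finally show ?thesis .
    qed
  qed (use k \<epsilon> in \<open>auto simp: v_def\<close>)
  moreover have "\<forall>\<^sub>F n in sequentially. \<rho> < radius n"
    using order_tendstoD(1)[OF radius_tendsto] \<rho> by simp
  ultimately have "\<forall>\<^sub>F n in sequentially. (\<integral>\<^sup>+\<theta>. ennreal (v n \<theta>) \<partial>lborel) \<le> ennreal (2 * pi * \<epsilon> / k) \<and> \<rho> < radius n"
    by eventually_elim auto
  then obtain n where n: "(\<integral>\<^sup>+\<theta>. ennreal (v n \<theta>) \<partial>lborel) \<le> ennreal (2 * pi * \<epsilon> / k)" "\<rho> < radius n"
    using eventually_happens'[OF sequentially_bot] by blast
  \<comment> \<open>On this one circle the values of \<open>G\<close> may be exchanged for boundary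
    values at the cost of \<open>\<epsilon>\<close>. The cost is the same for every direction of
    \<open>z\<close>, since rotating does not change the integral of \<open>v\<close>; the maximum
    principle then carries the bound inward to \<open>\<rho>\<close>.\<close>
  have sphere: "cmod (circle_pairing c G z) \<le> B + \<epsilon>" if z: "cmod z = radius n" for z
  proof -
    define \<phi> where "\<phi> = Arg z"
    have z': "z = of_real (radius n) * cis \<phi>" using rcis_cmod_Arg[of z] z by (simp add: rcis_def \<phi>_def)
    have zc: "z * cis \<theta> = of_real (radius n) * cis (\<theta> + \<phi>)" for \<theta>
      unfolding z' by (simp add: cis_mult mult.assoc add.commute)
    have z1: "cmod z < 1" using z radius by simp
    have "ennreal (2 * pi * cmod (circle_pairing c G z)) \<le> (\<integral>\<^sup>+\<theta>\<in>{0..2*pi}. ennreal (cmod (c \<theta>) * cmod (G (z * cis \<theta>))) \<partial>lborel)"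
      by (rule norm_circle_pairing_nn_integral_le[OF Gc cc z1])
    also have "\<dots> \<le> (\<integral>\<^sup>+\<theta>. ennreal (cmod (c \<theta>) * cmod (\<beta> (cis (\<theta> + \<phi>)))) * indicator {0..2*pi} \<theta>
        + ennreal k * (ennreal (cmod (G' (of_real (radius n) * cis (\<theta> + \<phi>)) - \<beta> (cis (\<theta> + \<phi>)))) * indicator {0..2*pi} \<theta>) \<partial>lborel)"
    proof (rule nn_integral_mono)
      fix \<theta> :: real
      show "ennreal (cmod (c \<theta>) * cmod (G (z * cis \<theta>))) * indicator {0..2*pi} \<theta> \<le> ennreal (cmod (c \<theta>) * cmod (\<beta> (cis (\<theta> + \<phi>)))) * indicator {0..2*pi} \<theta>
        + ennreal k * (ennreal (cmod (G' (of_real (radius n) * cis (\<theta> + \<phi>)) - \<beta> (cis (\<theta> + \<phi>)))) * indicator {0..2*pi} \<theta>)"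
      proof (cases "\<theta> \<in> {0..2*pi}")
        case True
        define x y where "x = G (of_real (radius n) * cis (\<theta> + \<phi>))" and "y = \<beta> (cis (\<theta> + \<phi>))"
        have "cmod (c \<theta>) * cmod x \<le> cmod (c \<theta>) * (cmod y + cmod (x - y))"
          using norm_triangle_ineq2[of x y] by (intro mult_left_mono) auto
        also have "\<dots> \<le> cmod (c \<theta>) * cmod y + k * cmod (x - y)"
          using k(2)[OF True] by (simp add: distrib_left mult_right_mono)
        finally show ?thesis using True k(1)
          by (simp add: zc G' x_def y_def ennreal_mult[symmetric] ennreal_plus[symmetric] del: ennreal_plus)
      qed simp
    qed
    also have "\<dots> = (\<integral>\<^sup>+\<theta>\<in>{0..2*pi}. ennreal (cmod (c \<theta>) * cmod (\<beta> (cis (\<theta> + \<phi>)))) \<partial>lborel)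
        + ennreal k * (\<integral>\<^sup>+\<theta>\<in>{0..2*pi}. ennreal (cmod (G' (of_real (radius n) * cis (\<theta> + \<phi>)) - \<beta> (cis (\<theta> + \<phi>)))) \<partial>lborel)"
      by (simp add: nn_integral_add nn_integral_cmult)
    also have "(\<integral>\<^sup>+\<theta>\<in>{0..2*pi}. ennreal (cmod (G' (of_real (radius n) * cis (\<theta> + \<phi>)) - \<beta> (cis (\<theta> + \<phi>)))) \<partial>lborel)
       = (\<integral>\<^sup>+\<theta>\<in>{0..2*pi}. ennreal (cmod (G' (of_real (radius n) * cis \<theta>) - \<beta> (cis \<theta>))) \<partial>lborel)"
      by (rule nn_integral_cis_shift[of "\<lambda>\<zeta>. ennreal (cmod (G' (of_real (radius n) * \<zeta>) - \<beta> \<zeta>))"]) measurable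
    also have "\<dots> = (\<integral>\<^sup>+\<theta>. ennreal (v n \<theta>) \<partial>lborel)"
      by (intro nn_integral_cong) (auto simp: v_def indicator_def)
    also have "(\<integral>\<^sup>+\<theta>\<in>{0..2*pi}. ennreal (cmod (c \<theta>) * cmod (\<beta> (cis (\<theta> + \<phi>)))) \<partial>lborel) + ennreal k * (\<integral>\<^sup>+\<theta>. ennreal (v n \<theta>) \<partial>lborel)
        \<le> ennreal (2 * pi * B) + ennreal k * ennreal (2 * pi * \<epsilon> / k)"
    proof (intro add_mono mult_left_mono n(1) dual_ball_Holder[OF c(1) p] B)
      have "(\<integral>\<^sup>+\<theta>\<in>{0..2*pi}. ennreal (cmod (\<beta> (cis (\<theta> + \<phi>))) powr p) \<partial>lborel) = (\<integral>\<^sup>+\<theta>\<in>{0..2*pi}. ennreal (cmod (\<beta> (cis \<theta>)) powr p) \<partial>lborel)"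
        by (rule nn_integral_cis_shift[of "\<lambda>\<zeta>. ennreal (cmod (\<beta> \<zeta>) powr p)"]) measurable
      with \<beta>B show "(\<integral>\<^sup>+\<theta>\<in>{0..2*pi}. ennreal (cmod (\<beta> (cis (\<theta> + \<phi>))) powr p) \<partial>lborel) \<le> ennreal (2 * pi * B powr p)" by simp
    qed auto
    also have "\<dots> = ennreal (2 * pi * (B + \<epsilon>))"
      using k(1) B \<epsilon> by (simp add: ennreal_mult[symmetric] ennreal_plus[symmetric] distrib_left del: ennreal_plus)
    finally show ?thesis using B \<epsilon> by simp
  qed
  have "cmod (circle_pairing c G (of_real \<rho>)) \<le> B + \<epsilon>"
  proof (rule maximum_modulus_frontier[where S="cball 0 (radius n)" and f="circle_pairing c G" and \<xi>="of_real \<rho>"])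
    note hol = circle_pairing_holomorphic[OF G cc]
    show "circle_pairing c G holomorphic_on interior (cball 0 (radius n))"
      by (rule holomorphic_on_subset[OF hol]) (use radius[of n] in auto)
    show "continuous_on (closure (cball 0 (radius n))) (circle_pairing c G)"
      by (rule holomorphic_on_imp_continuous_on, rule holomorphic_on_subset[OF hol]) (use radius[of n] in auto)
    fix z assume "z \<in> frontier (cball (0::complex) (radius n))"
    then have "cmod z = radius n" using radius[of n] by (simp add: frontier_cball)
    then show "cmod (circle_pairing c G z) \<le> B + \<epsilon>" by (rule sphere)
  qed (use n \<rho> in auto)
  then show "integral_mean p \<rho> G \<le> B + \<epsilon>" using c(2) by simp
qed

text \<open>Completeness of Lebesgue measure. A boundary function is prescribed only almost
  everywhere and need not be Borel, yet its integrals have to be compared with those of a Borel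
  representative.\<close>

lemma borel_measurable_lebesgue_AE:
  fixes f g :: "'a::euclidean_space \<Rightarrow> 'b::topological_space"
  assumes g: "g \<in> borel_measurable borel" and ae: "AE x in lborel. f x = g x"
  shows "f \<in> borel_measurable lebesgue"
proof (rule measurableI)
  fix A :: "'b set" assume A: "A \<in> sets borel"
  have gA: "g -` A \<in> sets lebesgue"
    using measurable_sets[OF g A] by (simp add: sets_completionI_sets)
  have "f -` A \<in> sets lebesgue"
  proof (rule completion.in_sets_AE[OF _ gA])
    show "AE x in lebesgue. (x \<in> g -` A) = (x \<in> f -` A)"
      using AE_completion[OF ae] by eventually_elim auto
  qed simp
  then show "f -` A \<inter> space lebesgue \<in> sets lebesgue" by simp
qed simp

lemma hardy_spaceE:
  assumes "g \<in> hardy_space p" "1 < p"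
  obtains A where "0 < A" "\<And>r. 0 \<le> r \<Longrightarrow> r < 1 \<Longrightarrow> integral_mean p r g \<le> A"
proof -
  from assms have hol: "g holomorphic_on ball 0 1" and "bdd_above ((\<lambda>r. integral_mean p r g) ` {0<..<1})"
    by (auto simp: hardy_space_def)
  then obtain A where A: "\<And>r. r \<in> {0<..<1} \<Longrightarrow> integral_mean p r g \<le> A"
    unfolding bdd_above_def by blast
  show ?thesis
  proof (rule that[of "max A 1"])
    fix r :: real assume r: "0 \<le> r" "r < 1"
    \<comment> \<open>The defining supremum runs over positive radii only; monotonicity extends its
      bound to \<open>r = 0\<close>.\<close>
    have "integral_mean p r g \<le> integral_mean p ((1 + r) / 2) g"
      by (rule integral_mean_mono[OF hol assms(2)]) (use r in auto)
    also have "\<dots> \<le> A" by (rule A) (use r in auto)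
    finally show "integral_mean p r g \<le> max A 1" by simp
  qed simp
qed

lemma integral_mean_increment_le_double:
  assumes g: "g holomorphic_on ball 0 1" and p: "1 < p" and r: "0 \<le> r" "r < 1"
  shows "integral_mean p r (\<lambda>w. g (w * cis h) - g w) \<le> 2 * integral_mean p r g"
proof -
  have gc: "continuous_on (ball 0 1) g" by (rule holomorphic_on_imp_continuous_on[OF g])
  have "continuous_on (ball 0 1) (\<lambda>w. g (w * cis h) - g w)"
    by (intro holomorphic_on_imp_continuous_on holomorphic_intros holomorphic_on_rotate g)
  from circle_pairing_attains[OF this p r] obtain c where
    c: "c \<in> dual_ball p" "circle_pairing c (\<lambda>w. g (w * cis h) - g w) (of_real r) = of_real (integral_mean p r (\<lambda>w. g (w * cis h) - g w))"
    by blast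
  have "integral_mean p r (\<lambda>w. g (w * cis h) - g w) = cmod (circle_pairing c g (of_real r * cis h) - circle_pairing c g (of_real r))"
    using circle_pairing_increment[OF g dual_ball_continuous[OF c(1)], of "of_real r" h] c(2) r
    by (metis abs_of_nonneg integral_mean_nonneg norm_of_real)
  also have "\<dots> \<le> cmod (circle_pairing c g (of_real r * cis h)) + cmod (circle_pairing c g (of_real r))"
    by (rule norm_triangle_ineq4)
  also have "\<dots> \<le> integral_mean p r g + integral_mean p r g"
    using norm_circle_pairing_le[OF gc c(1) p, of "of_real r * cis h"] norm_circle_pairing_le[OF gc c(1) p, of "of_real r"] r
    by (intro add_mono) (auto simp: norm_mult)
  finally show ?thesis by simp
qed

text \<open>Carries the modulus of continuity from the boundary to all interior circles and from
  small \<open>h\<close> to all positive \<open>h\<close>. The boundary function supplied by the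
  definition is exchanged for \<open>radial_limit g\<close>, which is Borel and agrees with it
  almost everywhere, also after a shift.\<close>

lemma mean_lipschitz_increment:
  assumes g: "g \<in> mean_lipschitz p a" and p: "1 < p" and a: "0 < a"
  obtains K where "0 < K"
    "\<And>h \<rho>. 0 < h \<Longrightarrow> 0 \<le> \<rho> \<Longrightarrow> \<rho> < 1 \<Longrightarrow> integral_mean p \<rho> (\<lambda>w. g (w * cis h) - g w) \<le> K * h powr a"
proof -
  from g obtain b where gH: "g \<in> hardy_space p" and bd: "is_boundary_function g b"
    and O: "modulus_of_continuity p b \<in> O[at_right 0](\<lambda>t. t powr a)"
    by (auto simp: mean_lipschitz_def)
  have hol: "g holomorphic_on ball 0 1" using gH by (simp add: hardy_space_def)
  have gc: "continuous_on (ball 0 1) g" by (rule holomorphic_on_imp_continuous_on[OF hol])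
  obtain A where A: "0 < A" "\<And>r. 0 \<le> r \<Longrightarrow> r < 1 \<Longrightarrow> integral_mean p r g \<le> A"
    using hardy_spaceE[OF gH p] by blast
  define \<beta> where "\<beta> = radial_limit g"
  have [measurable]: "\<beta> \<in> borel_measurable borel"
    unfolding \<beta>_def by (rule borel_measurable_radial_limit[OF gc])
  have AEb: "AE \<theta> in lborel. ((\<lambda>r. g (rcis r \<theta>)) \<longlongrightarrow> b (cis \<theta>)) (at_left 1)"
    using bd unfolding is_boundary_function_def AE_completion_iff .
  have b\<beta>: "AE \<theta> in lborel. b (cis \<theta>) = \<beta> (cis \<theta>)"
    using AEb by eventually_elim (simp add: \<beta>_def radial_limit_eq(2))
  have AE: "AE \<theta> in lborel. ((\<lambda>r. g (rcis r \<theta>)) \<longlongrightarrow> \<beta> (cis \<theta>)) (at_left 1)"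
    using AEb b\<beta> by eventually_elim simp
  have inc2: "integral_mean p r (\<lambda>w. g (w * cis h) - g w) \<le> 2 * A" if "0 \<le> r" "r < 1" for r h
    using integral_mean_increment_le_double[OF hol p that, of h] A(2)[OF that] by linarith
  define L where "L h = (LINT \<theta>|lborel. indicator {0..2*pi} \<theta> *\<^sub>R cmod (\<beta> (cis (\<theta> + h)) - \<beta> (cis \<theta>)) powr p)" for h
  have nnL: "(\<integral>\<^sup>+\<theta>\<in>{0..2*pi}. ennreal (cmod (\<beta> (cis (\<theta> + h)) - \<beta> (cis \<theta>)) powr p) \<partial>lborel) = ennreal (L h)"
    and L0: "0 \<le> L h" and L2: "L h \<le> 2 * pi * (2 * A) powr p" for h
  proof -
    show "0 \<le> L h" unfolding L_def by (intro integral_nonneg_AE) auto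
    have eq: "(\<integral>\<^sup>+\<theta>. ennreal (cmod (indicator {0..2*pi} \<theta> *\<^sub>R (\<beta> (cis (\<theta> + h)) - \<beta> (cis \<theta>))) powr p) \<partial>lborel)
        = (\<integral>\<^sup>+\<theta>. ennreal (indicator {0..2*pi} \<theta> *\<^sub>R cmod (\<beta> (cis (\<theta> + h)) - \<beta> (cis \<theta>)) powr p) \<partial>lborel)"
      using p by (intro nn_integral_cong) (auto simp: indicator_def)
    have le: "(\<integral>\<^sup>+\<theta>. ennreal (indicator {0..2*pi} \<theta> *\<^sub>R cmod (\<beta> (cis (\<theta> + h)) - \<beta> (cis \<theta>)) powr p) \<partial>lborel) \<le> ennreal (2 * pi * (2 * A) powr p)"
      unfolding eq[symmetric]
      by (rule nn_integral_boundary_increment_le[OF hol _ AE inc2]) (use p radius in auto)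
    then show "L h \<le> 2 * pi * (2 * A) powr p"
      unfolding L_def by (intro integral_real_bounded) auto
    have "integrable lborel (\<lambda>\<theta>. indicator {0..2*pi} \<theta> *\<^sub>R cmod (\<beta> (cis (\<theta> + h)) - \<beta> (cis \<theta>)) powr p)"
    proof (rule integrableI_bounded)
      have "(\<integral>\<^sup>+\<theta>. ennreal (norm (indicator {0..2*pi} \<theta> *\<^sub>R cmod (\<beta> (cis (\<theta> + h)) - \<beta> (cis \<theta>)) powr p)) \<partial>lborel)
         = (\<integral>\<^sup>+\<theta>. ennreal (indicator {0..2*pi} \<theta> *\<^sub>R cmod (\<beta> (cis (\<theta> + h)) - \<beta> (cis \<theta>)) powr p) \<partial>lborel)"
        by (intro nn_integral_cong) (auto simp: indicator_def)
      also have "\<dots> < \<infinity>" using le by (rule order.strict_trans1) simp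
      finally show "(\<integral>\<^sup>+\<theta>. ennreal (norm (indicator {0..2*pi} \<theta> *\<^sub>R cmod (\<beta> (cis (\<theta> + h)) - \<beta> (cis \<theta>)) powr p)) \<partial>lborel) < \<infinity>" .
    qed measurable
    then have "(\<integral>\<^sup>+\<theta>. ennreal (indicator {0..2*pi} \<theta> *\<^sub>R cmod (\<beta> (cis (\<theta> + h)) - \<beta> (cis \<theta>)) powr p) \<partial>lborel) = ennreal (L h)"
      unfolding L_def by (intro nn_integral_eq_integral) auto
    moreover have "(\<integral>\<^sup>+\<theta>\<in>{0..2*pi}. ennreal (cmod (\<beta> (cis (\<theta> + h)) - \<beta> (cis \<theta>)) powr p) \<partial>lborel)
        = (\<integral>\<^sup>+\<theta>. ennreal (indicator {0..2*pi} \<theta> *\<^sub>R cmod (\<beta> (cis (\<theta> + h)) - \<beta> (cis \<theta>)) powr p) \<partial>lborel)"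
      by (intro nn_integral_cong) (auto simp: indicator_def)
    ultimately show "(\<integral>\<^sup>+\<theta>\<in>{0..2*pi}. ennreal (cmod (\<beta> (cis (\<theta> + h)) - \<beta> (cis \<theta>)) powr p) \<partial>lborel) = ennreal (L h)"
      by simp
  qed
  define N where "N h = (1 / (2 * pi) * L h) powr (1 / p)" for h
  have N0: "0 \<le> N h" for h by (simp add: N_def)
  have LN: "L h = 2 * pi * N h powr p" for h
    using p L0[of h] by (simp add: N_def powr_powr)
  have N2: "N h \<le> 2 * A" for h
  proof -
    have "N h powr p \<le> (2 * A) powr p" using L2[of h] by (simp add: LN)
    then show ?thesis using p A N0[of h] powr_less_mono2[of p "2 * A" "N h"] by force
  qed
  have bL: "(LINT \<theta>:{0..2 * pi}|lebesgue. cmod (b (cis (\<theta> + h)) - b (cis \<theta>)) powr p) = L h" for h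
  proof -
    have ae: "AE \<theta> in lborel. indicator {0..2*pi} \<theta> *\<^sub>R cmod (b (cis (\<theta> + h)) - b (cis \<theta>)) powr p
        = indicator {0..2*pi} \<theta> *\<^sub>R cmod (\<beta> (cis (\<theta> + h)) - \<beta> (cis \<theta>)) powr p"
      using b\<beta> AE_lborel_shift[OF b\<beta>, of h] by eventually_elim simp
    have m: "(\<lambda>\<theta>. indicator {0..2*pi} \<theta> *\<^sub>R cmod (\<beta> (cis (\<theta> + h)) - \<beta> (cis \<theta>)) powr p) \<in> borel_measurable borel"
      by measurable
    have "(LINT \<theta>:{0..2 * pi}|lebesgue. cmod (b (cis (\<theta> + h)) - b (cis \<theta>)) powr p)
       = (LINT \<theta>|lebesgue. indicator {0..2*pi} \<theta> *\<^sub>R cmod (\<beta> (cis (\<theta> + h)) - \<beta> (cis \<theta>)) powr p)"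
      unfolding set_lebesgue_integral_def
      by (rule integral_cong_AE[OF borel_measurable_lebesgue_AE[OF m ae] _ AE_completion[OF ae]])
         (use m in \<open>auto intro: measurable_completion\<close>)
    also have "\<dots> = L h" unfolding L_def by (rule integral_completion) (use m in simp)
    finally show ?thesis .
  qed
  \<comment> \<open>The uniform bound \<open>2 * A\<close> is what makes a single term lie below the
    supremum: it shows that the set is bounded above.\<close>
  have NM: "N h \<le> modulus_of_continuity p b h" if "0 < h" for h
    unfolding modulus_of_continuity_def bL N_def[symmetric]
    by (rule cSUP_upper) (use that N2 in \<open>auto intro!: bdd_aboveI2[where M="2 * A"]\<close>)
  from O obtain c where c: "0 < c" "\<forall>\<^sub>F t in at_right 0. norm (modulus_of_continuity p b t) \<le> c * norm (t powr a)"
    by (elim landau_o.bigE)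
  then obtain \<delta> where \<delta>: "0 < \<delta>" "\<And>t. 0 < t \<Longrightarrow> t < \<delta> \<Longrightarrow> \<bar>modulus_of_continuity p b t\<bar> \<le> c * t powr a"
    unfolding eventually_at_right_field by auto
  \<comment> \<open>The first entry serves steps below \<open>\<delta>\<close>, where the big-O
    bound holds; the second turns the trivial bound \<open>2 * A\<close> into a multiple of
    \<open>h powr a\<close> for \<open>h \<ge> \<delta>\<close>.\<close>
  define K where "K = max c (2 * A / \<delta> powr a)"
  have K: "0 < K" using c by (simp add: K_def)
  have NK: "N h \<le> K * h powr a" if h: "0 < h" for h
  proof (cases "h < \<delta>")
    case True
    have "N h \<le> c * h powr a" using NM[OF h] \<delta>(2)[OF h True] by linarith
    also have "\<dots> \<le> K * h powr a" by (intro mult_right_mono) (auto simp: K_def)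
    finally show ?thesis .
  next
    case False
    have "N h \<le> 2 * A / \<delta> powr a * \<delta> powr a" using N2[of h] \<delta> by simp
    also have "\<dots> \<le> 2 * A / \<delta> powr a * h powr a"
      using A \<delta> False a by (intro mult_left_mono powr_mono2) auto
    also have "\<dots> \<le> K * h powr a" by (intro mult_right_mono) (auto simp: K_def)
    finally show ?thesis .
  qed
  show ?thesis
  proof (rule that[OF K])
    fix h \<rho> :: real assume h: "0 < h" and \<rho>: "0 \<le> \<rho>" "\<rho> < 1"
    show "integral_mean p \<rho> (\<lambda>w. g (w * cis h) - g w) \<le> K * h powr a"
    proof (rule integral_mean_le_boundary[where \<beta>="\<lambda>\<zeta>. \<beta> (\<zeta> * cis h) - \<beta> \<zeta>" and A="2 * A", OF _ p \<rho>])
      show "(\<lambda>w. g (w * cis h) - g w) holomorphic_on ball 0 1"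
        by (intro holomorphic_intros holomorphic_on_rotate hol)
      show "AE \<theta> in lborel. (\<lambda>n. g (of_real (radius n) * cis \<theta> * cis h) - g (of_real (radius n) * cis \<theta>))
          \<longlonglongrightarrow> \<beta> (cis \<theta> * cis h) - \<beta> (cis \<theta>)"
        using AE AE_lborel_shift[OF AE, of h]
      proof eventually_elim
        case (elim \<theta>)
        have "(\<lambda>n. g (of_real (radius n) * cis (\<theta> + h)) - g (of_real (radius n) * cis \<theta>)) \<longlonglongrightarrow> \<beta> (cis (\<theta> + h)) - \<beta> (cis \<theta>)"
          by (intro tendsto_intros radial_limit_eq(1) elim)
        then show ?case by (simp add: cis_mult[symmetric] mult.assoc)
      qed
      have "(\<integral>\<^sup>+\<theta>\<in>{0..2*pi}. ennreal (cmod (\<beta> (cis (\<theta> + h)) - \<beta> (cis \<theta>)) powr p) \<partial>lborel) \<le> ennreal (2 * pi * (K * h powr a) powr p)"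
        unfolding nnL LN using NK[OF h] N0 p by (intro ennreal_leI mult_left_mono powr_mono2) auto
      then show "(\<integral>\<^sup>+\<theta>\<in>{0..2*pi}. ennreal (cmod (\<beta> (cis \<theta> * cis h) - \<beta> (cis \<theta>)) powr p) \<partial>lborel) \<le> ennreal (2 * pi * (K * h powr a) powr p)"
        by (simp add: cis_mult)
      show "integral_mean p (radius n) (\<lambda>w. g (w * cis h) - g w) \<le> 2 * A" for n
        by (rule inc2) (use radius in auto)
    qed (use K in \<open>measurable, auto\<close>)
  qed
qed

lemma mean_lipschitz_imp_mean_growth:
  assumes g: "g \<in> mean_lipschitz p a" and p: "1 < p" and a: "0 < a" "a < 1"
  shows "mean_growth p a g"
proof -
  have hol: "g holomorphic_on ball 0 1" using g by (simp add: mean_lipschitz_def hardy_space_def)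
  have dhol: "deriv g holomorphic_on ball 0 1" by (rule holomorphic_deriv[OF hol open_ball])
  obtain K where K: "0 < K"
    "\<And>h \<rho>. 0 < h \<Longrightarrow> 0 \<le> \<rho> \<Longrightarrow> \<rho> < 1 \<Longrightarrow> integral_mean p \<rho> (\<lambda>w. g (w * cis h) - g w) \<le> K * h powr a"
    using mean_lipschitz_increment[OF g p a(1)] by blast
  define D where "D = 16 * K * (1 / (a + 1) - 1 / (a - 1))"
  have "0 \<le> 1 / (a + 1) - 1 / (a - 1)" by (rule inverse_sum_nonneg[OF a])
  then have D: "0 \<le> D" using K by (simp add: D_def)
  have main: "integral_mean p r (deriv g) \<le> D * ((1 - r) / 2) powr (a - 1)" if r: "1 / 2 \<le> r" "r < 1" for r
  proof -
    from circle_pairing_deriv_attains[OF hol p, of r] r obtain c where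
      c: "c \<in> dual_ball p" "deriv (circle_pairing c g) (of_real r) = of_real (integral_mean p r (deriv g))"
      by auto
    define \<rho> where "\<rho> = (1 + r) / 2"
    have \<rho>: "0 \<le> \<rho>" "\<rho> < 1" using r by (auto simp: \<rho>_def)
    note cc = dual_ball_continuous[OF c(1)]
    have inc: "cmod (circle_pairing c g (z * cis \<phi>) - circle_pairing c g z) \<le> K * \<phi> powr a"
      if "0 < \<phi>" "cmod z = \<rho>" for \<phi> z
    proof -
      have "continuous_on (ball 0 1) (\<lambda>w. g (w * cis \<phi>) - g w)"
        by (intro holomorphic_on_imp_continuous_on holomorphic_intros holomorphic_on_rotate hol)
      from norm_circle_pairing_le[OF this c(1) p, of z] that \<rho>
      show ?thesis using circle_pairing_increment[OF hol cc, of z \<phi>] K(2)[of \<phi> \<rho>] by simp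
    qed
    have "cmod (deriv (circle_pairing c g) (of_real r)) \<le> 16 * K * (1 / (a + 1) - 1 / (a - 1)) * ((1 - r) / 2) powr (a - 1)"
    proof (rule norm_deriv_le_of_increments[OF circle_pairing_holomorphic[OF hol cc] a _ r \<rho>_def])
      fix \<phi> :: real assume \<phi>: "0 \<le> \<phi>" "\<phi> \<le> 2 * pi"
      consider "\<phi> = 0 \<or> \<phi> = 2 * pi" | "0 < \<phi>" "\<phi> \<le> 2 * pi - \<phi>" | "\<phi> < 2 * pi" "2 * pi - \<phi> < \<phi>"
        using \<phi> by linarith
      then show "cmod (circle_pairing c g (of_real \<rho> * cis \<phi>) - circle_pairing c g (of_real \<rho>)) \<le> K * (min \<phi> (2 * pi - \<phi>)) powr a"
      proof cases
        case 1
        then show ?thesis using K by auto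
      next
        case 2
        then show ?thesis using inc[of \<phi> "of_real \<rho>"] \<rho> by simp
      next
        case 3
        \<comment> \<open>Past the half-circle the increment is read from the other end: a forward
          step of length \<open>2 * pi - \<phi>\<close> from the point at angle
          \<open>\<phi>\<close> returns to \<open>\<rho>\<close>.\<close>
        have E: "of_real \<rho> * cis \<phi> * cis (2 * pi - \<phi>) = of_real \<rho>" by (simp only: mult.assoc cis_mult) simp
        have "cmod (circle_pairing c g (of_real \<rho> * cis \<phi> * cis (2 * pi - \<phi>)) - circle_pairing c g (of_real \<rho> * cis \<phi>)) \<le> K * (2 * pi - \<phi>) powr a"
          by (rule inc) (use 3 \<rho> in \<open>auto simp: norm_mult\<close>)
        then show ?thesis unfolding E using 3 by (simp add: norm_minus_commute)
      qed
    qed (use K in auto)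
    then show ?thesis using c(2) by (simp add: D_def)
  qed
  \<comment> \<open>The second summand covers \<open>r < 1 / 2\<close>, where the mean is at most
    its value at \<open>1 / 2\<close> and \<open>(1 - r) powr (a - 1)\<close> is at least 1.\<close>
  define C where "C = D * (1 / 2) powr (a - 1) + integral_mean p (1 / 2) (deriv g)"
  have "integral_mean p r (deriv g) \<le> C * (1 - r) powr (a - 1)" if r: "0 \<le> r" "r < 1" for r
  proof (cases "1 / 2 \<le> r")
    case True
    have "integral_mean p r (deriv g) \<le> D * (1 / 2) powr (a - 1) * (1 - r) powr (a - 1)"
    proof -
      have "((1 - r) / 2) powr (a - 1) = (1 / 2) powr (a - 1) * (1 - r) powr (a - 1)"
        using r by (subst powr_mult[symmetric]) auto
      then show ?thesis using main[OF True r(2)] by (simp add: mult.assoc)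
    qed
    also have "\<dots> \<le> C * (1 - r) powr (a - 1)" by (intro mult_right_mono) (auto simp: C_def)
    finally show ?thesis .
  next
    case False
    have "1 powr (a - 1) \<le> (1 - r) powr (a - 1)" using r a by (intro powr_mono2') auto
    then have "integral_mean p (1 / 2) (deriv g) * 1 \<le> C * (1 - r) powr (a - 1)"
      using D by (intro mult_mono) (auto simp: C_def)
    moreover have "integral_mean p r (deriv g) \<le> integral_mean p (1 / 2) (deriv g)"
      by (rule integral_mean_mono[OF dhol p]) (use r False in auto)
    ultimately show ?thesis by linarith
  qed
  then show ?thesis by (auto simp: mean_growth_def)
qed

section \<open>Bergman norms\<close>

text \<open>The \<open>p\<close>-th power of the norm without its normalising factor, as an extended
  nonnegative integral. It is meaningful before membership is known, and for holomorphic functions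
  its finiteness is membership.\<close>

definition bergman_nn :: "real \<Rightarrow> real \<Rightarrow> (complex \<Rightarrow> complex) \<Rightarrow> ennreal" where
  "bergman_nn p \<alpha> f = (\<integral>\<^sup>+z\<in>ball 0 1. ennreal (cmod (f z) powr p * (1 - (cmod z)\<^sup>2) powr \<alpha>) \<partial>lborel)"

lemma bergman_nn_eq:
  "bergman_nn p \<alpha> f = (\<integral>\<^sup>+z. ennreal (norm (indicator (ball 0 1) z *\<^sub>R (cmod (f z) powr p * (1 - (cmod z)\<^sup>2) powr \<alpha>))) \<partial>lborel)"
  unfolding bergman_nn_def by (intro nn_integral_cong) (auto simp: indicator_def)

lemma borel_measurable_bergman_weight:
  assumes f: "continuous_on (ball 0 1) f" and p: "0 < p"
  shows "(\<lambda>z. indicator (ball 0 1) z *\<^sub>R (cmod (f z) powr p * (1 - (cmod z)\<^sup>2) powr \<alpha>)) \<in> borel_measurable borel"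
proof (rule borel_measurable_continuous_on_indicator)
  have "1 - (cmod z)\<^sup>2 \<noteq> 0" if "z \<in> ball 0 1" for z :: complex
    using that power_strict_mono[of "cmod z" 1 2] by auto
  then show "continuous_on (ball 0 1) (\<lambda>z. cmod (f z) powr p * (1 - (cmod z)\<^sup>2) powr \<alpha>)"
    by (intro continuous_on_mult continuous_on_norm_powr f p continuous_intros) auto
qed simp

lemma bergman_space_iff:
  assumes "0 < p"
  shows "f \<in> bergman_space p \<alpha> \<longleftrightarrow> f holomorphic_on ball 0 1 \<and> bergman_nn p \<alpha> f < \<infinity>"
proof -
  have "integrable lborel (\<lambda>z. indicator (ball 0 1) z *\<^sub>R (cmod (f z) powr p * (1 - (cmod z)\<^sup>2) powr \<alpha>)) \<longleftrightarrow> bergman_nn p \<alpha> f < \<infinity>"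
    if "f holomorphic_on ball 0 1"
    using borel_measurable_bergman_weight[OF holomorphic_on_imp_continuous_on[OF that] assms, of \<alpha>]
    unfolding bergman_nn_eq integrable_iff_bounded by simp
  then show ?thesis by (auto simp: bergman_space_def set_integrable_def)
qed

lemma bergman_norm_eq:
  assumes f: "f holomorphic_on ball 0 1" and p: "0 < p"
  shows "bergman_norm p \<alpha> f = ((\<alpha> + 1) * ((1 / pi) * enn2real (bergman_nn p \<alpha> f))) powr (1 / p)"
proof -
  have "(LINT z:ball 0 1|lborel. cmod (f z) powr p * (1 - (cmod z)\<^sup>2) powr \<alpha>) = enn2real (bergman_nn p \<alpha> f)"
    unfolding set_lebesgue_integral_def
    by (subst integral_eq_nn_integral)
       (use borel_measurable_bergman_weight[OF holomorphic_on_imp_continuous_on[OF f] p, of \<alpha>] in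
         \<open>auto simp: bergman_nn_eq\<close>)
  then show ?thesis by (simp add: bergman_norm_def)
qed

text \<open>One inequality in \<open>ennreal\<close> yields both membership and the norm bound. The
  real-valued norm alone would not do: a divergent integral has the default value 0 there.\<close>

lemma bounded_on_bergmanI:
  assumes p: "0 < p" and \<alpha>: "-1 < \<alpha>" and C: "0 \<le> C"
    and hol: "\<And>f. f \<in> bergman_space p \<alpha> \<Longrightarrow> T f holomorphic_on ball 0 1"
    and le: "\<And>f. f \<in> bergman_space p \<alpha> \<Longrightarrow> bergman_nn p \<alpha> (T f) \<le> ennreal C * bergman_nn p \<alpha> f"
  shows "bounded_on_bergman p \<alpha> T"
  unfolding bounded_on_bergman_def
proof (intro conjI exI ballI)
  fix f assume f: "f \<in> bergman_space p \<alpha>"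
  then have fin: "bergman_nn p \<alpha> f < \<infinity>" and fh: "f holomorphic_on ball 0 1" using p by (auto simp: bergman_space_iff)
  have "ennreal C * bergman_nn p \<alpha> f < \<infinity>" using fin by (simp add: ennreal_mult_less_top)
  with le[OF f] have fin': "bergman_nn p \<alpha> (T f) < \<infinity>" by (rule order.strict_trans1)
  then show "T f \<in> bergman_space p \<alpha>" using hol[OF f] p by (simp add: bergman_space_iff)
  have "enn2real (bergman_nn p \<alpha> (T f)) \<le> enn2real (ennreal C * bergman_nn p \<alpha> f)"
    by (rule enn2real_mono[OF le[OF f]]) (use fin in \<open>simp add: ennreal_mult_less_top\<close>)
  also have "\<dots> = C * enn2real (bergman_nn p \<alpha> f)" using C by (simp add: enn2real_mult)
  finally have "(\<alpha> + 1) * ((1 / pi) * enn2real (bergman_nn p \<alpha> (T f))) \<le> (\<alpha> + 1) * ((1 / pi) * (C * enn2real (bergman_nn p \<alpha> f)))"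
    using \<alpha> by (intro mult_left_mono) auto
  then have "bergman_norm p \<alpha> (T f) \<le> ((\<alpha> + 1) * ((1 / pi) * (C * enn2real (bergman_nn p \<alpha> f)))) powr (1 / p)"
    unfolding bergman_norm_eq[OF hol[OF f] p] using p \<alpha> by (intro powr_mono2) auto
  also have "\<dots> = C powr (1 / p) * bergman_norm p \<alpha> f"
    unfolding bergman_norm_eq[OF fh p] using C \<alpha>
    by (subst powr_mult[symmetric]) (auto simp: mult_ac)
  finally show "bergman_norm p \<alpha> (T f) \<le> C powr (1 / p) * bergman_norm p \<alpha> f" .
qed

lemma bergman_nn_polar:
  assumes f: "continuous_on (ball 0 1) f" and p: "0 < p"
  shows "bergman_nn p \<alpha> f = (\<integral>\<^sup>+r\<in>{0<..<1}. ennreal (2 * pi * r * (1 - r\<^sup>2) powr \<alpha> * integral_mean p r f powr p) \<partial>lborel)"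
proof -
  define f' where "f' w = indicator (ball 0 1) w *\<^sub>R f w" for w
  have [measurable]: "f' \<in> borel_measurable borel"
    unfolding f'_def[abs_def] by (rule borel_measurable_disc[OF f])
  have "bergman_nn p \<alpha> f = (\<integral>\<^sup>+z\<in>ball 0 1. ennreal (cmod (f' z) powr p * (1 - (cmod z)\<^sup>2) powr \<alpha>) \<partial>lborel)"
    unfolding bergman_nn_def by (intro nn_integral_cong) (auto simp: f'_def indicator_def)
  also have "\<dots> = (\<integral>\<^sup>+r\<in>{0<..<1}. ennreal r * (\<integral>\<^sup>+\<theta>\<in>{0..2*pi}. ennreal (cmod (f' (rcis r \<theta>)) powr p * (1 - (cmod (rcis r \<theta>))\<^sup>2) powr \<alpha>) \<partial>lborel) \<partial>lborel)"
    by (rule nn_integral_polar) measurable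
  also have "\<dots> = (\<integral>\<^sup>+r\<in>{0<..<1}. ennreal (2 * pi * r * (1 - r\<^sup>2) powr \<alpha> * integral_mean p r f powr p) \<partial>lborel)"
  proof (rule nn_integral_cong)
    fix r :: real
    show "ennreal r * (\<integral>\<^sup>+\<theta>\<in>{0..2*pi}. ennreal (cmod (f' (rcis r \<theta>)) powr p * (1 - (cmod (rcis r \<theta>))\<^sup>2) powr \<alpha>) \<partial>lborel) * indicator {0<..<1} r
      = ennreal (2 * pi * r * (1 - r\<^sup>2) powr \<alpha> * integral_mean p r f powr p) * indicator {0<..<1} r"
    proof (cases "r \<in> {0<..<1}")
      case True
      have "(\<integral>\<^sup>+\<theta>\<in>{0..2*pi}. ennreal (cmod (f' (rcis r \<theta>)) powr p * (1 - (cmod (rcis r \<theta>))\<^sup>2) powr \<alpha>) \<partial>lborel)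
        = (\<integral>\<^sup>+\<theta>. ennreal ((1 - r\<^sup>2) powr \<alpha>) * (ennreal (cmod (f (rcis r \<theta>)) powr p) * indicator {0..2*pi} \<theta>) \<partial>lborel)"
        using True by (intro nn_integral_cong) (auto simp: f'_def ennreal_mult indicator_def mult_ac)
      also have "\<dots> = ennreal ((1 - r\<^sup>2) powr \<alpha>) * (\<integral>\<^sup>+\<theta>\<in>{0..2*pi}. ennreal (cmod (f (rcis r \<theta>)) powr p) \<partial>lborel)"
      proof (rule nn_integral_cmult)
        have "continuous_on UNIV (\<lambda>\<theta>. cmod (f (of_real r * cis \<theta>)) powr p)"
          using True by (intro continuous_on_norm_powr continuous_on_circle f p) auto
        then have [measurable]: "(\<lambda>\<theta>. cmod (f (rcis r \<theta>)) powr p) \<in> borel_measurable borel"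
          unfolding rcis_def by (rule borel_measurable_continuous_onI)
        show "(\<lambda>\<theta>. ennreal (cmod (f (rcis r \<theta>)) powr p) * indicator {0..2*pi} \<theta>) \<in> borel_measurable lborel"
          by measurable
      qed
      also have "\<dots> = ennreal ((1 - r\<^sup>2) powr \<alpha>) * ennreal (2 * pi * integral_mean p r f powr p)"
        using nn_integral_mean[OF f, of r p] True p by simp
      finally show ?thesis using True
        by (simp add: ennreal_mult[symmetric] mult_ac)
    qed simp
  qed
  finally show ?thesis .
qed

section \<open>Area mean values and restriction to the diameter\<close>

lemma area_mean_value:
  assumes F: "F holomorphic_on ball 0 1" and p: "1 < p"
  shows "ennreal (pi * cmod (F 0) powr p) \<le> (\<integral>\<^sup>+z\<in>ball 0 1. ennreal (cmod (F z) powr p) \<partial>lborel)"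
proof -
  have Fc: "continuous_on (ball 0 1) F" by (rule holomorphic_on_imp_continuous_on[OF F])
  have M0: "integral_mean p 0 F = cmod (F 0)"
    using p by (simp add: integral_mean_def set_lebesgue_integral_def powr_powr)
  have "ennreal (pi * cmod (F 0) powr p) = ennreal (pi * cmod (F 0) powr p * 1\<^sup>2 - pi * cmod (F 0) powr p * 0\<^sup>2)" by simp
  also have "\<dots> = (\<integral>\<^sup>+r. ennreal (2 * pi * cmod (F 0) powr p * r) * indicator {0..1} r \<partial>lborel)"
    by (rule nn_integral_FTC_Icc[symmetric, where F="\<lambda>r. pi * cmod (F 0) powr p * r\<^sup>2"])
       (auto intro!: derivative_eq_intros)
  also have "\<dots> = (\<integral>\<^sup>+r\<in>{0<..<1}. ennreal (2 * pi * cmod (F 0) powr p * r) \<partial>lborel)"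
  proof (rule nn_integral_cong_AE)
    show "AE r in lborel. ennreal (2 * pi * cmod (F 0) powr p * r) * indicator {0..1} r = ennreal (2 * pi * cmod (F 0) powr p * r) * indicator {0<..<1} r"
      using AE_lborel_singleton[of 0] AE_lborel_singleton[of 1] by eventually_elim (auto simp: indicator_def)
  qed
  \<comment> \<open>The circle means increase with the radius and start at
    \<open>cmod (F 0)\<close>, so the constant value may be replaced by the mean on every
    circle.\<close>
  also have "\<dots> \<le> (\<integral>\<^sup>+r\<in>{0<..<1}. ennreal (2 * pi * r * (1 - r\<^sup>2) powr 0 * integral_mean p r F powr p) \<partial>lborel)"
  proof (rule nn_integral_mono)
    fix r :: real
    show "ennreal (2 * pi * cmod (F 0) powr p * r) * indicator {0<..<1} r
        \<le> ennreal (2 * pi * r * (1 - r\<^sup>2) powr 0 * integral_mean p r F powr p) * indicator {0<..<1} r"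
    proof (cases "r \<in> {0<..<1}")
      case True
      \<comment> \<open>Needed because \<open>0 powr 0 = 0\<close>: the weight with exponent 0
        equals 1 only where its base is nonzero.\<close>
      then have "1 - r\<^sup>2 \<noteq> 0" using power_strict_mono[of r 1 2] by auto
      moreover have "cmod (F 0) powr p \<le> integral_mean p r F powr p"
        unfolding M0[symmetric] using True p by (intro powr_mono2 integral_mean_mono[OF F p]) auto
      then have "2 * pi * r * cmod (F 0) powr p \<le> 2 * pi * r * integral_mean p r F powr p"
        using True by (intro mult_left_mono) auto
      ultimately show ?thesis using True by (auto intro!: ennreal_leI simp: mult_ac)
    qed simp
  qed
  also have "\<dots> = bergman_nn p 0 F" using bergman_nn_polar[OF Fc, of p 0] p by simp
  also have "\<dots> = (\<integral>\<^sup>+z\<in>ball 0 1. ennreal (cmod (F z) powr p) \<partial>lborel)"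
    unfolding bergman_nn_def
  proof (rule nn_integral_cong)
    fix z :: complex
    have "1 - (cmod z)\<^sup>2 \<noteq> 0" if "cmod z < 1" using that power_strict_mono[of "cmod z" 1 2] by auto
    then show "ennreal (cmod (F z) powr p * (1 - (cmod z)\<^sup>2) powr 0) * indicator (ball 0 1) z = ennreal (cmod (F z) powr p) * indicator (ball 0 1) z"
      by (auto simp: indicator_def)
  qed
  finally show ?thesis .
qed

lemma nn_integral_ball_affine:
  fixes h :: "complex \<Rightarrow> ennreal"
  assumes [measurable]: "h \<in> borel_measurable borel" and \<delta>: "0 < \<delta>"
  shows "(\<integral>\<^sup>+w\<in>ball c \<delta>. h w \<partial>lborel) = ennreal (\<delta>\<^sup>2) * (\<integral>\<^sup>+z\<in>ball 0 1. h (c + of_real \<delta> * z) \<partial>lborel)"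
proof -
  have b[measurable]: "ball c \<delta> \<in> sets borel" by simp
  define H where "H w = h w * indicator (ball c \<delta>) w" for w
  have H[measurable]: "H \<in> borel_measurable borel"
    unfolding H_def[abs_def] by (intro borel_measurable_times_ennreal borel_measurable_indicator) auto
  have "(\<integral>\<^sup>+w. H w \<partial>lborel) = (\<integral>\<^sup>+w. H w \<partial>density (distr lborel borel (\<lambda>x. c + \<delta> *\<^sub>R x)) (\<lambda>_. \<bar>\<delta>\<bar> ^ DIM(complex)))"
    using lborel_affine[of \<delta> c] \<delta> by simp
  also have "\<dots> = (\<integral>\<^sup>+z. ennreal (\<delta>\<^sup>2) * H (c + \<delta> *\<^sub>R z) \<partial>lborel)"
    using \<delta> by (subst nn_integral_density) (auto simp: nn_integral_distr)
  also have "\<dots> = ennreal (\<delta>\<^sup>2) * (\<integral>\<^sup>+z. H (c + \<delta> *\<^sub>R z) \<partial>lborel)"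
    by (rule nn_integral_cmult) measurable
  also have "(\<integral>\<^sup>+z. H (c + \<delta> *\<^sub>R z) \<partial>lborel) = (\<integral>\<^sup>+z\<in>ball 0 1. h (c + of_real \<delta> * z) \<partial>lborel)"
    using \<delta> by (intro nn_integral_cong) (auto simp: H_def indicator_def dist_norm norm_mult scaleR_conv_of_real)
  finally show ?thesis by (simp add: H_def)
qed

lemma powr_le_mult_powr:
  fixes x y :: real
  assumes "0 < y" "y / k \<le> x" "x \<le> k * y" "1 \<le> k"
  shows "x powr b \<le> k powr \<bar>b\<bar> * y powr b"
proof (cases "0 \<le> b")
  case True
  have "0 \<le> x" using assms by (meson divide_nonneg_nonneg less_imp_le order_trans zero_le_one)
  then have "x powr b \<le> (k * y) powr b" using True assms by (intro powr_mono2) auto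
  then show ?thesis using True assms by (simp add: powr_mult)
next
  case False
  have "0 < y / k" using assms by simp
  then have "x powr b \<le> (y / k) powr b" using False assms by (intro powr_mono2') auto
  then show ?thesis using False assms by (simp add: powr_divide powr_minus_divide)
qed

text \<open>A Carleson-type estimate. \<open>|f t|^p\<close> is at most the average of
  \<open>|f|^p\<close> over the disc of radius \<open>(1 - t) / 2\<close> about \<open>t\<close>.
  After exchanging integrals, a point \<open>w\<close> is charged only by those \<open>t\<close> for
  which \<open>1 - t\<close> is comparable with \<open>1 - cmod w\<close>; they form a set of length
  at most a multiple of \<open>1 - cmod w\<close>, so \<open>(1 - t) powr (\<alpha> - 1)\<close>
  integrates to a multiple of \<open>(1 - cmod w) powr \<alpha>\<close>.\<close>

lemma bergman_diameter_bound:
  assumes p: "1 < p" and \<alpha>: "-1 < \<alpha>"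
  obtains C where "0 < C" "\<And>f. f holomorphic_on ball 0 1 \<Longrightarrow>
    (\<integral>\<^sup>+t\<in>{0..<1}. ennreal (cmod (f (of_real t)) powr p * (1 - t) powr (\<alpha> + 1)) \<partial>lborel) \<le> ennreal C * bergman_nn p \<alpha> f"
proof
  define C where "C = 4 / pi * (2 powr \<bar>\<alpha> - 1\<bar> * 2 * 2 powr \<bar>\<alpha>\<bar>)"
  show "0 < C" by (simp add: C_def)
  fix f :: "complex \<Rightarrow> complex" assume f: "f holomorphic_on ball 0 1"
  have fc: "continuous_on (ball 0 1) f" by (rule holomorphic_on_imp_continuous_on[OF f])
  define f' where "f' w = indicator (ball 0 1) w *\<^sub>R f w" for w
  have [measurable]: "f' \<in> borel_measurable borel"
    unfolding f'_def[abs_def] by (rule borel_measurable_disc[OF fc])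
  \<comment> \<open>The disc condition is kept inside one function of both variables, so that its
    joint measurability is visible when the integrals are exchanged.\<close>
  define J where "J t w = (if 0 \<le> t \<and> t < 1 \<and> cmod (w - of_real t) < (1 - t) / 2 then ennreal ((1 - t) powr (\<alpha> - 1)) else 0)" for t w
  have [measurable]: "(\<lambda>(t, w). J t w) \<in> borel_measurable (borel \<Otimes>\<^sub>M borel)"
    unfolding J_def[abs_def] by measurable
  have pt: "ennreal (cmod (f (of_real t)) powr p * (1 - t) powr (\<alpha> + 1)) * indicator {0..<1} t
      \<le> (\<integral>\<^sup>+w. ennreal (4 / pi) * (J t w * ennreal (cmod (f' w) powr p)) \<partial>lborel)" for t
  proof (cases "t \<in> {0..<1}")
    case True
    define \<delta> where "\<delta> = (1 - t) / 2"
    have \<delta>: "0 < \<delta>" using True by (simp add: \<delta>_def)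
    have in1: "of_real t + of_real \<delta> * z \<in> ball 0 1" if "z \<in> ball 0 1" for z :: complex
    proof -
      have "cmod (of_real t + of_real \<delta> * z) \<le> t + \<delta> * cmod z"
        using norm_triangle_ineq[of "of_real t" "of_real \<delta> * z"] True \<delta> by (simp add: norm_mult)
      also have "\<dots> \<le> t + \<delta> * 1" using \<delta> that by (intro add_left_mono mult_left_mono) auto
      also have "\<dots> < 1" using True by (simp add: \<delta>_def field_simps)
      finally show ?thesis by simp
    qed
    have "(\<lambda>z. f (of_real t + of_real \<delta> * z)) holomorphic_on ball 0 1"
    proof -
      have "(\<lambda>z. of_real t + of_real \<delta> * z) holomorphic_on ball 0 1" by (intro holomorphic_intros)
      moreover have "(\<lambda>z. of_real t + of_real \<delta> * z) ` ball (0 :: complex) 1 \<subseteq> ball 0 1" using in1 by blast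
      ultimately show ?thesis
        using holomorphic_on_compose_gen[of "\<lambda>z. of_real t + of_real \<delta> * z" "ball 0 1" f "ball 0 1"] f
        by (simp add: o_def)
    qed
    from area_mean_value[OF this p]
    have "ennreal (\<delta>\<^sup>2) * ennreal (pi * cmod (f (of_real t)) powr p) \<le> ennreal (\<delta>\<^sup>2) * (\<integral>\<^sup>+z\<in>ball 0 1. ennreal (cmod (f (of_real t + of_real \<delta> * z)) powr p) \<partial>lborel)"
      by (intro mult_left_mono) auto
    also have "(\<integral>\<^sup>+z\<in>ball 0 1. ennreal (cmod (f (of_real t + of_real \<delta> * z)) powr p) \<partial>lborel)
        = (\<integral>\<^sup>+z\<in>ball 0 1. ennreal (cmod (f' (of_real t + of_real \<delta> * z)) powr p) \<partial>lborel)"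
      using in1 by (intro nn_integral_cong) (auto simp: f'_def indicator_def)
    also have "ennreal (\<delta>\<^sup>2) * \<dots> = (\<integral>\<^sup>+w\<in>ball (of_real t) \<delta>. ennreal (cmod (f' w) powr p) \<partial>lborel)"
      by (rule nn_integral_ball_affine[OF _ \<delta>, symmetric]) measurable
    finally have sub: "ennreal (\<delta>\<^sup>2) * ennreal (pi * cmod (f (of_real t)) powr p) \<le> (\<integral>\<^sup>+w\<in>ball (of_real t) \<delta>. ennreal (cmod (f' w) powr p) \<partial>lborel)" .
    \<comment> \<open>\<open>4 / pi\<close> converts the area \<open>\<delta>\<^sup>2 * pi\<close>
      of the disc into \<open>(1 - t) powr 2\<close>.\<close>
    have "(1 - t) powr (\<alpha> + 1) = 4 / pi * (1 - t) powr (\<alpha> - 1) * (\<delta>\<^sup>2 * pi)"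
    proof -
      have "(1 - t) powr (\<alpha> + 1) = (1 - t) powr (\<alpha> - 1) * (1 - t) powr 2"
        by (simp add: powr_add[symmetric] add.commute)
      then show ?thesis using True by (simp add: \<delta>_def power_divide field_simps)
    qed
    then have "ennreal (cmod (f (of_real t)) powr p * (1 - t) powr (\<alpha> + 1))
        = ennreal (4 / pi) * ennreal ((1 - t) powr (\<alpha> - 1)) * (ennreal (\<delta>\<^sup>2) * ennreal (pi * cmod (f (of_real t)) powr p))"
      by (simp add: ennreal_mult[symmetric] mult_ac)
    also have "\<dots> \<le> ennreal (4 / pi) * ennreal ((1 - t) powr (\<alpha> - 1)) * (\<integral>\<^sup>+w\<in>ball (of_real t) \<delta>. ennreal (cmod (f' w) powr p) \<partial>lborel)"
      by (intro mult_left_mono sub) auto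
    also have "\<dots> = (\<integral>\<^sup>+w. ennreal (4 / pi) * ennreal ((1 - t) powr (\<alpha> - 1)) * (ennreal (cmod (f' w) powr p) * indicator (ball (of_real t) \<delta>) w) \<partial>lborel)"
      by (rule nn_integral_cmult[symmetric]) (auto intro!: borel_measurable_times_ennreal borel_measurable_indicator)
    also have "\<dots> = (\<integral>\<^sup>+w. ennreal (4 / pi) * (J t w * ennreal (cmod (f' w) powr p)) \<partial>lborel)"
      using True by (intro nn_integral_cong) (auto simp: J_def \<delta>_def indicator_def dist_norm norm_minus_commute mult_ac)
    finally show ?thesis using True by simp
  qed simp
  have Jw: "(\<integral>\<^sup>+t. J t w \<partial>lborel) \<le> ennreal (2 powr \<bar>\<alpha> - 1\<bar> * 2 * 2 powr \<bar>\<alpha>\<bar> * (1 - (cmod w)\<^sup>2) powr \<alpha>)" if w: "w \<in> ball 0 1" for w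
  proof -
    define d where "d = 1 - cmod w"
    have d: "0 < d" using w by (simp add: d_def)
    have "J t w \<le> ennreal (2 powr \<bar>\<alpha> - 1\<bar> * d powr (\<alpha> - 1)) * indicator {1 - 2 * d..1} t" for t
    proof (cases "0 \<le> t \<and> t < 1 \<and> cmod (w - of_real t) < (1 - t) / 2")
      case True
      have "cmod w \<le> t + cmod (w - of_real t)" "t \<le> cmod w + cmod (w - of_real t)"
        using True norm_triangle_ineq2[of w "of_real t"] norm_triangle_ineq2[of "of_real t" w] by (auto simp: norm_minus_commute)
      \<comment> \<open>The distance of \<open>w\<close> from \<open>t\<close> is less than
        \<open>(1 - t) / 2\<close>, so \<open>d\<close> and \<open>1 - t\<close> differ by at most
        \<open>(1 - t) / 2\<close>; hence each is at most twice the other.\<close>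
      then have "d / 2 \<le> 1 - t" "1 - t \<le> 2 * d" using True d by (auto simp: d_def)
      then show ?thesis using True powr_le_mult_powr[of d 2 "1 - t" "\<alpha> - 1"] d
        by (auto simp: J_def intro!: ennreal_leI)
    qed (auto simp: J_def)
    then have "(\<integral>\<^sup>+t. J t w \<partial>lborel) \<le> (\<integral>\<^sup>+t. ennreal (2 powr \<bar>\<alpha> - 1\<bar> * d powr (\<alpha> - 1)) * indicator {1 - 2 * d..1} t \<partial>lborel)"
      by (intro nn_integral_mono)
    also have "\<dots> = ennreal (2 powr \<bar>\<alpha> - 1\<bar> * d powr (\<alpha> - 1)) * ennreal (2 * d)"
      using d by (subst nn_integral_cmult_indicator) auto
    also have "\<dots> = ennreal (2 powr \<bar>\<alpha> - 1\<bar> * 2 * d powr \<alpha>)"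
      using d by (simp add: ennreal_mult[symmetric] powr_diff)
    also have "\<dots> \<le> ennreal (2 powr \<bar>\<alpha> - 1\<bar> * 2 * (2 powr \<bar>\<alpha>\<bar> * (1 - (cmod w)\<^sup>2) powr \<alpha>))"
    proof (intro ennreal_leI mult_left_mono powr_le_mult_powr)
      have e: "1 - (cmod w)\<^sup>2 = d * (1 + cmod w)" by (simp add: d_def power2_eq_square algebra_simps)
      show "0 < 1 - (cmod w)\<^sup>2" unfolding e using d by (intro mult_pos_pos) (auto intro: add_pos_nonneg)
      have "d * (1 + cmod w) \<le> d * 2" using d w by (intro mult_left_mono) auto
      then show "(1 - (cmod w)\<^sup>2) / 2 \<le> d" unfolding e by simp
      have "d * 1 \<le> d * (1 + cmod w)" using d by (intro mult_left_mono) auto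
      then show "d \<le> 2 * (1 - (cmod w)\<^sup>2)" unfolding e using d by simp
    qed auto
    finally show ?thesis by (simp add: mult_ac)
  qed
  have "(\<integral>\<^sup>+t\<in>{0..<1}. ennreal (cmod (f (of_real t)) powr p * (1 - t) powr (\<alpha> + 1)) \<partial>lborel)
      \<le> (\<integral>\<^sup>+t. \<integral>\<^sup>+w. ennreal (4 / pi) * (J t w * ennreal (cmod (f' w) powr p)) \<partial>lborel \<partial>lborel)"
    by (intro nn_integral_mono pt)
  also have "\<dots> = (\<integral>\<^sup>+w. \<integral>\<^sup>+t. ennreal (4 / pi) * (J t w * ennreal (cmod (f' w) powr p)) \<partial>lborel \<partial>lborel)"
    by (rule lborel_pair.Fubini'[symmetric]) (use \<open>(\<lambda>(t, w). J t w) \<in> _\<close> in measurable)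
  also have "\<dots> = (\<integral>\<^sup>+w. ennreal (4 / pi) * ((\<integral>\<^sup>+t. J t w \<partial>lborel) * ennreal (cmod (f' w) powr p)) \<partial>lborel)"
    by (intro nn_integral_cong) (simp add: nn_integral_cmult nn_integral_multc)
  also have "\<dots> \<le> (\<integral>\<^sup>+w. ennreal C * ennreal (norm (indicator (ball 0 1) w *\<^sub>R (cmod (f w) powr p * (1 - (cmod w)\<^sup>2) powr \<alpha>))) \<partial>lborel)"
  proof (rule nn_integral_mono)
    fix w :: complex
    show "ennreal (4 / pi) * ((\<integral>\<^sup>+t. J t w \<partial>lborel) * ennreal (cmod (f' w) powr p))
      \<le> ennreal C * ennreal (norm (indicator (ball 0 1) w *\<^sub>R (cmod (f w) powr p * (1 - (cmod w)\<^sup>2) powr \<alpha>)))"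
    proof (cases "w \<in> ball 0 1")
      case True
      have "ennreal (4 / pi) * ((\<integral>\<^sup>+t. J t w \<partial>lborel) * ennreal (cmod (f' w) powr p))
         \<le> ennreal (4 / pi) * (ennreal (2 powr \<bar>\<alpha> - 1\<bar> * 2 * 2 powr \<bar>\<alpha>\<bar> * (1 - (cmod w)\<^sup>2) powr \<alpha>) * ennreal (cmod (f' w) powr p))"
        by (intro mult_left_mono mult_right_mono Jw True) auto
      also have "\<dots> = ennreal C * ennreal (norm (indicator (ball 0 1) w *\<^sub>R (cmod (f w) powr p * (1 - (cmod w)\<^sup>2) powr \<alpha>)))"
        using True by (simp add: C_def f'_def ennreal_mult[symmetric] mult_ac)
      finally show ?thesis .
    qed (use p in \<open>simp add: f'_def\<close>)
  qed
  also have "\<dots> = ennreal C * bergman_nn p \<alpha> f"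
    unfolding bergman_nn_eq
    by (rule nn_integral_cmult) (use borel_measurable_bergman_weight[OF fc, of p \<alpha>] p in auto)
  finally show "(\<integral>\<^sup>+t\<in>{0..<1}. ennreal (cmod (f (of_real t)) powr p * (1 - t) powr (\<alpha> + 1)) \<partial>lborel) \<le> ennreal C * bergman_nn p \<alpha> f" .
qed

text \<open>The values of \<open>|f|\<close> are compared with the threshold
  \<open>(1 - t) powr (- (\<alpha> + 1) / (p - 1))\<close>. Above it \<open>|f|\<close> is dominated
  by the integrand of the diameter bound; the threshold itself is integrable exactly because
  \<open>\<alpha> + 1 < p - 1\<close>.\<close>

lemma bergman_integrable_diameter:
  assumes p: "1 < p" and \<alpha>: "-1 < \<alpha>" "\<alpha> < p - 2" and f: "f \<in> bergman_space p \<alpha>"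
  shows "set_integrable lborel {0..<1} (\<lambda>t. f (of_real t))"
proof -
  have fh: "f holomorphic_on ball 0 1" and fin: "bergman_nn p \<alpha> f < \<infinity>"
    using f p by (auto simp: bergman_space_iff)
  have fc: "continuous_on (ball 0 1) f" by (rule holomorphic_on_imp_continuous_on[OF fh])
  define F where "F t = indicator {0..<1} t *\<^sub>R f (of_real t)" for t :: real
  have [measurable]: "F \<in> borel_measurable borel"
    unfolding F_def[abs_def]
    by (intro borel_measurable_continuous_on_indicator continuous_on_compose2[OF fc] continuous_intros) auto
  obtain C where C: "0 < C" "\<And>f. f holomorphic_on ball 0 1 \<Longrightarrow>
    (\<integral>\<^sup>+t\<in>{0..<1}. ennreal (cmod (f (of_real t)) powr p * (1 - t) powr (\<alpha> + 1)) \<partial>lborel) \<le> ennreal C * bergman_nn p \<alpha> f"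
    using bergman_diameter_bound[OF p \<alpha>(1)] by blast
  have "(\<integral>\<^sup>+t. ennreal (cmod (F t)) \<partial>lborel) \<le> (\<integral>\<^sup>+t. ennreal (cmod (F t) powr p * (1 - t) powr (\<alpha> + 1)) * indicator {0..<1} t
      + ennreal ((1 - t) powr (- (\<alpha> + 1) / (p - 1))) * indicator {0..<1} t \<partial>lborel)"
  proof (rule nn_integral_mono)
    fix t :: real
    show "ennreal (cmod (F t)) \<le> ennreal (cmod (F t) powr p * (1 - t) powr (\<alpha> + 1)) * indicator {0..<1} t
      + ennreal ((1 - t) powr (- (\<alpha> + 1) / (p - 1))) * indicator {0..<1} t"
    proof (cases "t \<in> {0..<1}")
      case True
      define x u where "x = cmod (F t)" and "u = 1 - t"
      have xu: "0 \<le> x" "0 < u" using True by (auto simp: x_def u_def)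
      have "x \<le> x powr p * u powr (\<alpha> + 1) + u powr (- (\<alpha> + 1) / (p - 1))"
      proof (cases "x \<le> u powr (- (\<alpha> + 1) / (p - 1))")
        case False
        then have "(u powr (- (\<alpha> + 1) / (p - 1))) powr (p - 1) \<le> x powr (p - 1)"
          using p by (intro powr_mono2) auto
        then have "u powr (- (\<alpha> + 1)) \<le> x powr (p - 1)" using p by (simp add: powr_powr)
        then have "u powr (- (\<alpha> + 1)) * u powr (\<alpha> + 1) \<le> x powr (p - 1) * u powr (\<alpha> + 1)"
          by (intro mult_right_mono) auto
        then have "1 \<le> x powr (p - 1) * u powr (\<alpha> + 1)" using xu by (simp add: powr_add[symmetric])
        then have "x * 1 \<le> x * (x powr (p - 1) * u powr (\<alpha> + 1))" using xu by (intro mult_left_mono) auto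
        also have "\<dots> = x powr p * u powr (\<alpha> + 1)" using xu by (cases "x = 0") (auto simp: powr_mult_base mult.assoc[symmetric])
        also have "\<dots> \<le> x powr p * u powr (\<alpha> + 1) + u powr (- (\<alpha> + 1) / (p - 1))" by simp
        finally show ?thesis by simp
      next
        case True
        moreover have "0 \<le> x powr p * u powr (\<alpha> + 1)" by simp
        ultimately show ?thesis by linarith
      qed
      then show ?thesis using True
        by (simp add: x_def u_def ennreal_plus[symmetric] del: ennreal_plus)
    qed (simp add: F_def)
  qed
  also have "\<dots> = (\<integral>\<^sup>+t\<in>{0..<1}. ennreal (cmod (F t) powr p * (1 - t) powr (\<alpha> + 1)) \<partial>lborel)
      + (\<integral>\<^sup>+t\<in>{0..<1}. ennreal ((1 - t) powr (- (\<alpha> + 1) / (p - 1))) \<partial>lborel)"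
    by (rule nn_integral_add) measurable
  also have "(\<integral>\<^sup>+t\<in>{0..<1}. ennreal (cmod (F t) powr p * (1 - t) powr (\<alpha> + 1)) \<partial>lborel)
      = (\<integral>\<^sup>+t\<in>{0..<1}. ennreal (cmod (f (of_real t)) powr p * (1 - t) powr (\<alpha> + 1)) \<partial>lborel)"
    by (intro nn_integral_cong) (auto simp: F_def indicator_def)
  also have "(\<integral>\<^sup>+t\<in>{0..<1}. ennreal ((1 - t) powr (- (\<alpha> + 1) / (p - 1))) \<partial>lborel) = ennreal (1 / (- (\<alpha> + 1) / (p - 1) + 1))"
    by (rule nn_integral_one_minus_powr) (use p \<alpha> in \<open>simp add: field_simps\<close>)
  also have "(\<integral>\<^sup>+t\<in>{0..<1}. ennreal (cmod (f (of_real t)) powr p * (1 - t) powr (\<alpha> + 1)) \<partial>lborel) + ennreal (1 / (- (\<alpha> + 1) / (p - 1) + 1))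
      \<le> ennreal C * bergman_nn p \<alpha> f + ennreal (1 / (- (\<alpha> + 1) / (p - 1) + 1))"
    by (intro add_mono C(2) fh) auto
  also have "\<dots> < \<infinity>" using fin by (simp add: ennreal_mult_less_top)
  finally have "integrable lborel F" by (intro integrableI_bounded) auto
  then show ?thesis by (simp add: set_integrable_def F_def[abs_def])
qed

lemma nn_integral_one_minus_le:
  assumes [measurable]: "k \<in> borel_measurable borel"
  shows "(\<integral>\<^sup>+t\<in>{0..<1}. k (1 - t) \<partial>lborel) \<le> (\<integral>\<^sup>+u\<in>{0<..}. k u \<partial>(lborel :: real measure))"
proof -
  define k' where "k' u = k u * indicator {0<..} u" for u :: real
  have "(\<integral>\<^sup>+u. k' u \<partial>lborel) = ennreal \<bar>-1\<bar> * (\<integral>\<^sup>+t. k' (1 + (-1) * t) \<partial>lborel)"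
    by (rule nn_integral_real_affine) (auto simp: k'_def[abs_def])
  then have "(\<integral>\<^sup>+t. k' (1 - t) \<partial>lborel) = (\<integral>\<^sup>+u. k' u \<partial>lborel)" by simp
  moreover have "(\<integral>\<^sup>+t\<in>{0..<1}. k (1 - t) \<partial>lborel) \<le> (\<integral>\<^sup>+t. k' (1 - t) \<partial>lborel)"
    by (intro nn_integral_mono) (auto simp: k'_def indicator_def)
  ultimately show ?thesis by (simp only: k'_def)
qed

section \<open>Sufficiency\<close>

lemma one_minus_mult_ge_max:
  fixes t r :: real
  assumes "0 \<le> t" "t < 1" "0 \<le> r" "r < 1"
  shows "max (1 - t) (1 - r) \<le> 1 - t * r"
proof -
  have "t * r \<le> t" using assms mult_left_mono[of r 1 t] by simp
  moreover have "t * r \<le> r" using assms mult_right_mono[of t 1 r] by simp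
  ultimately show ?thesis by simp
qed

lemma one_minus_square_powr_le:
  fixes r :: real
  assumes "0 \<le> r" "r < 1"
  shows "(1 - r\<^sup>2) powr b \<le> 2 powr \<bar>b\<bar> * (1 - r) powr b" "(1 - r) powr b \<le> 2 powr \<bar>b\<bar> * (1 - r\<^sup>2) powr b"
proof -
  have e: "1 - r\<^sup>2 = (1 - r) * (1 + r)" by (simp add: power2_eq_square algebra_simps)
  have "(1 - r) * 1 \<le> 1 - r\<^sup>2" unfolding e using assms by (intro mult_left_mono) auto
  moreover have "1 - r\<^sup>2 \<le> (1 - r) * 2" unfolding e using assms by (intro mult_left_mono) auto
  ultimately show "(1 - r\<^sup>2) powr b \<le> 2 powr \<bar>b\<bar> * (1 - r) powr b" "(1 - r) powr b \<le> 2 powr \<bar>b\<bar> * (1 - r\<^sup>2) powr b"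
    using assms by (auto intro!: powr_le_mult_powr)
qed

text \<open>Schur's test in two stages. For fixed \<open>r\<close>, Hoelder in \<open>t\<close> with
  the weight \<open>(1 - t) powr e\<close> separates \<open>f\<close> from an explicit kernel
  integral, which is a power of \<open>1 - r\<close>. The remaining double integral of
  \<open>|f|^p\<close> is integrated first in \<open>r\<close>, giving back the weight of the
  diameter bound.\<close>

lemma mean_growth_imp_bounded:
  assumes p: "1 < p" and \<alpha>: "-1 < \<alpha>" "\<alpha> < p - 2" and g: "g holomorphic_on ball 0 1"
    and gr: "mean_growth p (1 / p) g"
  shows "bounded_on_bergman p \<alpha> (gen_hilbert g)"
proof -
  obtain C where C: "0 < C" "\<And>r. 0 \<le> r \<Longrightarrow> r < 1 \<Longrightarrow> integral_mean p r (deriv g) \<le> C * (1 - r) powr (1 / p - 1)"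
    using mean_growthE[OF gr] by blast
  obtain Cd where Cd: "0 < Cd" "\<And>f. f holomorphic_on ball 0 1 \<Longrightarrow>
    (\<integral>\<^sup>+t\<in>{0..<1}. ennreal (cmod (f (of_real t)) powr p * (1 - t) powr (\<alpha> + 1)) \<partial>lborel) \<le> ennreal Cd * bergman_nn p \<alpha> f"
    using bergman_diameter_bound[OF p \<alpha>(1)] by blast
  have p1: "0 < 1 / p" "1 / p < 1" "0 < p" using p by auto
  have "1 - 1 / p < p - 1"
  proof -
    have "1 - 1 / p = (p - 1) / p" using p by (simp add: field_simps)
    also have "\<dots> < (p - 1) / 1" using p by (intro divide_strict_left_mono) auto
    finally show ?thesis by simp
  qed
  then have "max (\<alpha> + 1) (1 - 1 / p) < min (\<alpha> + 2 - 1 / p) (p - 1)" using p1 \<alpha> by simp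
  \<comment> \<open>The exponent of the Schur weight: both kernel integrals below converge exactly in this window.\<close>
  then obtain e where "max (\<alpha> + 1) (1 - 1 / p) < e" "e < min (\<alpha> + 2 - 1 / p) (p - 1)"
    using dense by blast
  then have e: "\<alpha> + 1 < e" "1 - 1 / p < e" "e < \<alpha> + 2 - 1 / p" "e < p - 1" by auto
  \<comment> \<open>\<open>B\<close> is the exponent of the kernel, \<open>A2\<close> that of
    \<open>1 - t\<close> in the factor of Hoelder's inequality not involving \<open>f\<close>, and
    \<open>A3\<close> that of \<open>1 - r\<close> once the Bergman weight and the power from the
    first kernel integral are collected.\<close>
  define B where "B = 1 / p - 1"
  define A2 where "A2 = - e / (p - 1)"
  define A3 where "A3 = \<alpha> + 1 - 1 / p - e"
  have B: "B < 0" using p1 by (simp add: B_def)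
  have A2: "-1 < A2" "A2 + B < -1"
  proof -
    show "-1 < A2" using e p by (simp add: A2_def field_simps)
    have "1 / p = (1 - 1 / p) / (p - 1)" using p by (simp add: field_simps)
    also have "\<dots> < e / (p - 1)" using e p by (intro divide_strict_right_mono) auto
    finally show "A2 + B < -1" by (simp add: A2_def B_def)
  qed
  have A3: "-1 < A3" "A3 + B < -1" using e by (auto simp: A3_def B_def)
  define K2 where "K2 = 1 / (A2 + 1) - 1 / (A2 + B + 1)"
  define K3 where "K3 = 1 / (A3 + 1) - 1 / (A3 + B + 1)"
  have pos: "0 < 1 / (A + 1) - 1 / (A + B + 1)" if "-1 < A" "A + B < -1" for A
  proof -
    have "0 < 1 / (A + 1)" "1 / (A + B + 1) < 0" using that by (auto simp: divide_less_0_iff)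
    then show ?thesis by linarith
  qed
  have K2: "0 < K2" and K3: "0 < K3" unfolding K2_def K3_def by (rule pos[OF A2], rule pos[OF A3])
  define D where "D = 2 * pi * 2 powr \<bar>\<alpha>\<bar> * (C powr p * K2 powr (p - 1))"
  have D: "0 \<le> D" by (simp add: D_def)
  show ?thesis
  proof (rule bounded_on_bergmanI[where C="D * K3 * Cd"])
    fix f assume f: "f \<in> bergman_space p \<alpha>"
    then have fh: "f holomorphic_on ball 0 1" and fin: "bergman_nn p \<alpha> f < \<infinity>"
      using p1 by (auto simp: bergman_space_iff)
    have int: "set_integrable lborel {0..<1} (\<lambda>t. f (of_real t))" by (rule bergman_integrable_diameter[OF p \<alpha> f])
    show hol: "gen_hilbert g f holomorphic_on ball 0 1"
      by (rule gen_hilbert_holomorphic[OF g fh int])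
    have fc: "continuous_on (ball 0 1) f" by (rule holomorphic_on_imp_continuous_on[OF fh])
    define F where "F t = cmod (indicator {0..<1} t *\<^sub>R f (of_real t))" for t :: real
    have "(\<lambda>t. indicator {0..<1} t *\<^sub>R f (of_real t)) \<in> borel_measurable (borel :: real measure)"
      by (intro borel_measurable_continuous_on_indicator continuous_on_compose2[OF fc] continuous_intros) auto
    then have [measurable]: "F \<in> borel_measurable borel"
      unfolding F_def[abs_def] by (rule borel_measurable_norm[THEN measurable_compose[rotated]])
    have F0: "0 \<le> F t" for t by (simp add: F_def)
    define W where "W = (\<integral>\<^sup>+t\<in>{0..<1}. ennreal (F t powr p * (1 - t) powr (\<alpha> + 1)) \<partial>lborel)"
    have W: "W \<le> ennreal Cd * bergman_nn p \<alpha> f"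
    proof -
      have "W = (\<integral>\<^sup>+t\<in>{0..<1}. ennreal (cmod (f (of_real t)) powr p * (1 - t) powr (\<alpha> + 1)) \<partial>lborel)"
        unfolding W_def by (intro nn_integral_cong) (auto simp: F_def indicator_def)
      then show ?thesis using Cd(2)[OF fh] by simp
    qed
    then have Wfin: "W < \<infinity>" by (rule order.strict_trans1) (use fin in \<open>simp add: ennreal_mult_less_top\<close>)
    define A where "A r = (\<integral>\<^sup>+t\<in>{0..<1}. ennreal (F t powr p * (1 - t) powr e * max (1 - t) (1 - r) powr B) \<partial>lborel)" for r
    \<comment> \<open>The Hoelder estimate below takes a real bound, so \<open>A r\<close> must be
      finite; \<open>\<alpha> + 1 < e\<close> lets the diameter integral \<open>W\<close> dominate
      it for each fixed \<open>r\<close>.\<close>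
    have Afin: "A r < \<infinity>" if r: "r \<in> {0<..<1}" for r
    proof -
      have "A r \<le> (\<integral>\<^sup>+t. ennreal ((1 - r) powr B) * (ennreal (F t powr p * (1 - t) powr (\<alpha> + 1)) * indicator {0..<1} t) \<partial>lborel)"
        unfolding A_def
      proof (rule nn_integral_mono)
        fix t :: real
        show "ennreal (F t powr p * (1 - t) powr e * max (1 - t) (1 - r) powr B) * indicator {0..<1} t
          \<le> ennreal ((1 - r) powr B) * (ennreal (F t powr p * (1 - t) powr (\<alpha> + 1)) * indicator {0..<1} t)"
        proof (cases "t \<in> {0..<1}")
          case True
          have "(1 - t) powr e \<le> (1 - t) powr (\<alpha> + 1)" using True e by (intro powr_mono') auto
          moreover have "max (1 - t) (1 - r) powr B \<le> (1 - r) powr B" using B r by (intro powr_mono2') auto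
          ultimately have "F t powr p * (1 - t) powr e * max (1 - t) (1 - r) powr B \<le> F t powr p * (1 - t) powr (\<alpha> + 1) * (1 - r) powr B"
            by (intro mult_mono) auto
          then show ?thesis using True by (simp add: ennreal_mult[symmetric] mult_ac ennreal_leI)
        qed simp
      qed
      also have "\<dots> = ennreal ((1 - r) powr B) * W"
        unfolding W_def by (rule nn_integral_cmult) measurable
      also have "\<dots> < \<infinity>" using Wfin by (simp add: ennreal_mult_less_top)
      finally show ?thesis .
    qed
    have mean: "ennreal (integral_mean p r (gen_hilbert g f) powr p) \<le> ennreal (C powr p * K2 powr (p - 1) * (1 - r) powr (1 - 1 / p - e)) * A r"
      if r: "r \<in> {0<..<1}" for r
    proof -
      define s where "s = 1 - r"
      have s: "0 < s" using r by (simp add: s_def)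
      define a where "a = enn2real (A r)"
      have a: "A r = ennreal a" "0 \<le> a" using Afin[OF r] by (auto simp: a_def less_top)
      define q where "q = p / (p - 1)"
      have q: "1 < q" "1 / p + 1 / q = 1" "q / p = 1 / (p - 1)" "p / q = p - 1" using p by (simp_all add: q_def field_simps)
      \<comment> \<open>The kernel exponent is divided as \<open>B = B / p + B / q\<close>, and the
        weights \<open>(1 - t) powr (e / p)\<close> and \<open>(1 - t) powr (- e / p)\<close> cancel
        in the product of \<open>\<phi>\<close> and \<open>\<psi>\<close>.\<close>
      define \<phi> where "\<phi> t = indicator {0..<1} t * (F t * (1 - t) powr (e / p) * max (1 - t) s powr (B / p))" for t
      define \<psi> where "\<psi> t = indicator {0..<1} t * ((1 - t) powr (- e / p) * max (1 - t) s powr (B / q))" for t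
      have "ennreal (integral_mean p r (gen_hilbert g f)) \<le>
          (\<integral>\<^sup>+t\<in>{0..<1}. ennreal (cmod (f (of_real t)) * integral_mean p (t * r) (deriv g)) \<partial>lborel)"
        by (rule integral_mean_gen_hilbert_le[OF g fh p int]) (use r in auto)
      also have "\<dots> \<le> (\<integral>\<^sup>+t. ennreal C * ennreal (\<phi> t * \<psi> t) \<partial>lborel)"
      proof (rule nn_integral_mono)
        fix t :: real
        show "ennreal (cmod (f (of_real t)) * integral_mean p (t * r) (deriv g)) * indicator {0..<1} t \<le> ennreal C * ennreal (\<phi> t * \<psi> t)"
        proof (cases "t \<in> {0..<1}")
          case True
          have tr: "0 \<le> t * r" "t * r < 1" using True r mult_strict_mono'[of t 1 r 1] by auto
          have "integral_mean p (t * r) (deriv g) \<le> C * (1 - t * r) powr B"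
            unfolding B_def by (rule C(2)[OF tr])
          \<comment> \<open>As \<open>B < 0\<close>, a lower bound for \<open>1 - t * r\<close>
            suffices. The maximum of \<open>1 - t\<close> and \<open>1 - r\<close> makes the kernel
            homogeneous, as the power integrals require.\<close>
          also have "\<dots> \<le> C * max (1 - t) s powr B"
            using one_minus_mult_ge_max[of t r] True r B s C(1)
            by (intro mult_left_mono powr_mono2') (auto simp: s_def)
          also have "max (1 - t) s powr B = max (1 - t) s powr (B / p) * max (1 - t) s powr (B / q)"
          proof -
            have "B = B / p + B / q" using q(2) by (metis distrib_left mult.right_neutral times_divide_eq_right)
            then show ?thesis by (metis powr_add)
          qed
          finally have "cmod (f (of_real t)) * integral_mean p (t * r) (deriv g)
              \<le> cmod (f (of_real t)) * (C * (max (1 - t) s powr (B / p) * max (1 - t) s powr (B / q)))"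
            by (intro mult_left_mono) auto
          also have "\<dots> = C * (\<phi> t * \<psi> t)"
          proof -
            have "(1 - t) powr (e / p) * (1 - t) powr (- e / p) = 1"
              using True by (simp add: powr_add[symmetric])
            then have "\<phi> t * \<psi> t = F t * 1 * (max (1 - t) s powr (B / p) * max (1 - t) s powr (B / q))"
              using True by (simp add: \<phi>_def \<psi>_def)
            then show ?thesis using True by (simp add: F_def)
          qed
          finally show ?thesis using True C(1) by (simp add: ennreal_mult'[symmetric] ennreal_leI)
        qed simp
      qed
      also have "\<dots> = ennreal C * (\<integral>\<^sup>+t. ennreal (\<phi> t * \<psi> t) \<partial>lborel)"
        by (rule nn_integral_cmult) (simp add: \<phi>_def \<psi>_def)
      also have "\<dots> \<le> ennreal C * ennreal (a powr (1 / p) * (K2 * s powr (A2 + B + 1)) powr (1 / q))"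
      proof (intro mult_left_mono nn_integral_Holder[OF _ _ _ _ p q(1,2)])
        show "(\<integral>\<^sup>+t. ennreal (\<phi> t powr p) \<partial>lborel) \<le> ennreal a"
        proof -
          have "(\<integral>\<^sup>+t. ennreal (\<phi> t powr p) \<partial>lborel) = A r"
            unfolding A_def
          proof (rule nn_integral_cong)
            fix t :: real
            show "ennreal (\<phi> t powr p) = ennreal (F t powr p * (1 - t) powr e * max (1 - t) (1 - r) powr B) * indicator {0..<1} t"
              using F0[of t] p1 by (cases "t \<in> {0..<1}") (auto simp: \<phi>_def s_def powr_mult powr_powr)
          qed
          then show ?thesis using a by simp
        qed
        show "(\<integral>\<^sup>+t. ennreal (\<psi> t powr q) \<partial>lborel) \<le> ennreal (K2 * s powr (A2 + B + 1))"
        proof -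
          have "- e / p * q = - e * (q / p)" by simp
          then have eq: "- e / p * q = A2" unfolding q(3) by (simp add: A2_def)
          have "(\<integral>\<^sup>+t. ennreal (\<psi> t powr q) \<partial>lborel) = (\<integral>\<^sup>+t\<in>{0..<1}. ennreal ((1 - t) powr A2 * max (1 - t) s powr B) \<partial>lborel)"
          proof (rule nn_integral_cong)
            fix t :: real
            show "ennreal (\<psi> t powr q) = ennreal ((1 - t) powr A2 * max (1 - t) s powr B) * indicator {0..<1} t"
              unfolding eq[symmetric] using q(1) by (cases "t \<in> {0..<1}") (auto simp: \<psi>_def powr_mult powr_powr)
          qed
          also have "\<dots> \<le> (\<integral>\<^sup>+u\<in>{0<..}. ennreal (u powr A2 * max u s powr B) \<partial>lborel)"
            by (rule nn_integral_one_minus_le[of "\<lambda>u. ennreal (u powr A2 * max u s powr B)"]) measurable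
          also have "\<dots> \<le> ennreal (K2 * s powr (A2 + B + 1))"
            unfolding K2_def by (rule nn_integral_max_powr[OF s A2])
          finally show ?thesis .
        qed
      qed (use a K2 F0 in \<open>auto simp: \<phi>_def \<psi>_def\<close>)
      also have "\<dots> = ennreal (C * (a powr (1 / p) * (K2 * s powr (A2 + B + 1)) powr (1 / q)))"
        using C(1) by (simp add: ennreal_mult'[symmetric])
      finally have "integral_mean p r (gen_hilbert g f) \<le> C * (a powr (1 / p) * (K2 * s powr (A2 + B + 1)) powr (1 / q))"
        using C(1) by (subst (asm) ennreal_le_iff) auto
      then have "integral_mean p r (gen_hilbert g f) powr p \<le> (C * (a powr (1 / p) * (K2 * s powr (A2 + B + 1)) powr (1 / q))) powr p"
        using p1 by (intro powr_mono2) auto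
      also have "\<dots> = C powr p * (a * (K2 * s powr (A2 + B + 1)) powr (p / q))"
        using C(1) a(2) K2 p1 by (simp add: powr_mult powr_powr)
      also have "(K2 * s powr (A2 + B + 1)) powr (p / q) = K2 powr (p - 1) * s powr (1 - 1 / p - e)"
      proof -
        have "(A2 + B + 1) * (p - 1) = 1 - 1 / p - e" using p by (simp add: A2_def B_def field_simps)
        then show ?thesis using K2 by (simp add: q(4) powr_mult powr_powr)
      qed
      finally have "integral_mean p r (gen_hilbert g f) powr p \<le> C powr p * K2 powr (p - 1) * s powr (1 - 1 / p - e) * a"
        by (simp add: mult_ac)
      then show ?thesis unfolding a(1) s_def[symmetric]
        using a(2) by (simp add: ennreal_mult[symmetric] ennreal_leI)
    qed
    define H where "H r t = ennreal ((1 - r) powr A3 * max (1 - t) (1 - r) powr B) * indicator {0<..<1} r * (ennreal (F t powr p * (1 - t) powr e) * indicator {0..<1} t)" for r t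
    have "bergman_nn p \<alpha> (gen_hilbert g f) = (\<integral>\<^sup>+r\<in>{0<..<1}. ennreal (2 * pi * r * (1 - r\<^sup>2) powr \<alpha> * integral_mean p r (gen_hilbert g f) powr p) \<partial>lborel)"
      by (rule bergman_nn_polar[OF holomorphic_on_imp_continuous_on[OF hol] p1(3)])
    also have "\<dots> \<le> (\<integral>\<^sup>+r. ennreal D * (\<integral>\<^sup>+t. H r t \<partial>lborel) \<partial>lborel)"
    proof (rule nn_integral_mono)
      fix r :: real
      show "ennreal (2 * pi * r * (1 - r\<^sup>2) powr \<alpha> * integral_mean p r (gen_hilbert g f) powr p) * indicator {0<..<1} r \<le> ennreal D * (\<integral>\<^sup>+t. H r t \<partial>lborel)"
      proof (cases "r \<in> {0<..<1}")
        case True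
        have "2 * pi * r * (1 - r\<^sup>2) powr \<alpha> \<le> 2 * pi * 1 * (2 powr \<bar>\<alpha>\<bar> * (1 - r) powr \<alpha>)"
          using True by (intro mult_mono one_minus_square_powr_le) auto
        then have "ennreal (2 * pi * r * (1 - r\<^sup>2) powr \<alpha> * integral_mean p r (gen_hilbert g f) powr p)
          \<le> ennreal (2 * pi * 2 powr \<bar>\<alpha>\<bar> * (1 - r) powr \<alpha>) * ennreal (integral_mean p r (gen_hilbert g f) powr p)"
          by (simp add: ennreal_mult''[symmetric] ennreal_leI mult_right_mono)
        also have "\<dots> \<le> ennreal (2 * pi * 2 powr \<bar>\<alpha>\<bar> * (1 - r) powr \<alpha>) * (ennreal (C powr p * K2 powr (p - 1) * (1 - r) powr (1 - 1 / p - e)) * A r)"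
          by (intro mult_left_mono mean True) auto
        also have "\<dots> = ennreal D * (ennreal ((1 - r) powr A3) * A r)"
        proof -
          have "(1 - r) powr A3 = (1 - r) powr \<alpha> * (1 - r) powr (1 - 1 / p - e)"
            by (simp add: powr_add[symmetric] A3_def algebra_simps)
          then have "2 * pi * 2 powr \<bar>\<alpha>\<bar> * (1 - r) powr \<alpha> * (C powr p * K2 powr (p - 1) * (1 - r) powr (1 - 1 / p - e)) = D * (1 - r) powr A3"
            by (simp add: D_def mult_ac)
          then have "ennreal (2 * pi * 2 powr \<bar>\<alpha>\<bar> * (1 - r) powr \<alpha>) * ennreal (C powr p * K2 powr (p - 1) * (1 - r) powr (1 - 1 / p - e)) = ennreal D * ennreal ((1 - r) powr A3)"
            using D by (simp add: ennreal_mult[symmetric])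
          then show ?thesis by (simp add: mult.assoc[symmetric])
        qed
        also have "ennreal ((1 - r) powr A3) * A r = (\<integral>\<^sup>+t. ennreal ((1 - r) powr A3) * (ennreal (F t powr p * (1 - t) powr e * max (1 - t) (1 - r) powr B) * indicator {0..<1} t) \<partial>lborel)"
          unfolding A_def by (rule nn_integral_cmult[symmetric]) measurable
        also have "\<dots> = (\<integral>\<^sup>+t. H r t \<partial>lborel)"
          using True by (intro nn_integral_cong) (auto simp: H_def indicator_def ennreal_mult mult_ac)
        finally show ?thesis using True by simp
      qed simp
    qed
    also have "\<dots> = ennreal D * (\<integral>\<^sup>+r. \<integral>\<^sup>+t. H r t \<partial>lborel \<partial>lborel)"
      unfolding H_def by (rule nn_integral_cmult) measurable
    also have "(\<integral>\<^sup>+r. \<integral>\<^sup>+t. H r t \<partial>lborel \<partial>lborel) = (\<integral>\<^sup>+t. \<integral>\<^sup>+r. H r t \<partial>lborel \<partial>lborel)"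
      unfolding H_def by (rule lborel_pair.Fubini'[symmetric]) measurable
    also have "\<dots> \<le> (\<integral>\<^sup>+t. ennreal K3 * (ennreal (F t powr p * (1 - t) powr (\<alpha> + 1)) * indicator {0..<1} t) \<partial>lborel)"
    proof (rule nn_integral_mono)
      fix t :: real
      show "(\<integral>\<^sup>+r. H r t \<partial>lborel) \<le> ennreal K3 * (ennreal (F t powr p * (1 - t) powr (\<alpha> + 1)) * indicator {0..<1} t)"
      proof (cases "t \<in> {0..<1}")
        case True
        have "(\<integral>\<^sup>+r\<in>{0<..<1}. ennreal ((1 - r) powr A3 * max (1 - t) (1 - r) powr B) \<partial>lborel)
          \<le> (\<integral>\<^sup>+r\<in>{0..<1}. ennreal ((1 - r) powr A3 * max (1 - r) (1 - t) powr B) \<partial>lborel)"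
          by (intro nn_integral_mono) (auto simp: indicator_def max.commute)
        also have "\<dots> \<le> (\<integral>\<^sup>+u\<in>{0<..}. ennreal (u powr A3 * max u (1 - t) powr B) \<partial>lborel)"
          by (rule nn_integral_one_minus_le[of "\<lambda>u. ennreal (u powr A3 * max u (1 - t) powr B)"]) measurable
        also have "\<dots> \<le> ennreal (K3 * (1 - t) powr (A3 + B + 1))"
          unfolding K3_def by (rule nn_integral_max_powr[OF _ A3]) (use True in auto)
        finally have I: "(\<integral>\<^sup>+r\<in>{0<..<1}. ennreal ((1 - r) powr A3 * max (1 - t) (1 - r) powr B) \<partial>lborel) \<le> ennreal (K3 * (1 - t) powr (A3 + B + 1))" .
        have "(\<integral>\<^sup>+r. H r t \<partial>lborel) = (\<integral>\<^sup>+r\<in>{0<..<1}. ennreal ((1 - r) powr A3 * max (1 - t) (1 - r) powr B) \<partial>lborel) * ennreal (F t powr p * (1 - t) powr e)"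
          unfolding H_def using True by (subst nn_integral_multc) auto
        also have "\<dots> \<le> ennreal (K3 * (1 - t) powr (A3 + B + 1)) * ennreal (F t powr p * (1 - t) powr e)"
          by (intro mult_right_mono I) auto
        also have "\<dots> = ennreal (K3 * (F t powr p * ((1 - t) powr e * (1 - t) powr (A3 + B + 1))))"
          using K3 by (simp add: ennreal_mult[symmetric] mult_ac)
        \<comment> \<open>The auxiliary exponent \<open>e\<close> cancels:
          \<open>e + A3 + B + 1 = \<alpha> + 1\<close>.\<close>
        also have "(1 - t) powr e * (1 - t) powr (A3 + B + 1) = (1 - t) powr (\<alpha> + 1)"
          by (simp add: powr_add[symmetric] A3_def B_def)
        finally show ?thesis using True K3 by (simp add: ennreal_mult)
      qed (simp add: H_def)
    qed
    also have "\<dots> = ennreal K3 * W"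
      unfolding W_def by (rule nn_integral_cmult) measurable
    finally have "bergman_nn p \<alpha> (gen_hilbert g f) \<le> ennreal D * (ennreal K3 * (ennreal Cd * bergman_nn p \<alpha> f))"
      using W by (meson mult_left_mono order_trans zero_le)
    also have "\<dots> = ennreal (D * K3 * Cd) * bergman_nn p \<alpha> f"
      using D K3 Cd(1) by (simp add: ennreal_mult mult_ac)
    finally show "bergman_nn p \<alpha> (gen_hilbert g f) \<le> ennreal (D * K3 * Cd) * bergman_nn p \<alpha> f" .
  qed (use p1 \<alpha> D K3 Cd in auto)
qed

section \<open>Necessity\<close>

text \<open>All means beyond \<open>R\<close> are at least the one at \<open>R\<close>, and the
  annulus beyond \<open>R\<close> has weight of order \<open>(1 - R) powr (\<alpha> + 1)\<close>.
  The condition \<open>R \<ge> 1 / 2\<close> replaces the factor \<open>2 * r\<close> of polar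
  coordinates by 1.\<close>

lemma integral_mean_le_bergman:
  assumes F: "F holomorphic_on ball 0 1" and p: "1 < p" and \<alpha>: "-1 < \<alpha>" and R: "1 / 2 \<le> R" "R < 1"
  shows "ennreal (pi / (2 powr \<bar>\<alpha>\<bar> * (\<alpha> + 1)) * (integral_mean p R F powr p * (1 - R) powr (\<alpha> + 1))) \<le> bergman_nn p \<alpha> F"
proof -
  define M where "M = integral_mean p R F powr p"
  define k where "k = pi / 2 powr \<bar>\<alpha>\<bar> * M"
  have k: "0 \<le> k" by (simp add: k_def M_def)
  have "ennreal (pi / (2 powr \<bar>\<alpha>\<bar> * (\<alpha> + 1)) * (M * (1 - R) powr (\<alpha> + 1))) = ennreal k * ennreal ((1 - R) powr (\<alpha> + 1) / (\<alpha> + 1))"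
    using k \<alpha> by (simp add: ennreal_mult[symmetric] k_def mult_ac)
  also have "\<dots> = (\<integral>\<^sup>+r. ennreal k * (ennreal ((1 - r) powr \<alpha>) * indicator {R..<1} r) \<partial>lborel)"
    by (subst nn_integral_cmult) (auto simp: nn_integral_one_minus_powr_from[OF \<alpha> R(2)])
  also have "\<dots> \<le> (\<integral>\<^sup>+r\<in>{0<..<1}. ennreal (2 * pi * r * (1 - r\<^sup>2) powr \<alpha> * integral_mean p r F powr p) \<partial>lborel)"
  proof (rule nn_integral_mono)
    fix r :: real
    show "ennreal k * (ennreal ((1 - r) powr \<alpha>) * indicator {R..<1} r)
      \<le> ennreal (2 * pi * r * (1 - r\<^sup>2) powr \<alpha> * integral_mean p r F powr p) * indicator {0<..<1} r"
    proof (cases "r \<in> {R..<1}")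
      case True
      have "M \<le> integral_mean p r F powr p"
        unfolding M_def using True R p by (intro powr_mono2 integral_mean_mono[OF F p]) auto
      moreover have "(1 - r) powr \<alpha> / 2 powr \<bar>\<alpha>\<bar> \<le> (1 - r\<^sup>2) powr \<alpha>"
        using one_minus_square_powr_le(2)[of r \<alpha>] True R by (simp add: field_simps)
      moreover have "1 \<le> 2 * r" using True R by simp
      ultimately have "pi * (1 * ((1 - r) powr \<alpha> / 2 powr \<bar>\<alpha>\<bar> * M)) \<le> pi * ((2 * r) * ((1 - r\<^sup>2) powr \<alpha> * integral_mean p r F powr p))"
        by (intro mult_left_mono mult_mono) (auto simp: M_def)
      then show ?thesis using True R k
        by (simp add: k_def ennreal_mult[symmetric] mult_ac ennreal_leI)
    qed simp
  qed
  also have "\<dots> = bergman_nn p \<alpha> F"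
    by (rule bergman_nn_polar[symmetric]) (use p F holomorphic_on_imp_continuous_on in auto)
  finally show ?thesis unfolding M_def .
qed

section \<open>Test functions and their Bergman norms\<close>

definition geometric_block :: "nat \<Rightarrow> complex \<Rightarrow> complex" where
  "geometric_block L z = (\<Sum>j<L. z ^ (2 * L + j))"

lemma geometric_block_holomorphic: "geometric_block L holomorphic_on A"
  unfolding geometric_block_def by (intro holomorphic_intros)

text \<open>The first bound counts terms, the second comes from the closed form
  \<open>z ^ (2 * L) * (1 - z ^ L) / (1 - z)\<close>. Together they make the block behave like
  \<open>1 / (1 - z)\<close> truncated at height \<open>L\<close>.\<close>

lemma norm_geometric_block_le:
  assumes z: "cmod z < 1"
  shows "cmod (geometric_block L z) \<le> real L" "cmod (geometric_block L z) * cmod (1 - z) \<le> 2"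
proof -
  have "cmod (geometric_block L z) \<le> (\<Sum>j<L. cmod (z ^ (2 * L + j)))"
    unfolding geometric_block_def by (rule norm_sum)
  also have "\<dots> \<le> (\<Sum>j<L. 1)"
    using z by (intro sum_mono) (auto simp: norm_power intro!: power_le_one)
  finally show "cmod (geometric_block L z) \<le> real L" by simp
  have "geometric_block L z * (1 - z) = z ^ (2 * L) * (1 - z ^ L)"
    unfolding geometric_block_def power_add sum_distrib_left[symmetric]
    by (simp add: one_diff_power_eq mult.assoc mult.commute)
  then have "cmod (geometric_block L z) * cmod (1 - z) = cmod z ^ (2 * L) * cmod (1 - z ^ L)"
    by (metis norm_mult norm_power)
  also have "\<dots> \<le> 1 * (1 + 1)"
  proof (intro mult_mono)
    show "cmod z ^ (2 * L) \<le> 1" using z by (intro power_le_one) auto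
    have "cmod (1 - z ^ L) \<le> 1 + cmod z ^ L" using norm_triangle_ineq4[of 1 "z ^ L"] by (simp add: norm_power)
    also have "cmod z ^ L \<le> 1" using z by (intro power_le_one) auto
    finally show "cmod (1 - z ^ L) \<le> 1 + 1" by simp
  qed auto
  finally show "cmod (geometric_block L z) * cmod (1 - z) \<le> 2" by simp
qed

lemma norm_one_minus_cis_ge:
  assumes r: "0 \<le> r" "r < 1" and \<theta>: "0 \<le> \<theta>" "\<theta> \<le> 2 * pi"
  shows "1 - r \<le> cmod (1 - of_real r * cis \<theta>)" "min \<theta> (2 * pi - \<theta>) / 8 \<le> cmod (1 - of_real r * cis \<theta>)"
proof -
  define m where "m = min \<theta> (2 * pi - \<theta>)"
  have m: "0 \<le> m" "m \<le> 4" using \<theta> pi_less_4 by (auto simp: m_def min_def)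
  show 1: "1 - r \<le> cmod (1 - of_real r * cis \<theta>)"
    using norm_triangle_ineq2[of 1 "of_real r * cis \<theta>"] r by (simp add: norm_mult)
  have "m / 8 \<le> cmod (1 - of_real r * cis \<theta>)"
  proof (cases "r \<le> 1 / 2")
    case True
    \<comment> \<open>For small \<open>r\<close> the chord estimate degenerates, but then
      \<open>1 - r\<close> is at least 1/2, which is at least \<open>m / 8\<close> because
      \<open>m \<le> 4\<close>.\<close>
    then show ?thesis using 1 m by linarith
  next
    case False
    have "(r - 1)\<^sup>2 + r * 1 * m\<^sup>2 / 4 \<le> (cmod (of_real r * cis \<theta> - of_real 1))\<^sup>2"
      unfolding m_def by (rule norm_cis_diff_ge) (use r \<theta> in auto)
    moreover have "1 / 2 * m\<^sup>2 \<le> r * 1 * m\<^sup>2" using False by (intro mult_right_mono) auto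
    moreover have "0 \<le> (r - 1)\<^sup>2" "0 \<le> m\<^sup>2" by auto
    ultimately have "m\<^sup>2 / 64 \<le> (cmod (of_real r * cis \<theta> - of_real 1))\<^sup>2" by linarith
    then have "(m / 8)\<^sup>2 \<le> (cmod (1 - of_real r * cis \<theta>))\<^sup>2" by (simp add: power_divide norm_minus_commute)
    then show ?thesis by (rule power2_le_imp_le) simp
  qed
  then show "min \<theta> (2 * pi - \<theta>) / 8 \<le> cmod (1 - of_real r * cis \<theta>)" by (simp add: m_def)
qed

lemma le_div_max:
  fixes x :: real
  assumes "0 < l" "0 \<le> x" "x \<le> l" "x * d \<le> k" "1 \<le> k"
  shows "x \<le> k * max d (1 / l) powr (-1)"
proof -
  have M: "0 < max d (1 / l)" using assms(1) by (simp add: less_max_iff_disj)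
  have "x * max d (1 / l) \<le> k"
  proof (cases "d \<le> 1 / l")
    case True
    have "x * (1 / l) \<le> 1" using assms by simp
    then show ?thesis using True assms(5) unfolding max_absorb2[OF True] by linarith
  qed (use assms in \<open>simp add: max_def\<close>)
  then show ?thesis using M by (simp add: powr_minus_divide field_simps)
qed

text \<open>The block is at most a constant over \<open>max (1 - r) (1 / L)\<close> and also at most
  a constant over \<open>max m (1 / L)\<close>, with \<open>m\<close> the angular distance from 1.
  The two integrals contribute \<open>L powr (p1 - 1)\<close> and
  \<open>L powr (p2 - \<alpha> - 1)\<close>, with product \<open>L powr (p - 2 - \<alpha>)\<close>;
  \<open>\<alpha> < p - 2\<close> leaves room for a positive \<open>\<epsilon>\<close> in
  both.\<close>

lemma bergman_geometric_block:
  assumes p: "1 < p" and \<alpha>: "-1 < \<alpha>" "\<alpha> < p - 2"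
  obtains K where "0 < K" "\<And>L. 0 < L \<Longrightarrow> bergman_nn p \<alpha> (geometric_block L) \<le> ennreal (K * real L powr (p - 2 - \<alpha>))"
proof -
  define \<epsilon> where "\<epsilon> = (p - 2 - \<alpha>) / 2"
  \<comment> \<open>Splitting \<open>p\<close> separates the variables: \<open>p1 > 1\<close> serves the angular and \<open>p2 > \<alpha> + 1\<close> the radial integral.\<close>
  define p1 where "p1 = 1 + \<epsilon>"
  define p2 where "p2 = \<alpha> + 1 + \<epsilon>"
  have \<epsilon>: "0 < \<epsilon>" using \<alpha> by (simp add: \<epsilon>_def)
  have pp: "p1 + p2 = p" by (simp add: p1_def p2_def \<epsilon>_def field_simps)
  define k1 where "k1 = 1 / (0 + 1) - 1 / (0 + (- p1) + 1)"
  define k2 where "k2 = 1 / (\<alpha> + 1) - 1 / (\<alpha> + (- p2) + 1)"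
  have k1: "0 < k1" using \<epsilon> by (simp add: k1_def p1_def add_pos_pos)
  have k2: "0 < k2" using \<epsilon> \<alpha> by (simp add: k2_def p2_def add_pos_pos)
  define K where "K = 2 powr \<bar>\<alpha>\<bar> * 2 powr p2 * (16 powr p1 * (2 * k1)) * k2"
  show ?thesis
  proof (rule that[of K])
    show "0 < K" using k1 k2 by (simp add: K_def)
    fix L :: nat assume L: "0 < L"
    define l where "l = real L"
    have l: "0 < l" "0 < 1 / l" using L by (auto simp: l_def)
    have bc: "continuous_on (ball 0 1) (geometric_block L)"
      by (rule holomorphic_on_imp_continuous_on[OF geometric_block_holomorphic])
    have mean: "2 * pi * integral_mean p r (geometric_block L) powr p
        \<le> 2 powr p2 * max (1 - r) (1 / l) powr (- p2) * (16 powr p1 * (2 * k1) * (1 / l) powr (1 - p1))"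
      if r: "r \<in> {0<..<1}" for r
    proof -
      define c where "c = 2 powr p2 * max (1 - r) (1 / l) powr (- p2) * 16 powr p1"
      have c: "0 \<le> c" by (simp add: c_def)
      \<comment> \<open>The factor with exponent 0 only brings the bound into the shape of
        \<open>nn_integral_max_powr\<close>. The endpoints are excluded because there
        \<open>m = 0\<close> and \<open>0 powr 0 = 0\<close>; they form a null set.\<close>
      have pt: "cmod (geometric_block L (rcis r \<theta>)) powr p \<le> c * (min \<theta> (2 * pi - \<theta>) powr 0 * max (min \<theta> (2 * pi - \<theta>)) (1 / l) powr (- p1))"
        if \<theta>: "\<theta> \<in> {0<..<2*pi}" for \<theta>
      proof -
        define m where "m = min \<theta> (2 * pi - \<theta>)"
        have m: "0 < m" using \<theta> by (simp add: m_def)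
        define x where "x = cmod (geometric_block L (rcis r \<theta>))"
        have z: "cmod (rcis r \<theta>) < 1" using r by simp
        have x: "0 \<le> x" "x \<le> l" "x * cmod (1 - rcis r \<theta>) \<le> 2"
          using norm_geometric_block_le[OF z, of L] by (auto simp: x_def l_def)
        have ge: "1 - r \<le> cmod (1 - rcis r \<theta>)" "m / 8 \<le> cmod (1 - rcis r \<theta>)"
          using norm_one_minus_cis_ge[of r \<theta>] r \<theta> by (auto simp: rcis_def m_def)
        have "x * (1 - r) \<le> 2" using mult_left_mono[OF ge(1) x(1)] x(3) by linarith
        then have x1: "x \<le> 2 * max (1 - r) (1 / l) powr (-1)" using x l by (intro le_div_max) auto
        have "x * (m / 8) \<le> 2" using mult_left_mono[OF ge(2) x(1)] x(3) by linarith
        then have x2: "x \<le> 16 * max m (1 / l) powr (-1)" using x l by (intro le_div_max) auto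
        have "x powr p = x powr p2 * x powr p1" by (simp add: pp[symmetric] powr_add mult.commute)
        also have "\<dots> \<le> (2 * max (1 - r) (1 / l) powr (-1)) powr p2 * (16 * max m (1 / l) powr (-1)) powr p1"
          using x x1 x2 \<epsilon> \<alpha> by (intro mult_mono powr_mono2) (auto simp: p1_def p2_def)
        also have "\<dots> = c * (m powr 0 * max m (1 / l) powr (- p1))"
        proof -
          have "(k * X powr (-1)) powr q = k powr q * X powr (- q)" if "0 \<le> k" for k X q :: real
            using powr_powr[of X "-1" q] that by (simp only: powr_mult powr_ge_zero mult_minus1)
          moreover have "m powr 0 = 1" using m by simp
          ultimately show ?thesis unfolding c_def by (simp only: zero_le_numeral mult_1_left mult.assoc)
        qed
        finally show ?thesis by (simp add: x_def m_def)
      qed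
      have "ennreal (2 * pi * integral_mean p r (geometric_block L) powr p) = (\<integral>\<^sup>+\<theta>\<in>{0..2*pi}. ennreal (cmod (geometric_block L (rcis r \<theta>)) powr p) \<partial>lborel)"
        by (rule nn_integral_mean[OF bc, symmetric]) (use r p in auto)
      also have "\<dots> \<le> (\<integral>\<^sup>+\<theta>. ennreal c * (ennreal (min \<theta> (2 * pi - \<theta>) powr 0 * max (min \<theta> (2 * pi - \<theta>)) (1 / l) powr (- p1)) * indicator {0..2*pi} \<theta>) \<partial>lborel)"
      proof (rule nn_integral_mono_AE)
        show "AE \<theta> in lborel. ennreal (cmod (geometric_block L (rcis r \<theta>)) powr p) * indicator {0..2*pi} \<theta>
          \<le> ennreal c * (ennreal (min \<theta> (2 * pi - \<theta>) powr 0 * max (min \<theta> (2 * pi - \<theta>)) (1 / l) powr (- p1)) * indicator {0..2*pi} \<theta>)"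
          using AE_lborel_singleton[of 0] AE_lborel_singleton[of "2 * pi"]
        proof eventually_elim
          case (elim \<theta>)
          then show ?case using pt[of \<theta>] c by (auto simp: indicator_def ennreal_mult[symmetric] intro!: ennreal_leI)
        qed
      qed
      also have "\<dots> = ennreal c * (\<integral>\<^sup>+\<theta>\<in>{0..2*pi}. ennreal (min \<theta> (2 * pi - \<theta>) powr 0 * max (min \<theta> (2 * pi - \<theta>)) (1 / l) powr (- p1)) \<partial>lborel)"
        by (rule nn_integral_cmult) measurable
      also have "\<dots> \<le> ennreal c * (2 * (\<integral>\<^sup>+u\<in>{0<..}. ennreal (u powr 0 * max u (1 / l) powr (- p1)) \<partial>lborel))"
        by (intro mult_left_mono nn_integral_min_arc_le[of "\<lambda>u. ennreal (u powr 0 * max u (1 / l) powr (- p1))"]) auto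
      also have "\<dots> \<le> ennreal c * (2 * ennreal (k1 * (1 / l) powr (0 + (- p1) + 1)))"
        unfolding k1_def by (intro mult_left_mono nn_integral_max_powr l) (use \<epsilon> in \<open>auto simp: p1_def\<close>)
      also have "\<dots> = ennreal (c * (2 * (k1 * (1 / l) powr (1 - p1))))"
        using c k1 by (simp add: ennreal_mult ennreal_numeral[symmetric] del: ennreal_numeral)
      finally have "2 * pi * integral_mean p r (geometric_block L) powr p \<le> c * (2 * (k1 * (1 / l) powr (1 - p1)))"
        using c k1 by (subst (asm) ennreal_le_iff) auto
      then show ?thesis by (simp add: c_def mult_ac)
    qed
    define D where "D = 2 powr \<bar>\<alpha>\<bar> * 2 powr p2 * (16 powr p1 * (2 * k1)) * (1 / l) powr (1 - p1)"
    have D: "0 \<le> D" using k1 by (simp add: D_def)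
    have "bergman_nn p \<alpha> (geometric_block L) = (\<integral>\<^sup>+r\<in>{0<..<1}. ennreal (2 * pi * r * (1 - r\<^sup>2) powr \<alpha> * integral_mean p r (geometric_block L) powr p) \<partial>lborel)"
      by (rule bergman_nn_polar[OF bc]) (use p in auto)
    also have "\<dots> \<le> (\<integral>\<^sup>+r. ennreal D * (ennreal ((1 - r) powr \<alpha> * max (1 - r) (1 / l) powr (- p2)) * indicator {0..<1} r) \<partial>lborel)"
    proof (rule nn_integral_mono)
      fix r :: real
      show "ennreal (2 * pi * r * (1 - r\<^sup>2) powr \<alpha> * integral_mean p r (geometric_block L) powr p) * indicator {0<..<1} r
        \<le> ennreal D * (ennreal ((1 - r) powr \<alpha> * max (1 - r) (1 / l) powr (- p2)) * indicator {0..<1} r)"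
      proof (cases "r \<in> {0<..<1}")
        case True
        have "2 * pi * r * (1 - r\<^sup>2) powr \<alpha> * integral_mean p r (geometric_block L) powr p
          = r * ((1 - r\<^sup>2) powr \<alpha> * (2 * pi * integral_mean p r (geometric_block L) powr p))" by (simp add: mult_ac)
        also have "\<dots> \<le> 1 * ((2 powr \<bar>\<alpha>\<bar> * (1 - r) powr \<alpha>) * (2 powr p2 * max (1 - r) (1 / l) powr (- p2) * (16 powr p1 * (2 * k1) * (1 / l) powr (1 - p1))))"
          using True k1 by (intro mult_mono mean one_minus_square_powr_le) auto
        also have "\<dots> = D * ((1 - r) powr \<alpha> * max (1 - r) (1 / l) powr (- p2))" by (simp add: D_def mult_ac)
        finally show ?thesis using True D by (simp add: ennreal_mult'[symmetric] ennreal_leI)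
      qed simp
    qed
    also have "\<dots> = ennreal D * (\<integral>\<^sup>+r\<in>{0..<1}. ennreal ((1 - r) powr \<alpha> * max (1 - r) (1 / l) powr (- p2)) \<partial>lborel)"
      by (rule nn_integral_cmult) measurable
    also have "\<dots> \<le> ennreal D * (\<integral>\<^sup>+u\<in>{0<..}. ennreal (u powr \<alpha> * max u (1 / l) powr (- p2)) \<partial>lborel)"
      by (intro mult_left_mono nn_integral_one_minus_le[of "\<lambda>u. ennreal (u powr \<alpha> * max u (1 / l) powr (- p2))"]) auto
    also have "\<dots> \<le> ennreal D * ennreal (k2 * (1 / l) powr (\<alpha> + (- p2) + 1))"
      unfolding k2_def by (intro mult_left_mono nn_integral_max_powr l \<alpha>(1)) (use \<epsilon> in \<open>auto simp: p2_def\<close>)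
    also have "\<dots> = ennreal (D * (k2 * (1 / l) powr (\<alpha> + (- p2) + 1)))"
      using D k2 by (simp add: ennreal_mult)
    also have "D * (k2 * (1 / l) powr (\<alpha> + (- p2) + 1)) = K * l powr (p - 2 - \<alpha>)"
    proof -
      have "(1 - p1) + (\<alpha> + (- p2) + 1) = - (p - 2 - \<alpha>)" by (simp add: pp[symmetric])
      then have "(1 / l) powr (1 - p1) * (1 / l) powr (\<alpha> + (- p2) + 1) = (1 / l) powr (- (p - 2 - \<alpha>))"
        by (metis powr_add)
      moreover have "(1 / l) powr (- x) = l powr x" for x
        using l by (simp add: powr_divide powr_minus_divide)
      ultimately have "(1 / l) powr (1 - p1) * (1 / l) powr (\<alpha> + (- p2) + 1) = l powr (p - 2 - \<alpha>)"
        by (simp only:)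
      then show ?thesis by (simp add: D_def K_def mult_ac)
    qed
    finally show "bergman_nn p \<alpha> (geometric_block L) \<le> ennreal (K * real L powr (p - 2 - \<alpha>))" by (simp add: l_def)
  qed
qed

section \<open>Recovering the derivative of \<open>g\<close> from images of monomials\<close>

lemma set_integrable_power: "set_integrable lborel {0..<1} (\<lambda>t. (of_real t :: complex) ^ m)"
  by (rule set_integrable_subset[OF set_integrable_continuous[of _ 0 1]]) (auto intro!: continuous_intros)

text \<open>The substitution \<open>u = t * z\<close> turns \<open>z ^ (m + 1)\<close> times the
  image into the increment from 0 to \<open>z\<close> of a primitive of
  \<open>w ^ m * deriv g w\<close>. Differentiating and cancelling \<open>z ^ m\<close> gives the
  equation, whence \<open>z \<noteq> 0\<close>.\<close>

lemma gen_hilbert_power_ode: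
  assumes g: "g holomorphic_on ball 0 1" and z: "cmod z < 1" "z \<noteq> 0"
  shows "z * deriv (gen_hilbert g (\<lambda>w. w ^ m)) z + of_nat (m + 1) * gen_hilbert g (\<lambda>w. w ^ m) z = deriv g z"
proof -
  define G where "G = deriv g"
  define T where "T = gen_hilbert g (\<lambda>w. w ^ m)"
  have G: "G holomorphic_on ball 0 1" unfolding G_def by (rule holomorphic_deriv[OF g open_ball])
  have Gc: "continuous_on (ball 0 1) G" by (rule holomorphic_on_imp_continuous_on[OF G])
  have T: "T holomorphic_on ball 0 1"
    unfolding T_def by (rule gen_hilbert_holomorphic[OF g _ set_integrable_power]) (intro holomorphic_intros)
  have "(\<lambda>w. w ^ m * G w) holomorphic_on ball 0 1" by (intro holomorphic_intros G)
  then obtain P where P: "\<And>w. w \<in> ball 0 1 \<Longrightarrow> (P has_field_derivative w ^ m * G w) (at w)"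
    using holomorphic_convex_primitive'[of "ball 0 1" "\<lambda>w. w ^ m * G w"] by (auto simp: at_within_open[OF _ open_ball])
  have TP: "w ^ (m + 1) * T w = P w - P 0" if w: "w \<in> ball 0 1" for w
  proof -
    have tw: "of_real t * w \<in> ball 0 1" if "t \<in> {0..1}" for t
      using that w mult_right_mono[of t 1 "cmod w"] by (auto simp: norm_mult)
    have c: "continuous_on {0..1} (\<lambda>t. of_real t ^ m * G (of_real t * w))"
      by (intro continuous_intros continuous_on_compose2[OF Gc]) (use tw in auto)
    have "T w = integral {0..1} (\<lambda>t. of_real t ^ m * G (of_real t * w))"
      unfolding T_def gen_hilbert_def G_def[symmetric]
      using interval_integral_eq_integral[OF _ borel_integrable_atLeastAtMost'[OF c]] by (simp add: zero_ereal_def one_ereal_def)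
    then have "((\<lambda>t. of_real t ^ m * G (of_real t * w)) has_integral T w) {0..1}"
      using integrable_integral[OF integrable_continuous_interval[OF c]] by simp
    then have "((\<lambda>t. w ^ (m + 1) * (of_real t ^ m * G (of_real t * w))) has_integral w ^ (m + 1) * T w) {0..1}"
      by (rule has_integral_mult_right)
    moreover have "((\<lambda>t. w ^ (m + 1) * (of_real t ^ m * G (of_real t * w))) has_integral (P (of_real 1 * w) - P (of_real 0 * w))) {0..1}"
    proof (rule fundamental_theorem_of_calculus)
      fix t :: real assume t: "t \<in> {0..1}"
      have "((\<lambda>t. of_real t * w) has_vector_derivative w) (at t)"
        by (auto intro!: derivative_eq_intros)
      from field_vector_diff_chain_at[OF this P[OF tw[OF t]]]
      have V: "((\<lambda>t. P (of_real t * w)) has_vector_derivative w * ((of_real t * w) ^ m * G (of_real t * w))) (at t)"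
        by (simp add: o_def)
      show "((\<lambda>t. P (of_real t * w)) has_vector_derivative w ^ (m + 1) * (of_real t ^ m * G (of_real t * w))) (at t within {0..1})"
      proof -
        have "w ^ (m + 1) * (of_real t ^ m * G (of_real t * w)) = w * ((of_real t * w) ^ m * G (of_real t * w))"
          unfolding power_mult_distrib power_add by (simp only: power_one_right mult_ac)
        then show ?thesis using V by (simp only: has_vector_derivative_at_within)
      qed
    qed simp
    ultimately show ?thesis by (auto dest: has_integral_unique)
  qed
  have zb: "z \<in> ball 0 1" using z by simp
  have "(T has_field_derivative deriv T z) (at z)" by (rule holomorphic_derivI[OF T open_ball zb])
  moreover have "((\<lambda>w. w ^ (m + 1)) has_field_derivative of_nat (m + 1) * z ^ m) (at z)"
    by (rule DERIV_power[OF DERIV_ident, THEN DERIV_cong]) simp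
  ultimately have "((\<lambda>w. w ^ (m + 1) * T w) has_field_derivative (of_nat (m + 1) * z ^ m * T z + deriv T z * z ^ (m + 1))) (at z)"
    by (intro DERIV_mult)
  moreover have "((\<lambda>w. w ^ (m + 1) * T w) has_field_derivative z ^ m * G z) (at z)"
  proof (rule has_field_derivative_transform_within_open[where S="ball 0 1" and f="\<lambda>w. P w - P 0"])
    show "((\<lambda>w. P w - P 0) has_field_derivative z ^ m * G z) (at z)"
      using P[OF zb] by (auto intro!: derivative_eq_intros)
  qed (use zb TP in auto)
  ultimately have "of_nat (m + 1) * z ^ m * T z + deriv T z * z ^ (m + 1) = z ^ m * G z"
    by (rule DERIV_unique)
  then have "z ^ m * (z * deriv T z + of_nat (m + 1) * T z) = z ^ m * G z"
    by (simp add: algebra_simps)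
  then show ?thesis using z by (simp add: T_def G_def)
qed

lemma gen_hilbert_geometric_block:
  assumes g: "g holomorphic_on ball 0 1" and z: "cmod z < 1"
  shows "gen_hilbert g (geometric_block L) z = (\<Sum>j<L. gen_hilbert g (\<lambda>w. w ^ (2 * L + j)) z)"
proof -
  have Gc: "continuous_on (ball 0 1) (deriv g)"
    by (rule holomorphic_on_imp_continuous_on[OF holomorphic_deriv[OF g open_ball]])
  have int: "set_integrable lborel {0..<1} (\<lambda>t. of_real t ^ (2 * L + j) * deriv g (of_real t * z))" for j
  proof (rule set_integrable_subset)
    have "of_real t * z \<in> ball 0 1" if "t \<in> {0..1}" for t
      using that z mult_right_mono[of t 1 "cmod z"] by (auto simp: norm_mult)
    then show "set_integrable lborel {0..1} (\<lambda>t. of_real t ^ (2 * L + j) * deriv g (of_real t * z))"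
      by (intro borel_integrable_atLeastAtMost' continuous_intros continuous_on_compose2[OF Gc]) auto
  qed auto
  show ?thesis
    unfolding gen_hilbert_eq geometric_block_def sum_distrib_right set_lebesgue_integral_def scaleR_sum_right
    by (rule Bochner_Integration.integral_sum) (use int in \<open>simp add: set_integrable_def\<close>)
qed

text \<open>The mean of \<open>deriv g\<close> at \<open>t * r\<close> is at most that at
  \<open>r\<close>, and \<open>t ^ m\<close> integrates to \<open>1 / (m + 1)\<close>. This decay in
  \<open>m\<close> is what makes the error term of the block identity absorbable.\<close>

lemma integral_mean_gen_hilbert_power_le:
  assumes g: "g holomorphic_on ball 0 1" and p: "1 < p" and r: "0 \<le> r" "r < 1"
  shows "integral_mean p r (gen_hilbert g (\<lambda>w. w ^ m)) \<le> integral_mean p r (deriv g) / (real m + 1)"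
proof -
  define M where "M = integral_mean p r (deriv g)"
  have "ennreal (integral_mean p r (gen_hilbert g (\<lambda>w. w ^ m))) \<le>
    (\<integral>\<^sup>+t\<in>{0..<1}. ennreal (cmod (of_real t ^ m) * integral_mean p (t * r) (deriv g)) \<partial>lborel)"
    by (rule integral_mean_gen_hilbert_le[OF g _ p set_integrable_power r]) (intro holomorphic_intros)
  also have "\<dots> \<le> (\<integral>\<^sup>+t. ennreal (t ^ m * M) * indicator {0..1} t \<partial>lborel)"
  proof (rule nn_integral_mono)
    fix t :: real
    show "ennreal (cmod (of_real t ^ m) * integral_mean p (t * r) (deriv g)) * indicator {0..<1} t \<le> ennreal (t ^ m * M) * indicator {0..1} t"
    proof (cases "t \<in> {0..<1}")
      case True
      then have "0 \<le> t * r" "t * r \<le> r" using r mult_right_mono[of t 1 r] by auto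
      then have "integral_mean p (t * r) (deriv g) \<le> M"
        unfolding M_def using r by (intro integral_mean_mono[OF holomorphic_deriv[OF g open_ball] p]) auto
      then show ?thesis using True by (auto simp: norm_power intro!: ennreal_leI mult_left_mono)
    qed simp
  qed
  also have "\<dots> = ennreal (M / (real m + 1) * 1 ^ (m + 1) - M / (real m + 1) * 0 ^ (m + 1))"
  proof (rule nn_integral_FTC_Icc)
    fix t :: real
    have "((\<lambda>t. M / (real m + 1) * t ^ (m + 1)) has_field_derivative M / (real m + 1) * (real (m + 1) * t ^ m)) (at t)"
      using DERIV_pow[of "m + 1" t] by (intro DERIV_cmult) simp
    then show "((\<lambda>t. M / (real m + 1) * t ^ (m + 1)) has_real_derivative t ^ m * M) (at t)"
    proof -
      have "M / (real m + 1) * (real (m + 1) * t ^ m) = (M / (real m + 1) * real (m + 1)) * t ^ m" by (simp only: mult.assoc)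
      also have "M / (real m + 1) * real (m + 1) = M" by (simp add: add.commute)
      finally have "M / (real m + 1) * (real (m + 1) * t ^ m) = t ^ m * M" by (simp only: mult.commute)
      with \<open>(_ has_field_derivative _) (at t)\<close> show ?thesis by (simp only:)
    qed
  qed (auto simp: M_def)
  finally show ?thesis by (simp add: M_def)
qed

lemma circle_pairing_add:
  assumes "continuous_on (ball 0 1) F" "continuous_on (ball 0 1) G" "continuous_on UNIV c" "cmod z < 1"
  shows "circle_pairing c (\<lambda>w. F w + G w) z = circle_pairing c F z + circle_pairing c G z"
  using set_integral_add(2)[OF circle_pairing_integrable[OF assms(1,3,4)] circle_pairing_integrable[OF assms(2,3,4)]]
  by (simp add: circle_pairing_def distrib_left add_divide_distrib)

lemma circle_pairing_cmult: "circle_pairing c (\<lambda>w. k * F w) z = k * circle_pairing c F z"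
  by (simp add: circle_pairing_def mult.left_commute[of _ k])

lemma circle_pairing_sum:
  assumes "finite I" "\<And>i. i \<in> I \<Longrightarrow> continuous_on (ball 0 1) (F i)" "continuous_on UNIV c" "cmod z < 1"
  shows "circle_pairing c (\<lambda>w. \<Sum>i\<in>I. F i w) z = (\<Sum>i\<in>I. circle_pairing c (F i) z)"
  using assms(1,2)
proof (induction I rule: finite_induct)
  case empty
  show ?case by (simp add: circle_pairing_def set_lebesgue_integral_def)
next
  case (insert i I)
  have "circle_pairing c (\<lambda>w. F i w + (\<Sum>i\<in>I. F i w)) z = circle_pairing c (F i) z + circle_pairing c (\<lambda>w. \<Sum>i\<in>I. F i w) z"
    by (rule circle_pairing_add[OF _ _ assms(3,4)]) (use insert in \<open>auto intro!: continuous_on_sum\<close>)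
  then show ?case using insert by simp
qed

text \<open>The identity \<open>L g' = z F' + 2 L F + (\<Sum>j<L. (j + 1) F\<^sub>j)\<close> for \<open>F = (\<Sum>j<L. F\<^sub>j)\<close>, where \<open>F\<^sub>j\<close> is the image
  of \<open>z^(2L+j)\<close>, recovers \<open>g'\<close>: the last sum has mean at most half that of \<open>L g'\<close> and is absorbed.\<close>

lemma integral_mean_deriv_le_block:
  assumes g: "g holomorphic_on ball 0 1" and p: "1 < p" and L: "0 < L" and r: "0 < r" "r < R" "R < 1"
  shows "real L * integral_mean p r (deriv g)
    \<le> (2 / (R - r) + 4 * real L) * integral_mean p R (gen_hilbert g (geometric_block L))"
proof -
  define M where "M = integral_mean p r (deriv g)"
  define T where "T j = gen_hilbert g (\<lambda>w. w ^ (2 * L + j))" for j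
  define F where "F = gen_hilbert g (geometric_block L)"
  have r1: "0 \<le> r" "r < 1" using r by auto
  have Tj: "T j holomorphic_on ball 0 1" for j
    unfolding T_def by (rule gen_hilbert_holomorphic[OF g _ set_integrable_power]) (intro holomorphic_intros)
  have Tjc: "continuous_on (ball 0 1) (T j)" for j by (rule holomorphic_on_imp_continuous_on[OF Tj])
  have FT: "F w = (\<Sum>j<L. T j w)" if "cmod w < 1" for w
    unfolding F_def T_def by (rule gen_hilbert_geometric_block[OF g that])
  have F: "F holomorphic_on ball 0 1"
    by (rule holomorphic_transform[of "\<lambda>w. \<Sum>j<L. T j w"]) (use Tj FT in \<open>auto intro!: holomorphic_intros\<close>)
  have Fc: "continuous_on (ball 0 1) F" by (rule holomorphic_on_imp_continuous_on[OF F])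
  have dF: "deriv F w = (\<Sum>j<L. deriv (T j) w)" if w: "cmod w < 1" for w
  proof (rule DERIV_imp_deriv)
    have "((\<lambda>w. \<Sum>j<L. T j w) has_field_derivative (\<Sum>j<L. deriv (T j) w)) (at w)"
      using w by (intro DERIV_sum holomorphic_derivI[OF Tj open_ball]) auto
    then show "(F has_field_derivative (\<Sum>j<L. deriv (T j) w)) (at w)"
      by (rule has_field_derivative_transform_within_open[where S="ball 0 1"]) (use w FT in auto)
  qed
  have Gc: "continuous_on (ball 0 1) (deriv g)"
    by (rule holomorphic_on_imp_continuous_on[OF holomorphic_deriv[OF g open_ball]])
  have dFc: "continuous_on (ball 0 1) (deriv F)"
    by (rule holomorphic_on_imp_continuous_on[OF holomorphic_deriv[OF F open_ball]])
  have ode: "of_nat L * deriv g w = w * deriv F w + (of_nat (2 * L) * F w + (\<Sum>j<L. of_nat (j + 1) * T j w))"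
    if w: "cmod w < 1" "w \<noteq> 0" for w
  proof -
    have "of_nat L * deriv g w = (\<Sum>j<L. w * deriv (T j) w + of_nat (2 * L + j + 1) * T j w)"
      unfolding T_def gen_hilbert_power_ode[OF g w] by simp
    also have "\<dots> = (\<Sum>j<L. w * deriv (T j) w + (of_nat (2 * L) * T j w + of_nat (j + 1) * T j w))"
      by (intro sum.cong refl) (simp add: algebra_simps)
    also have "\<dots> = w * deriv F w + (of_nat (2 * L) * F w + (\<Sum>j<L. of_nat (j + 1) * T j w))"
      unfolding dF[OF w(1)] FT[OF w(1)] by (simp add: sum.distrib sum_distrib_left)
    finally show ?thesis .
  qed
  from circle_pairing_attains[OF Gc p r1] obtain c where
    c: "c \<in> dual_ball p" "circle_pairing c (deriv g) (of_real r) = of_real M" by (auto simp: M_def)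
  note cc = dual_ball_continuous[OF c(1)]
  have rc: "cmod (of_real r) < 1" using r1 by simp
  have "of_nat L * circle_pairing c (deriv g) (of_real r)
    = circle_pairing c (\<lambda>w. w * deriv F w + (of_nat (2 * L) * F w + (\<Sum>j<L. of_nat (j + 1) * T j w))) (of_real r)"
  proof -
    have eq: "of_nat L * deriv g (of_real r * cis \<theta>) = of_real r * cis \<theta> * deriv F (of_real r * cis \<theta>) + (of_nat (2 * L) * F (of_real r * cis \<theta>)
        + (\<Sum>j<L. of_nat (j + 1) * T j (of_real r * cis \<theta>)))" for \<theta>
      by (rule ode) (use r r1 in \<open>auto simp: norm_mult\<close>)
    have "of_nat L * circle_pairing c (deriv g) (of_real r) = circle_pairing c (\<lambda>w. of_nat L * deriv g w) (of_real r)"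
      by (rule circle_pairing_cmult[symmetric])
    also have "\<dots> = circle_pairing c (\<lambda>w. w * deriv F w + (of_nat (2 * L) * F w + (\<Sum>j<L. of_nat (j + 1) * T j w))) (of_real r)"
      unfolding circle_pairing_def eq ..
    finally show ?thesis .
  qed
  also have "\<dots> = circle_pairing c (\<lambda>w. w * deriv F w) (of_real r) + (of_nat (2 * L) * circle_pairing c F (of_real r)
      + (\<Sum>j<L. of_nat (j + 1) * circle_pairing c (T j) (of_real r)))"
    by (subst circle_pairing_add circle_pairing_sum, (intro continuous_intros Fc dFc Tjc cc rc finite_lessThan)+)+
       (simp add: circle_pairing_cmult)
  finally have "real L * M = cmod (circle_pairing c (\<lambda>w. w * deriv F w) (of_real r) + (of_nat (2 * L) * circle_pairing c F (of_real r)
      + (\<Sum>j<L. of_nat (j + 1) * circle_pairing c (T j) (of_real r))))"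
    unfolding c(2) by (metis M_def abs_of_nonneg integral_mean_nonneg mult_nonneg_nonneg norm_of_real of_nat_0_le_iff of_real_mult of_real_of_nat_eq)
  also have "\<dots> \<le> cmod (circle_pairing c (\<lambda>w. w * deriv F w) (of_real r)) + (cmod (of_nat (2 * L) * circle_pairing c F (of_real r))
      + (\<Sum>j<L. cmod (of_nat (j + 1) * circle_pairing c (T j) (of_real r))))"
    by (intro order_trans[OF norm_triangle_ineq] add_mono norm_sum order_refl)
  also have "\<dots> \<le> integral_mean p R F / (R - r) + (2 * real L * integral_mean p R F + (\<Sum>j<L. M / 2))"
  proof (intro add_mono sum_mono)
    \<comment> \<open>On the circle of radius \<open>r\<close> the factor \<open>w\<close> is the
      constant \<open>r\<close> times \<open>cis \<theta>\<close>, and the latter goes into the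
      multiplier without leaving \<open>dual_ball p\<close>.\<close>
    have "circle_pairing c (\<lambda>w. w * deriv F w) (of_real r) = of_real r * circle_pairing (\<lambda>\<theta>. c \<theta> * cis \<theta>) (deriv F) (of_real r)"
      unfolding circle_pairing_cmult[symmetric] by (simp add: circle_pairing_def mult_ac)
    then have "cmod (circle_pairing c (\<lambda>w. w * deriv F w) (of_real r)) = r * cmod (circle_pairing (\<lambda>\<theta>. c \<theta> * cis \<theta>) (deriv F) (of_real r))"
      using r by (simp add: norm_mult)
    also have "\<dots> \<le> 1 * integral_mean p (cmod (of_real r)) (deriv F)"
      using r by (intro mult_mono norm_circle_pairing_le[OF dFc _ p rc] dual_ball_cis[OF c(1)]) (auto intro!: continuous_intros)
    also have "\<dots> \<le> integral_mean p R F / (R - r)"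
      using integral_mean_deriv_le[OF F p r1(1) r(2,3)] r by simp
    finally show "cmod (circle_pairing c (\<lambda>w. w * deriv F w) (of_real r)) \<le> integral_mean p R F / (R - r)" .
    have "cmod (circle_pairing c F (of_real r)) \<le> integral_mean p R F"
      using norm_circle_pairing_le[OF Fc c(1) p rc] integral_mean_mono[OF F p r1(1), of R] r by simp
    then show "cmod (of_nat (2 * L) * circle_pairing c F (of_real r)) \<le> 2 * real L * integral_mean p R F"
      by (simp add: norm_mult mult_left_mono)
    fix j assume j: "j \<in> {..<L}"
    have "cmod (circle_pairing c (T j) (of_real r)) \<le> M / (real (2 * L + j) + 1)"
      using norm_circle_pairing_le[OF Tjc c(1) p rc, of j] integral_mean_gen_hilbert_power_le[OF g p r1, of "2 * L + j"] r
      by (simp add: T_def M_def)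
    then have "real (j + 1) * cmod (circle_pairing c (T j) (of_real r)) \<le> real (j + 1) * (M / (real (2 * L + j) + 1))"
      by (intro mult_left_mono) auto
    also have "\<dots> = M * (real (j + 1) / (real (2 * L + j) + 1))" by simp
    \<comment> \<open>The quotient is at most 1/2 because \<open>j + 1 \<le> 2 * L\<close>; this is
      the use of exponents starting at \<open>2 * L\<close>.\<close>
    also have "\<dots> \<le> M * (1 / 2)"
      using j by (intro mult_left_mono) (auto simp: field_simps M_def)
    finally show "cmod (of_nat (j + 1) * circle_pairing c (T j) (of_real r)) \<le> M / 2" by (simp only: norm_mult norm_of_nat)
  qed
  also have "(\<Sum>j<L. M / 2) = real L * M / 2" by simp
  finally have "real L * M \<le> 2 * (integral_mean p R F / (R - r) + 2 * real L * integral_mean p R F)" by simp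
  then show ?thesis by (simp add: M_def F_def algebra_simps)
qed

lemma bounded_imp_mean_growth:
  assumes p: "1 < p" and \<alpha>: "-1 < \<alpha>" "\<alpha> < p - 2" and g: "g holomorphic_on ball 0 1"
    and bd: "bounded_on_bergman p \<alpha> (gen_hilbert g)"
  shows "mean_growth p (1 / p) g"
proof -
  have p0: "0 < p" using p by simp
  have dg: "deriv g holomorphic_on ball 0 1" by (rule holomorphic_deriv[OF g open_ball])
  obtain C' where C': "\<And>f. f \<in> bergman_space p \<alpha> \<Longrightarrow> bergman_norm p \<alpha> (gen_hilbert g f) \<le> C' * bergman_norm p \<alpha> f"
    and mem: "\<And>f. f \<in> bergman_space p \<alpha> \<Longrightarrow> gen_hilbert g f \<in> bergman_space p \<alpha>"
    using bd by (auto simp: bounded_on_bergman_def)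
  \<comment> \<open>The constant provided by boundedness may fail to be positive.\<close>
  define C where "C = max C' 1"
  have C: "0 < C" by (simp add: C_def)
  have nn: "bergman_nn p \<alpha> (gen_hilbert g f) \<le> ennreal (C powr p) * bergman_nn p \<alpha> f" if f: "f \<in> bergman_space p \<alpha>" for f
  proof -
    have fh: "f holomorphic_on ball 0 1" "bergman_nn p \<alpha> f < \<infinity>" and Th: "gen_hilbert g f holomorphic_on ball 0 1" "bergman_nn p \<alpha> (gen_hilbert g f) < \<infinity>"
      using f mem[OF f] p0 by (auto simp: bergman_space_iff)
    define x y where "x = enn2real (bergman_nn p \<alpha> (gen_hilbert g f))" and "y = enn2real (bergman_nn p \<alpha> f)"
    have xy: "bergman_nn p \<alpha> (gen_hilbert g f) = ennreal x" "bergman_nn p \<alpha> f = ennreal y" "0 \<le> x" "0 \<le> y"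
      using fh Th by (auto simp: x_def y_def less_top)
    define k where "k = (\<alpha> + 1) * (1 / pi)"
    have k: "0 < k" using \<alpha> by (simp add: k_def)
    have "(k * x) powr (1 / p) \<le> C' * (k * y) powr (1 / p)"
      using C'[OF f] unfolding bergman_norm_eq[OF Th(1) p0] bergman_norm_eq[OF fh(1) p0] by (simp add: k_def x_def y_def mult.assoc)
    also have "\<dots> \<le> C * (k * y) powr (1 / p)" by (intro mult_right_mono) (auto simp: C_def)
    finally have "((k * x) powr (1 / p)) powr p \<le> (C * (k * y) powr (1 / p)) powr p"
      using p0 by (intro powr_mono2) auto
    then have "k * x \<le> k * (C powr p * y)" using k xy p0 C by (simp add: powr_mult powr_powr mult_ac)
    then have "x \<le> C powr p * y" using k by simp
    then show ?thesis unfolding xy(1,2) using xy(4) by (simp add: ennreal_mult[symmetric] ennreal_leI)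
  qed
  obtain K where K: "0 < K" "\<And>L. 0 < L \<Longrightarrow> bergman_nn p \<alpha> (geometric_block L) \<le> ennreal (K * real L powr (p - 2 - \<alpha>))"
    using bergman_geometric_block[OF p \<alpha>] by blast
  define k where "k = pi / (2 powr \<bar>\<alpha>\<bar> * (\<alpha> + 1))"
  have k: "0 < k" using \<alpha> by (simp add: k_def)
  define D where "D = C powr p * K / k"
  have D: "0 < D" using C K k by (simp add: D_def)
  \<comment> \<open>The mean at \<open>R\<close> is bounded by the norm of the image, this by the
    norm of the block, and the latter by the explicit power of \<open>L\<close>. The parameters
    \<open>L\<close> and \<open>R\<close> are still independent here.\<close>
  have block: "integral_mean p R (gen_hilbert g (geometric_block L)) \<le> (D * real L powr (p - 2 - \<alpha>) * (1 - R) powr (- (\<alpha> + 1))) powr (1 / p)"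
    if L: "0 < L" and R: "1 / 2 \<le> R" "R < 1" for L R
  proof -
    have mb: "geometric_block L \<in> bergman_space p \<alpha>"
    proof -
      have "bergman_nn p \<alpha> (geometric_block L) < \<infinity>"
        using K(2)[OF L] by (rule order.strict_trans1) simp
      then show ?thesis using p0 geometric_block_holomorphic by (simp add: bergman_space_iff)
    qed
    have Fh: "gen_hilbert g (geometric_block L) holomorphic_on ball 0 1"
      using mem[OF mb] p0 by (simp add: bergman_space_iff)
    define M where "M = integral_mean p R (gen_hilbert g (geometric_block L))"
    have "ennreal (k * (M powr p * (1 - R) powr (\<alpha> + 1))) \<le> bergman_nn p \<alpha> (gen_hilbert g (geometric_block L))"
      unfolding k_def M_def by (rule integral_mean_le_bergman[OF Fh p \<alpha>(1) R])
    also have "\<dots> \<le> ennreal (C powr p) * bergman_nn p \<alpha> (geometric_block L)" by (rule nn[OF mb])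
    also have "\<dots> \<le> ennreal (C powr p) * ennreal (K * real L powr (p - 2 - \<alpha>))"
      by (intro mult_left_mono K(2) L) auto
    also have "\<dots> = ennreal (C powr p * (K * real L powr (p - 2 - \<alpha>)))"
      using K by (simp add: ennreal_mult)
    finally have "k * (M powr p * (1 - R) powr (\<alpha> + 1)) \<le> C powr p * (K * real L powr (p - 2 - \<alpha>))"
      using K by (subst (asm) ennreal_le_iff) auto
    then have "M powr p * (1 - R) powr (\<alpha> + 1) \<le> D * real L powr (p - 2 - \<alpha>)"
      using k by (simp add: D_def field_simps)
    then have "M powr p * (1 - R) powr (\<alpha> + 1) * (1 - R) powr (- (\<alpha> + 1)) \<le> D * real L powr (p - 2 - \<alpha>) * (1 - R) powr (- (\<alpha> + 1))"
      by (intro mult_right_mono) auto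
    moreover have "(1 - R) powr (\<alpha> + 1) * (1 - R) powr (- (\<alpha> + 1)) = 1"
      using R by (simp add: powr_add[symmetric])
    ultimately have "M powr p \<le> D * real L powr (p - 2 - \<alpha>) * (1 - R) powr (- (\<alpha> + 1))"
      by (simp add: mult.assoc)
    then have "(M powr p) powr (1 / p) \<le> (D * real L powr (p - 2 - \<alpha>) * (1 - R) powr (- (\<alpha> + 1))) powr (1 / p)"
      using p0 by (intro powr_mono2) auto
    then show ?thesis using p0 by (simp add: M_def powr_powr)
  qed
  define E where "E = 8 * (D * 2 powr (p - 2 - \<alpha>) * 2 powr (\<alpha> + 1)) powr (1 / p)"
  have E: "0 < E" using D by (simp add: E_def)
  have main: "integral_mean p r (deriv g) \<le> E * (1 - r) powr (1 / p - 1)" if r: "1 / 2 \<le> r" "r < 1" for r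
  proof -
    define s where "s = 1 - r"
    define R where "R = (1 + r) / 2"
    \<comment> \<open>With \<open>L\<close> between \<open>1 / s\<close> and \<open>2 / s\<close>,
      the loss \<open>2 / (R - r) = 4 / s\<close> from differentiation is at most
      \<open>4 * L\<close>, of the same order as the term already present.\<close>
    define L where "L = nat \<lceil>1 / s\<rceil>"
    have s: "0 < s" "s \<le> 1 / 2" using r by (auto simp: s_def)
    have R: "1 / 2 \<le> R" "R < 1" "r < R" "1 - R = s / 2" "R - r = s / 2" using r by (auto simp: R_def s_def field_simps)
    have "2 \<le> 1 / s" using s by (simp add: field_simps)
    then have L: "1 / s \<le> real L" "real L \<le> 2 / s" "0 < L"
    proof -
      show 1: "1 / s \<le> real L" unfolding L_def by (rule real_nat_ceiling_ge)
      have "0 \<le> \<lceil>1 / s\<rceil>" using \<open>2 \<le> 1 / s\<close> by linarith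
      then have "real L = of_int \<lceil>1 / s\<rceil>" unfolding L_def by simp
      also have "\<dots> \<le> 1 / s + 1" by linarith
      also have "\<dots> \<le> 1 / s + 1 / s" using \<open>2 \<le> 1 / s\<close> by simp
      finally show "real L \<le> 2 / s" by simp
      have "0 < real L" using 1 \<open>2 \<le> 1 / s\<close> by linarith
      then show "0 < L" by simp
    qed
    define M where "M = integral_mean p R (gen_hilbert g (geometric_block L))"
    have "real L * integral_mean p r (deriv g) \<le> (2 / (s / 2) + 4 * real L) * M"
      using integral_mean_deriv_le_block[OF g p L(3), of r R] r R by (simp add: M_def)
    also have "\<dots> \<le> (8 * real L) * M"
      using L(1) by (intro mult_right_mono) (auto simp: M_def)
    finally have "real L * integral_mean p r (deriv g) \<le> real L * (8 * M)" by simp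
    then have "integral_mean p r (deriv g) \<le> 8 * M" using L(3) by simp
    also have "M \<le> (D * real L powr (p - 2 - \<alpha>) * (s / 2) powr (- (\<alpha> + 1))) powr (1 / p)"
      unfolding M_def R(4)[symmetric] by (rule block[OF L(3) R(1,2)])
    also have "\<dots> \<le> (D * (2 / s) powr (p - 2 - \<alpha>) * (s / 2) powr (- (\<alpha> + 1))) powr (1 / p)"
      using L D p0 \<alpha> by (intro powr_mono2 mult_right_mono mult_left_mono) auto
    \<comment> \<open>Here \<alpha> cancels:
      \<open>(p - 2 - \<alpha>) + (\<alpha> + 1) = p - 1\<close>, and the \<open>p\<close>-th root
      of \<open>s powr (1 - p)\<close> is \<open>s powr (1 / p - 1)\<close>.\<close>
    also have "D * (2 / s) powr (p - 2 - \<alpha>) * (s / 2) powr (- (\<alpha> + 1)) = D * 2 powr (p - 2 - \<alpha>) * 2 powr (\<alpha> + 1) * s powr (1 - p)"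
    proof -
      have "(2 / s) powr x = 2 powr x * s powr (- x)" "(s / 2) powr (- x) = 2 powr x * s powr (- x)" for x
        using s by (simp_all add: powr_divide powr_minus_divide)
      note this(1)[of "p - 2 - \<alpha>"] this(2)[of "\<alpha> + 1"]
      moreover have "s powr (- (p - 2 - \<alpha>)) * s powr (- (\<alpha> + 1)) = s powr (1 - p)"
        by (simp add: powr_add[symmetric])
      ultimately show ?thesis by (simp add: mult_ac)
    qed
    also have "8 * (D * 2 powr (p - 2 - \<alpha>) * 2 powr (\<alpha> + 1) * s powr (1 - p)) powr (1 / p) = E * s powr (1 / p - 1)"
    proof -
      have "(1 - p) * (1 / p) = 1 / p - 1" using p0 by (simp add: field_simps)
      then show ?thesis using D by (simp add: E_def powr_mult powr_powr)
    qed
    finally show ?thesis by (simp add: s_def)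
  qed
  \<comment> \<open>The added mean covers the radii below 1/2, where
    \<open>(1 - r) powr (1 / p - 1)\<close> is at least 1.\<close>
  define C0 where "C0 = E + integral_mean p (1 / 2) (deriv g)"
  have "integral_mean p r (deriv g) \<le> C0 * (1 - r) powr (1 / p - 1)" if r: "0 \<le> r" "r < 1" for r
  proof (cases "1 / 2 \<le> r")
    case True
    have "E * (1 - r) powr (1 / p - 1) \<le> C0 * (1 - r) powr (1 / p - 1)"
      by (intro mult_right_mono) (auto simp: C0_def)
    with main[OF True r(2)] show ?thesis by linarith
  next
    case False
    have "1 powr (1 / p - 1) \<le> (1 - r) powr (1 / p - 1)" using r p by (intro powr_mono2') auto
    then have "integral_mean p (1 / 2) (deriv g) * 1 \<le> C0 * (1 - r) powr (1 / p - 1)"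
      using E by (intro mult_mono) (auto simp: C0_def)
    moreover have "integral_mean p r (deriv g) \<le> integral_mean p (1 / 2) (deriv g)"
      by (rule integral_mean_mono[OF dg p]) (use r False in auto)
    ultimately show ?thesis by linarith
  qed
  then show ?thesis by (auto simp: mean_growth_def)
qed

theorem theorem3:
  fixes p \<alpha> :: real and g :: "complex \<Rightarrow> complex"
  assumes "1 < p" and "-1 < \<alpha>" and "\<alpha> < p - 2"
    and "g holomorphic_on ball 0 1"
  shows "bounded_on_bergman p \<alpha> (gen_hilbert g) \<longleftrightarrow> g \<in> mean_lipschitz p (1 / p)"
proof
  assume "bounded_on_bergman p \<alpha> (gen_hilbert g)"
  then have "mean_growth p (1 / p) g"
    by (rule bounded_imp_mean_growth[OF assms])
  then show "g \<in> mean_lipschitz p (1 / p)"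
    by (rule mean_growth_imp_mean_lipschitz[OF assms(4,1), rotated -1]) (use assms(1) in auto)
next
  assume "g \<in> mean_lipschitz p (1 / p)"
  then have "mean_growth p (1 / p) g"
    by (rule mean_lipschitz_imp_mean_growth) (use assms(1) in auto)
  then show "bounded_on_bergman p \<alpha> (gen_hilbert g)"
    by (rule mean_growth_imp_bounded[OF assms])
qed

end
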